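(* Let $\Bbbk$ be any field. Let $M$ (resp. $\mathcal M$) be a simple supersolvable matroid (resp. simple supersolvable oriented matroid) of rank $r$ on $E=\{1,\dots,n\}$ with a complete flag $\emptyset=F_0\subsetneq F_1\subsetneq\cdots\subsetneq F_r=E$ of modular flats, let $F=F_{r-1}$ and $E_r=E\setminus F$. Let $G$ be a group of automorphisms of $M$ (resp. $\mathcal M$), let $H=\{g\in G: g(F)=F\}$, and let $\mathcal X=\Bbbk[E_r]$ be the permutation (resp. signed permutation) $\Bbbk H$-module on $E_r$. Let $A=\mathrm{OS}(M)$ and $B=\mathrm{OS}(M|_F)$ (resp. $A=\mathrm{VG}(\mathcal M)$ and $B=\mathrm{VG}(\mathcal M|_F)$). Then there are short exact sequences of graded $\Bbbk H$-modules (i) $0\to B\to A\!\downarrow^G_H\to \mathcal X\otimes B(-1)\to 0$, (ii) $0\to\mathcal X\otimes\big(A^!\!\downarrow^G_H\big)(-1)\to A^!\!\downarrow^G_H\to B^!\to0$.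
   Context: Matroids (via circuits), simple (no circuits of size $\le2$), flats, rank, modular flats ($r(F\vee F')+r(F\wedge F')=r(F)+r(F')$ for all flats $F'$), supersolvable (complete flag of modular flats); oriented matroids via signed circuits $(C_+,C_-)$ with underlying matroid circuits $C_+\cup C_-$. $M|_F$ (resp. $\mathcal M|_F$) is the restriction to ground set $F$ (circuits/signed circuits contained in $F$). $\mathrm{OS}(M)=\bigwedge(x_1,\dots,x_n)/(\partial x_C)$ with $\partial x_C=\sum_{j}(-1)^{j-1}x_{c_1}\wedge\cdots\widehat{x_{c_j}}\cdots\wedge x_{c_k}$ for circuits $C=\{c_1<\cdots<c_k\}$; $\mathrm{VG}(\mathcal M)=\Bbbk[x_1,\dots,x_n]/(x_i^2,\partial^\pm x_C)$ with $\partial^\pm x_C=\sum_{c\in C}\epsilon_C(c)\prod_{c'\in C\setminus c}x_{c'}$, $\epsilon_C(c)=\pm1$ according as $c\in C_\pm$ for a chosen signed circuit on $C$. Koszul dual: writing $A=\Bbbk\langle x\rangle/I$ quadratically, $A^!=\Bbbk\langle y\rangle/(I_2^\perp)$ with $(y_iy_j,x_kx_\ell)=\delta_{ik}\delta_{j\ell}$. Automorphisms of $M$ are permutations of $E$ preserving circuits, acting by permuting subscripts of $x_i,y_i$; automorphisms of $\mathcal M$ are signed permutations $\sigma$ of $\{\pm1,\dots,\pm n\}$ preserving signed circuits, acting by $\sigma(x_i)=\epsilon x_j$, $\sigma(y_i)=\epsilon y_j$ when $\sigma(i)=\epsilon j$. The signed permutation module $\mathcal X$ has basis $\{t_j\}_{j\in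 E_r}$ with $g(t_j)=\epsilon t_k$ when $g(j)=\epsilon k$. For a graded module $B$, $B(-1)_j=B_{j-1}$; $\downarrow^G_H$ is restriction. *)

theory Defs
  imports Main
begin

definition matroid :: "nat set \<Rightarrow> nat set set \<Rightarrow> bool" where
  "matroid E \<C> \<longleftrightarrow> finite E \<and> \<C> \<subseteq> Pow E \<and> {} \<notin> \<C> \<and>
     (\<forall>C1\<in>\<C>. \<forall>C2\<in>\<C>. C1 \<subseteq> C2 \<longrightarrow> C1 = C2) \<and>
     (\<forall>C1\<in>\<C>. \<forall>C2\<in>\<C>. \<forall>e. C1 \<noteq> C2 \<and> e \<in> C1 \<inter> C2 \<longrightarrow> (\<exists>C3\<in>\<C>. C3 \<subseteq> (C1 \<union> C2) - {e}))"

definition simple_m :: "nat set set \<Rightarrow> bool" where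
  "simple_m \<C> \<longleftrightarrow> (\<forall>C\<in>\<C>. card C \<ge> 3)"

definition indep :: "nat set set \<Rightarrow> nat set \<Rightarrow> bool" where
  "indep \<C> X \<longleftrightarrow> (\<forall>C\<in>\<C>. \<not> C \<subseteq> X)"

definition mrank :: "nat set set \<Rightarrow> nat set \<Rightarrow> nat" where
  "mrank \<C> X = Max {card Y | Y. Y \<subseteq> X \<and> indep \<C> Y}"

definition mclosure :: "nat set \<Rightarrow> nat set set \<Rightarrow> nat set \<Rightarrow> nat set" where
  "mclosure E \<C> X = {e \<in> E. mrank \<C> (insert e X) = mrank \<C> X}"

definition flat :: "nat set \<Rightarrow> nat set set \<Rightarrow> nat set \<Rightarrow> bool" where
  "flat E \<C> X \<longleftrightarrow> X \<subseteq> E \<and> mclosure E \<C> X = X"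

text \<open>join of flats is the closure of the union, meet is the intersection\<close>
definition modular_flat :: "nat set \<Rightarrow> nat set set \<Rightarrow> nat set \<Rightarrow> bool" where
  "modular_flat E \<C> X \<longleftrightarrow> flat E \<C> X \<and>
     (\<forall>Y. flat E \<C> Y \<longrightarrow>
        mrank \<C> (mclosure E \<C> (X \<union> Y)) + mrank \<C> (X \<inter> Y) = mrank \<C> X + mrank \<C> Y)"

definition modular_flag :: "nat set \<Rightarrow> nat set set \<Rightarrow> nat \<Rightarrow> (nat \<Rightarrow> nat set) \<Rightarrow> bool" where
  "modular_flag E \<C> r Fl \<longleftrightarrow> mrank \<C> E = r \<and> Fl 0 = {} \<and> Fl r = E \<and>
     (\<forall>i<r. Fl i \<subset> Fl (Suc i)) \<and> (\<forall>i\<le>r. modular_flat E \<C> (Fl i))"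

section \<open>Oriented matroids via signed circuits (P,N) = (C+,C-)\<close>

definition oriented_matroid :: "nat set \<Rightarrow> (nat set \<times> nat set) set \<Rightarrow> bool" where
  "oriented_matroid E SC \<longleftrightarrow> finite E \<and>
     (\<forall>(P,N)\<in>SC. P \<union> N \<subseteq> E \<and> P \<inter> N = {} \<and> P \<union> N \<noteq> {}) \<and>
     (\<forall>(P,N)\<in>SC. (N,P) \<in> SC) \<and>
     (\<forall>(P,N)\<in>SC. \<forall>(P',N')\<in>SC. P \<union> N \<subseteq> P' \<union> N' \<longrightarrow> (P',N') = (P,N) \<or> (P',N') = (N,P)) \<and>
     (\<forall>(P,N)\<in>SC. \<forall>(P',N')\<in>SC. \<forall>e. (P',N') \<noteq> (N,P) \<and> e \<in> P \<inter> N' \<longrightarrow>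
        (\<exists>(Q,R)\<in>SC. Q \<subseteq> (P \<union> P') - {e} \<and> R \<subseteq> (N \<union> N') - {e}))"

definition underlying :: "(nat set \<times> nat set) set \<Rightarrow> nat set set" where
  "underlying SC = {P \<union> N | P N. (P,N) \<in> SC}"

text \<open>A signed permutation g = (pi, s) sends i to (-1)^(s i) * pi i.\<close>
type_synonym sperm = "(nat \<Rightarrow> nat) \<times> (nat \<Rightarrow> bool)"

definition sg :: "bool \<Rightarrow> 'k::field" where
  "sg b = (if b then -1 else 1)"

definition unsigned :: "(nat \<Rightarrow> nat) set \<Rightarrow> sperm set" where
  "unsigned G = (\<lambda>\<pi>. (\<pi>, \<lambda>_. False)) ` G"

definition sgroup :: "nat set \<Rightarrow> sperm set \<Rightarrow> bool" where
  "sgroup E G \<longleftrightarrow> G \<noteq> {} \<and>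
     (\<forall>g\<in>G. bij_betw (fst g) E E) \<and>
     (\<forall>g\<in>G. \<forall>h\<in>G. \<exists>k\<in>G. \<forall>i\<in>E. fst k i = fst g (fst h i) \<and> snd k i = (snd h i \<noteq> snd g (fst h i))) \<and>
     (\<forall>g\<in>G. \<exists>k\<in>G. \<forall>i\<in>E. fst k (fst g i) = i \<and> snd k (fst g i) = snd g i)"

definition maut :: "nat set \<Rightarrow> nat set set \<Rightarrow> (nat \<Rightarrow> nat) \<Rightarrow> bool" where
  "maut E \<C> \<pi> \<longleftrightarrow> bij_betw \<pi> E E \<and> (\<forall>C\<in>\<C>. \<pi> ` C \<in> \<C>)"

definition oaut :: "nat set \<Rightarrow> (nat set \<times> nat set) set \<Rightarrow> sperm \<Rightarrow> bool" where
  "oaut E SC g \<longleftrightarrow> bij_betw (fst g) E E \<and>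
     (\<forall>(P,N)\<in>SC.
        ({fst g e | e. e \<in> P \<and> \<not> snd g e} \<union> {fst g e | e. e \<in> N \<and> snd g e},
         {fst g e | e. e \<in> N \<and> \<not> snd g e} \<union> {fst g e | e. e \<in> P \<and> snd g e}) \<in> SC)"

inductive_set lspan :: "('a \<Rightarrow> 'k::field) set \<Rightarrow> ('a \<Rightarrow> 'k) set" for S where
  zero: "(\<lambda>_. 0) \<in> lspan S"
| step: "v \<in> S \<Longrightarrow> u \<in> lspan S \<Longrightarrow> (\<lambda>x. c * v x + u x) \<in> lspan S"

definition lin_map :: "('a \<Rightarrow> 'k::field) set \<Rightarrow> ('b \<Rightarrow> 'k) set \<Rightarrow> (('a \<Rightarrow> 'k) \<Rightarrow> ('b \<Rightarrow> 'k)) \<Rightarrow> bool" where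
  "lin_map V V' f \<longleftrightarrow> (\<forall>u\<in>V. f u \<in> V') \<and>
     (\<forall>u\<in>V. \<forall>v\<in>V. \<forall>c. f (\<lambda>x. c * u x + v x) = (\<lambda>y. c * f u y + f v y))"

text \<open>A short exact sequence 0 -> V1/W1 -> V2/W2 -> V3/W3 -> 0 of quotient spaces,
  given by linear lifts f, g of the maps to the representative spaces.\<close>
definition ses :: "('a \<Rightarrow> 'k::field) set \<Rightarrow> ('a \<Rightarrow> 'k) set \<Rightarrow> ('b \<Rightarrow> 'k) set \<Rightarrow> ('b \<Rightarrow> 'k) set \<Rightarrow>
     ('c \<Rightarrow> 'k) set \<Rightarrow> ('c \<Rightarrow> 'k) set \<Rightarrow> (('a \<Rightarrow> 'k) \<Rightarrow> ('b \<Rightarrow> 'k)) \<Rightarrow> (('b \<Rightarrow> 'k) \<Rightarrow> ('c \<Rightarrow> 'k)) \<Rightarrow> bool" where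
  "ses V1 W1 V2 W2 V3 W3 f g \<longleftrightarrow> lin_map V1 V2 f \<and> lin_map V2 V3 g \<and> f ` W1 \<subseteq> W2 \<and> g ` W2 \<subseteq> W3 \<and>
     (\<forall>v\<in>V1. f v \<in> W2 \<longrightarrow> v \<in> W1) \<and>
     (\<forall>v\<in>V2. g v \<in> W3 \<longleftrightarrow> (\<exists>u\<in>V1. (\<lambda>x. v x - f u x) \<in> W2)) \<and>
     (\<forall>w\<in>V3. \<exists>v\<in>V2. (\<lambda>x. g v x - w x) \<in> W3)"

text \<open>equivariance of the induced map on quotients (target quotient by W2)\<close>
definition equivar :: "('a \<Rightarrow> 'k::field) set \<Rightarrow> ('b \<Rightarrow> 'k) set \<Rightarrow> (('a \<Rightarrow> 'k) \<Rightarrow> ('b \<Rightarrow> 'k)) \<Rightarrow>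
     (sperm \<Rightarrow> ('a \<Rightarrow> 'k) \<Rightarrow> ('a \<Rightarrow> 'k)) \<Rightarrow> (sperm \<Rightarrow> ('b \<Rightarrow> 'k) \<Rightarrow> ('b \<Rightarrow> 'k)) \<Rightarrow> sperm set \<Rightarrow> bool" where
  "equivar V1 W2 f a1 a2 H \<longleftrightarrow> (\<forall>h\<in>H. \<forall>v\<in>V1. (\<lambda>x. f (a1 h v) x - a2 h (f v) x) \<in> W2)"

section \<open>Exterior algebra (ext = True) / squarefree commutative algebra (ext = False)\<close>

text \<open>basis element e_S = product of x_s, s in S, in increasing order\<close>
definition extsp :: "nat set \<Rightarrow> nat \<Rightarrow> (nat set \<Rightarrow> 'k::field) set" where
  "extsp E d = {v. \<forall>S. v S \<noteq> 0 \<longrightarrow> S \<subseteq> E \<and> card S = d}"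

text \<open>e_T * e_S = cf T S * e_(T \<union> S)\<close>
definition cf :: "bool \<Rightarrow> nat set \<Rightarrow> nat set \<Rightarrow> 'k::field" where
  "cf ext T S = (if T \<inter> S \<noteq> {} then 0
     else if ext then (-1) ^ card {(t,s). t \<in> T \<and> s \<in> S \<and> s < t} else 1)"

definition lmul :: "bool \<Rightarrow> nat set \<Rightarrow> nat set \<Rightarrow> (nat set \<Rightarrow> 'k::field) \<Rightarrow> (nat set \<Rightarrow> 'k)" where
  "lmul ext E T v = (\<lambda>U. \<Sum>S\<in>Pow E. if T \<union> S = U then cf ext T S * v S else 0)"

definition osrel :: "nat set \<Rightarrow> (nat set \<Rightarrow> 'k::field)" where
  "osrel C = (\<lambda>S. \<Sum>c\<in>C. if S = C - {c} then (-1) ^ card {c'\<in>C. c' < c} else 0)"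

definition vgrel :: "nat set \<Rightarrow> nat set \<Rightarrow> (nat set \<Rightarrow> 'k::field)" where
  "vgrel P N = (\<lambda>S. \<Sum>c\<in>P \<union> N. if S = (P \<union> N) - {c} then (if c \<in> P then 1 else -1) else 0)"

text \<open>relations tagged with their degree\<close>
definition relsOS :: "nat set set \<Rightarrow> (nat \<times> (nat set \<Rightarrow> 'k::field)) set" where
  "relsOS \<C> = {(card C - 1, osrel C) | C. C \<in> \<C>}"

definition relsVG :: "(nat set \<times> nat set) set \<Rightarrow> (nat \<times> (nat set \<Rightarrow> 'k::field)) set" where
  "relsVG SC = {(card (P \<union> N) - 1, vgrel P N) | P N. (P,N) \<in> SC}"

text \<open>degree d part of the ideal generated by the relations (algebra is graded commutative)\<close>
definition idl :: "bool \<Rightarrow> nat set \<Rightarrow> (nat \<times> (nat set \<Rightarrow> 'k::field)) set \<Rightarrow> nat \<Rightarrow> (nat set \<Rightarrow> 'k) set" where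
  "idl ext E R d = lspan {lmul ext E T r | T k r. T \<subseteq> E \<and> (k, r) \<in> R \<and> card T + k = d}"

definition act_ext :: "bool \<Rightarrow> nat set \<Rightarrow> sperm \<Rightarrow> (nat set \<Rightarrow> 'k::field) \<Rightarrow> (nat set \<Rightarrow> 'k)" where
  "act_ext ext E g v = (\<lambda>T. \<Sum>S\<in>Pow E. if fst g ` S = T then
      (\<Prod>x\<in>S. sg (snd g x)) *
      (if ext then (-1) ^ card {(a,b). a \<in> S \<and> b \<in> S \<and> a < b \<and> fst g b < fst g a} else 1) * v S
    else 0)"

definition words :: "nat set \<Rightarrow> nat \<Rightarrow> nat list set" where
  "words E d = {w. set w \<subseteq> E \<and> length w = d}"

definition frsp :: "nat set \<Rightarrow> nat \<Rightarrow> (nat list \<Rightarrow> 'k::field) set" where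
  "frsp E d = {u. \<forall>w. u w \<noteq> 0 \<longrightarrow> w \<in> words E d}"

text \<open>degree-2 part of the quotient map k<x> -> A\<close>
definition wordproj :: "bool \<Rightarrow> nat set \<Rightarrow> (nat list \<Rightarrow> 'k::field) \<Rightarrow> (nat set \<Rightarrow> 'k)" where
  "wordproj ext E u = (\<lambda>U. \<Sum>w\<in>words E 2. if set w = U then cf ext {w ! 0} {w ! 1} * u w else 0)"

definition I2 :: "bool \<Rightarrow> nat set \<Rightarrow> (nat \<times> (nat set \<Rightarrow> 'k::field)) set \<Rightarrow> (nat list \<Rightarrow> 'k) set" where
  "I2 ext E R = {u \<in> frsp E 2. wordproj ext E u \<in> idl ext E R 2}"

definition perp :: "nat set \<Rightarrow> (nat list \<Rightarrow> 'k::field) set \<Rightarrow> (nat list \<Rightarrow> 'k) set" where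
  "perp E Q = {u \<in> frsp E 2. \<forall>w\<in>Q. (\<Sum>x\<in>words E 2. u x * w x) = 0}"

definition lmulw :: "nat list \<Rightarrow> (nat list \<Rightarrow> 'k::field) \<Rightarrow> nat list \<Rightarrow> (nat list \<Rightarrow> 'k)" where
  "lmulw a r b = (\<lambda>w. if length w = length a + 2 + length b \<and> take (length a) w = a
      \<and> drop (length a + 2) w = b then r (take 2 (drop (length a) w)) else 0)"

definition didl :: "nat set \<Rightarrow> (nat list \<Rightarrow> 'k::field) set \<Rightarrow> nat \<Rightarrow> (nat list \<Rightarrow> 'k) set" where
  "didl E P d = lspan {lmulw a r b | a r b. set a \<subseteq> E \<and> set b \<subseteq> E \<and> r \<in> P \<and> length a + 2 + length b = d}"

text \<open>A^! in degree d is frsp E d / kidl ext E R d\<close>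
definition kidl :: "bool \<Rightarrow> nat set \<Rightarrow> (nat \<times> (nat set \<Rightarrow> 'k::field)) set \<Rightarrow> nat \<Rightarrow> (nat list \<Rightarrow> 'k) set" where
  "kidl ext E R d = didl E (perp E (I2 ext E R)) d"

definition act_word :: "nat set \<Rightarrow> sperm \<Rightarrow> (nat list \<Rightarrow> 'k::field) \<Rightarrow> (nat list \<Rightarrow> 'k)" where
  "act_word E g u = (\<lambda>w'. \<Sum>w\<in>words E (length w'). if map (fst g) w = w' then
      prod_list (map (\<lambda>i. sg (snd g i)) w) * u w else 0)"

text \<open>element \<Sum>_j t_j \<otimes> \<phi>(j,-) ; degree d part of X \<otimes> V(-1)\<close>
definition tsp :: "nat set \<Rightarrow> (nat \<Rightarrow> ('a \<Rightarrow> 'k::field) set) \<Rightarrow> nat \<Rightarrow> ((nat \<times> 'a) \<Rightarrow> 'k) set" where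
  "tsp Er V d = (if d = 0 then {\<lambda>_. 0} else
     {\<phi>. (\<forall>j a. j \<notin> Er \<longrightarrow> \<phi> (j,a) = 0) \<and> (\<forall>j\<in>Er. (\<lambda>a. \<phi> (j,a)) \<in> V (d - 1))})"

definition act_tensor :: "nat set \<Rightarrow> (sperm \<Rightarrow> ('a \<Rightarrow> 'k::field) \<Rightarrow> ('a \<Rightarrow> 'k)) \<Rightarrow> sperm \<Rightarrow>
    ((nat \<times> 'a) \<Rightarrow> 'k) \<Rightarrow> ((nat \<times> 'a) \<Rightarrow> 'k)" where
  "act_tensor Er act g \<phi> = (\<lambda>(k,a). \<Sum>j\<in>Er. if fst g j = k then
      sg (snd g j) * act g (\<lambda>b. \<phi> (j,b)) a else 0)"

definition conc :: "bool \<Rightarrow> nat set \<Rightarrow> nat set \<Rightarrow> (nat \<times> (nat set \<Rightarrow> 'k::field)) set \<Rightarrow>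
    (nat \<times> (nat set \<Rightarrow> 'k)) set \<Rightarrow> sperm set \<Rightarrow> bool" where
  "conc ext E F RA RB H \<longleftrightarrow> (\<forall>d.
     (\<exists>f g. ses (extsp F d) (idl ext F RB d) (extsp E d) (idl ext E RA d)
                (tsp (E - F) (extsp F) d) (tsp (E - F) (idl ext F RB) d) f g \<and>
            equivar (extsp F d) (idl ext E RA d) f (act_ext ext F) (act_ext ext E) H \<and>
            equivar (extsp E d) (tsp (E - F) (idl ext F RB) d) g (act_ext ext E)
                    (act_tensor (E - F) (act_ext ext F)) H) \<and>
     (\<exists>f g. ses (tsp (E - F) (frsp E) d) (tsp (E - F) (kidl ext E RA) d) (frsp E d) (kidl ext E RA d)
                (frsp F d) (kidl ext F RB d) f g \<and>
            equivar (tsp (E - F) (frsp E) d) (kidl ext E RA d) f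
                    (act_tensor (E - F) (act_word E)) (act_word E) H \<and>
            equivar (frsp E d) (kidl ext F RB d) g (act_word E) (act_word F) H))"

end

theory Submission
  imports Defs HOL.Rat
begin

text \<open>Let \<open>m\<close> be a point outside the modular hyperplane \<open>F\<close>. Every line through \<open>m\<close> and another point
  outside \<open>F\<close> meets \<open>F\<close>, so projection from \<open>m\<close> induces an algebra map \<open>phi m\<close> from \<open>A\<close> to \<open>B\<close>:
  the relations of \<open>A\<close> are carried into the ideal of \<open>B\<close> by eliminating the elements outside \<open>F\<close> one at a
  time. Contraction by \<open>x\<^sub>m\<close> followed by \<open>phi m\<close> is a residue \<open>res m\<close> of degree -1, and
  \<open>res m (x\<^sub>l b)\<close> is \<open>b\<close> if \<open>l = m\<close> and 0 otherwise, for \<open>b\<close> in \<open>B\<close>. Since \<open>A\<close> is spanned by \<open>B\<close> and the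
  \<open>x\<^sub>m B\<close>, and \<open>B\<close> is a retract of \<open>A\<close>, the residues give the sequence (i).

  For (ii), the quadratic relations dual to the residues move the letters outside \<open>F\<close> to the front of a
  word, and the retraction embeds the relations of the dual of \<open>B\<close> into those of the dual of \<open>A\<close>;
  this is exactness in the middle. Iterating the same rewriting yields a normal form \<open>der\<close>, which
  respects the relations and is a left inverse of \<open>(\<phi>\<^sub>j) \<mapsto> \<Sum>\<^sub>j y\<^sub>j \<phi>\<^sub>j\<close>.\<close>

section \<open>Linear maps on function spaces\<close>

text \<open>All maps are written down on representatives and no dimensions are counted, so the field
  may have any characteristic. For a three-point circuit Y = {m, a, f} the relation reads Y_m x_a
  x_f - s Y_a x_m x_f + Y_f x_m x_a = 0. Its x_m-part forces x_a = s Y_a Y_f x_f after contraction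
  by m; this is where \<open>kap\<close> comes from, and in the unsigned case it is 1. Projection
  and residue must be shown well defined together, because the residue of x_m v is the projection of
  v; both come down to \<open>contraction_relation\<close>. On the dual side an element of the perp
  space is a linear form in degree 2, so the maps between A and B produce dual relations: inclusion,
  retraction and projection by composition, the residue because B has no relations in degree 1. The
  hard point of (ii) is injectivity. Left multiplication by a letter of F mixes the components
  \<open>der m\<close>, so it has to be checked that \<open>der m\<close> sends a relation times a
  word to a sum of multiples of relations; the coefficients match only because the projections from
  the points m, b and c are tied together by \<open>kap_psi_exchange\<close>.\<close>

definition bv :: "'a \<Rightarrow> 'a \<Rightarrow> 'k::field" where
  "bv a = (\<lambda>x. if x = a then 1 else 0)"

definition linop :: "(('a \<Rightarrow> 'k::field) \<Rightarrow> ('b \<Rightarrow> 'k)) \<Rightarrow> bool" where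
  "linop L \<longleftrightarrow> (\<forall>c u v. L (\<lambda>x. c * u x + v x) = (\<lambda>y. c * L u y + L v y))"

definition subsp :: "('a \<Rightarrow> 'k::field) set \<Rightarrow> bool" where
  "subsp W \<longleftrightarrow> (\<lambda>_. 0) \<in> W \<and> (\<forall>c. \<forall>u\<in>W. \<forall>v\<in>W. (\<lambda>x. c * u x + v x) \<in> W)"

lemma linopD: "linop L \<Longrightarrow> L (\<lambda>x. c * u x + v x) = (\<lambda>y. c * L u y + L v y)"
  unfolding linop_def by blast

lemma linop_zero: assumes "linop L" shows "L (\<lambda>_. 0) = (\<lambda>_. 0)"
  using linopD[OF assms, of "-1" "\<lambda>_. 0" "\<lambda>_. 0"] by simp

lemma linop_scale: assumes "linop L" shows "L (\<lambda>x. c * u x) = (\<lambda>y. c * L u y)"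
  using linopD[OF assms, of c u "\<lambda>_. 0"] linop_zero[OF assms] by simp

lemma linop_add: assumes "linop L" shows "L (\<lambda>x. u x + v x) = (\<lambda>y. L u y + L v y)"
  using linopD[OF assms, of 1 u v] by simp

lemma linop_diff: assumes "linop L" shows "L (\<lambda>x. u x - v x) = (\<lambda>y. L u y - L v y)"
  using linopD[OF assms, of "-1" v u] by simp

lemma linop_sum:
  assumes "linop L"
  shows "L (\<lambda>x. \<Sum>i\<in>I. c i * u i x) = (\<lambda>y. \<Sum>i\<in>I. c i * L (u i) y)"
proof (cases "finite I")
  case True
  then show ?thesis
    by (induction I rule: finite_induct) (simp_all add: linop_zero[OF assms] linopD[OF assms])
qed (simp add: linop_zero[OF assms])

lemma linop_comp: "linop L \<Longrightarrow> linop L' \<Longrightarrow> linop (\<lambda>v. L (L' v))"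
  unfolding linop_def by simp

lemma linop_smult: "linop L \<Longrightarrow> linop (\<lambda>v x. c * L v x)"
  unfolding linop_def by (simp add: algebra_simps)

lemma subsp_zero: "subsp W \<Longrightarrow> (\<lambda>_. 0) \<in> W"
  unfolding subsp_def by blast

lemma subspD: "subsp W \<Longrightarrow> u \<in> W \<Longrightarrow> v \<in> W \<Longrightarrow> (\<lambda>x. c * u x + v x) \<in> W"
  unfolding subsp_def by blast

lemma subsp_scale: "subsp W \<Longrightarrow> u \<in> W \<Longrightarrow> (\<lambda>x. c * u x) \<in> W"
  using subspD[of W u "\<lambda>_. 0" c] subsp_zero by fastforce

lemma subsp_add: "subsp W \<Longrightarrow> u \<in> W \<Longrightarrow> v \<in> W \<Longrightarrow> (\<lambda>x. u x + v x) \<in> W"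
  using subspD[of W u v 1] by simp

lemma subsp_diff: "subsp W \<Longrightarrow> u \<in> W \<Longrightarrow> v \<in> W \<Longrightarrow> (\<lambda>x. u x - v x) \<in> W"
  using subspD[of W v u "-1"] by simp

lemma subsp_sum:
  assumes "subsp W" "\<And>i. i \<in> I \<Longrightarrow> u i \<in> W"
  shows "(\<lambda>x. \<Sum>i\<in>I. u i x) \<in> W"
proof (cases "finite I")
  case True
  then show ?thesis using assms(2)
    by (induction I rule: finite_induct) (simp_all add: subsp_zero[OF assms(1)] subsp_add[OF assms(1)])
qed (simp add: subsp_zero[OF assms(1)])

lemma subsp_scaleE:
  assumes "subsp W" "(\<lambda>x. c * u x) \<in> W" "c \<noteq> 0" shows "u \<in> W"
  using subsp_scale[OF assms(1,2), of "inverse c"] assms(3) by (simp add: mult.assoc[symmetric])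

lemma subsp_lspan: "subsp (lspan S)"
proof -
  have "(\<lambda>x. c * u x + v x) \<in> lspan S" if "u \<in> lspan S" "v \<in> lspan S" for c and u v :: "'a \<Rightarrow> 'b"
    using that(1)
  proof (induction rule: lspan.induct)
    case zero then show ?case using that(2) by simp
  next
    case (step w u c')
    have "(\<lambda>x. (c * c') * w x + (c * u x + v x)) \<in> lspan S"
      by (rule lspan.step[where u = "\<lambda>x. c * u x + v x", OF step(1,3)])
    then show ?case by (simp add: algebra_simps)
  qed
  then show ?thesis unfolding subsp_def using lspan.zero by blast
qed

lemma lspan_base: assumes "v \<in> S" shows "v \<in> lspan S"
  using lspan.step[OF assms lspan.zero, of 1] by simp

lemma lspan_minimal:
  assumes "subsp W" "S \<subseteq> W" shows "lspan S \<subseteq> W"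
proof
  fix v assume "v \<in> lspan S"
  then show "v \<in> W"
    by (induction rule: lspan.induct) (use assms subsp_zero subspD in blast)+
qed

lemma subsp_vimage: "subsp W \<Longrightarrow> linop L \<Longrightarrow> subsp {v. L v \<in> W}"
  unfolding subsp_def by (simp add: linop_zero linopD)

text \<open>Most identities between linear operators below are proved this way: the vectors on which
  two operators agree form a subspace, so it suffices to test basis vectors or monomials.\<close>

lemma subsp_equalizer: "linop L \<Longrightarrow> linop L' \<Longrightarrow> subsp {v. L v = L' v}"
  unfolding subsp_def by (simp add: linop_zero linopD)

lemma subsp_Int: "subsp V \<Longrightarrow> subsp W \<Longrightarrow> subsp (V \<inter> W)"
  unfolding subsp_def by blast

lemma bv_expansion:
  fixes v :: "'a \<Rightarrow> 'k::field"
  assumes "finite A" "\<And>x. v x \<noteq> 0 \<Longrightarrow> x \<in> A"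
  shows "v = (\<lambda>x. \<Sum>a\<in>A. v a * bv a x)"
proof
  fix x
  have "(\<Sum>a\<in>A. v a * bv a x) = (\<Sum>a\<in>A. if a = x then v x else 0)"
    by (rule sum.cong) (auto simp: bv_def)
  then show "v x = (\<Sum>a\<in>A. v a * bv a x)" using assms by auto
qed

lemma lspan_bv:
  assumes "finite A" "\<And>x. v x \<noteq> 0 \<Longrightarrow> x \<in> A" "\<And>a. a \<in> A \<Longrightarrow> bv a \<in> W" "subsp W"
  shows "v \<in> W"
  by (subst bv_expansion[OF assms(1,2)], assumption)
     (intro subsp_sum subsp_scale assms(3,4))

section \<open>The exterior and the squarefree commutative algebra\<close>

text \<open>The sign \<open>s\<close> records the commutation rule \<open>x\<^sub>a x\<^sub>b = - s x\<^sub>b x\<^sub>a\<close>, so that both algebras are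
  treated at once.\<close>

locale sign_alg =
  fixes ext :: bool and s :: "'k::field"
  assumes s_eq: "s = (if ext then 1 else -1)"
begin

lemma s_sq [simp]: "s * s = 1" "s * (s * c) = c"
  by (auto simp: s_eq)

lemma s_nz [simp]: "s \<noteq> 0"
  by (auto simp: s_eq)

text \<open>The sign in x_a e_U = \<open>sn a U\<close> e_(U + a): x_a moves past the smaller
  elements of U. It does not matter whether a itself lies in U, so \<open>xm\<close> and
  \<open>ct\<close> can use the same factor.\<close>

definition sn :: "nat \<Rightarrow> nat set \<Rightarrow> 'k" where
  "sn a U = (if ext then (-1) ^ card {x \<in> U. x < a} else 1)"

definition xm :: "nat \<Rightarrow> (nat set \<Rightarrow> 'k) \<Rightarrow> nat set \<Rightarrow> 'k" where
  "xm a v = (\<lambda>U. if a \<in> U then sn a U * v (U - {a}) else 0)"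

text \<open>The interior product with the form dual to x_a: the coefficient of x_a after x_a has
  been moved to the front.\<close>

definition ct :: "nat \<Rightarrow> (nat set \<Rightarrow> 'k) \<Rightarrow> nat set \<Rightarrow> 'k" where
  "ct a v = (\<lambda>U. if a \<in> U then 0 else sn a U * v (insert a U))"

lemma sn_remove: "sn b (U - {a}) = (if a \<in> U \<and> a < b then - s * sn b U else sn b U)"
proof (cases "a \<in> U \<and> a < b")
  case True
  then have "{x \<in> U. x < b} = insert a {x \<in> U - {a}. x < b}" by auto
  then have "card {x \<in> U. x < b} = Suc (card {x \<in> U - {a}. x < b})" by simp
  then show ?thesis using True by (simp add: sn_def s_eq)
next
  case False
  then have "{x \<in> U - {a}. x < b} = {x \<in> U. x < b}" by auto
  then show ?thesis using False by (auto simp: sn_def)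
qed

lemma sn_insert: "sn b (insert a U) = (if a \<notin> U \<and> a < b then - s * sn b U else sn b U)"
  using sn_remove[of b "insert a U" a] s_sq
  by (cases "a \<in> U") (auto simp: insert_absorb mult.assoc[symmetric] split: if_splits)

lemma sn_sq [simp]: "sn a U * sn a U = 1" "sn a U * (sn a U * c) = c"
  by (simp_all add: sn_def mult.assoc[symmetric] power_add[symmetric])

lemma sn_nz [simp]: "sn a U \<noteq> 0"
  by (simp add: sn_def)

lemma sn_self [simp]: "sn a (insert a U) = sn a U" "sn a (U - {a}) = sn a U"
  by (simp_all add: sn_insert sn_remove)

lemma sn_Un: "T \<inter> S = {} \<Longrightarrow> sn a (T \<union> S) = sn a T * sn a S"
proof -
  assume d: "T \<inter> S = {}"
  have "{x \<in> T \<union> S. x < a} = {x \<in> T. x < a} \<union> {x \<in> S. x < a}" by auto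
  then have "card {x \<in> T \<union> S. x < a} = card {x \<in> T. x < a} + card {x \<in> S. x < a}"
    using d by (subst card_Un_disjoint[symmetric]) auto
  then show ?thesis by (simp add: sn_def power_add)
qed

lemma linop_xm: "linop (xm a)"
  unfolding linop_def xm_def by (auto simp: algebra_simps)

lemma linop_ct: "linop (ct a)"
  unfolding linop_def ct_def by (auto simp: algebra_simps)

lemma xm_sq [simp]: "xm a (xm a v) = (\<lambda>_. 0)"
  unfolding xm_def by auto

lemma xm_anticomm:
  assumes "a \<noteq> b" shows "xm a (xm b v) = (\<lambda>U. - s * xm b (xm a v) U)"
proof
  fix U
  have "U - {a} - {b} = U - {b} - {a}" by auto
  then show "xm a (xm b v) U = - s * xm b (xm a v) U"
    using assms by (cases "a < b") (auto simp: xm_def sn_remove)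
qed

lemma ct_xm:
  assumes "a \<noteq> b" shows "ct a (xm b v) = (\<lambda>U. - s * xm b (ct a v) U)"
proof
  fix U
  show "ct a (xm b v) U = - s * xm b (ct a v) U"
  proof (cases "a \<notin> U \<and> b \<in> U")
    case True
    then have "insert a U - {b} = insert a (U - {b})" using assms by auto
    then show ?thesis using True assms
      by (cases "a < b") (auto simp: xm_def ct_def sn_remove sn_insert)
  qed (use assms in \<open>auto simp: xm_def ct_def\<close>)
qed

lemma ct_xm_same:
  assumes "\<And>U. a \<in> U \<Longrightarrow> v U = 0" shows "ct a (xm a v) = v"
  using assms by (auto simp: xm_def ct_def fun_eq_iff)

lemma xm_bv: "a \<notin> S \<Longrightarrow> xm a (bv S) = (\<lambda>U. sn a S * bv (insert a S) U)"
  by (rule ext) (auto simp: xm_def bv_def insert_absorb)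

lemma xm_bv_mem: "a \<in> S \<Longrightarrow> xm a (bv S) = (\<lambda>_. 0)"
  by (rule ext) (auto simp: xm_def bv_def)

text \<open>What a family of operators must satisfy for x_a \<mapsto> \<open>\<Theta> a\<close> to
  define an action of the algebra. It is applied to multiplication \<open>xm\<close> and to its
  projected version \<open>Th m\<close>, so that the sign computations are done once.\<close>

definition anti :: "(nat \<Rightarrow> (nat set \<Rightarrow> 'k) \<Rightarrow> nat set \<Rightarrow> 'k) \<Rightarrow> bool" where
  "anti \<Theta> \<longleftrightarrow> (\<forall>a. linop (\<Theta> a)) \<and> (\<forall>a v. \<Theta> a (\<Theta> a v) = (\<lambda>_. 0)) \<and>
     (\<forall>a b v. a \<noteq> b \<longrightarrow> \<Theta> a (\<Theta> b v) = (\<lambda>U. - s * \<Theta> b (\<Theta> a v) U))"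

lemma antiD:
  assumes "anti \<Theta>"
  shows "linop (\<Theta> a)" "\<Theta> a (\<Theta> a v) = (\<lambda>_. 0)" "a \<noteq> b \<Longrightarrow> \<Theta> a (\<Theta> b v) = (\<lambda>U. - s * \<Theta> b (\<Theta> a v) U)"
  using assms unfolding anti_def by blast+

lemma anti_xm: "anti xm"
  unfolding anti_def by (intro conjI allI impI linop_xm xm_sq xm_anticomm)

abbreviation mon :: "(nat \<Rightarrow> (nat set \<Rightarrow> 'k) \<Rightarrow> nat set \<Rightarrow> 'k) \<Rightarrow> nat list \<Rightarrow> nat set \<Rightarrow> 'k" where
  "mon \<Theta> xs \<equiv> foldr \<Theta> xs (bv {})"

text \<open>\<open>dm xm Y xs\<close> is the image of the product of \<open>xs\<close> under the derivation with \<open>x\<^sub>a \<mapsto> Y a\<close>.\<close>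

primrec dm :: "(nat \<Rightarrow> (nat set \<Rightarrow> 'k) \<Rightarrow> nat set \<Rightarrow> 'k) \<Rightarrow> (nat \<Rightarrow> 'k) \<Rightarrow> nat list \<Rightarrow> nat set \<Rightarrow> 'k" where
  "dm \<Theta> Y [] = (\<lambda>_. 0)"
| "dm \<Theta> Y (a # xs) = (\<lambda>U. Y a * mon \<Theta> xs U - s * \<Theta> a (dm \<Theta> Y xs) U)"

lemma foldr_move:
  assumes "anti \<Theta>" "a \<notin> set us"
  shows "foldr \<Theta> (us @ a # vs) w = (\<lambda>U. (- s) ^ length us * foldr \<Theta> (a # us @ vs) w U)"
  using assms(2)
proof (induction us)
  case (Cons b us)
  then have "foldr \<Theta> ((b # us) @ a # vs) w
      = (\<lambda>U. (- s) ^ length us * \<Theta> b (\<Theta> a (foldr \<Theta> (us @ vs) w)) U)"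
    by (simp add: linop_scale[OF antiD(1)[OF assms(1)]])
  also have "\<Theta> b (\<Theta> a (foldr \<Theta> (us @ vs) w)) = (\<lambda>U. - s * \<Theta> a (\<Theta> b (foldr \<Theta> (us @ vs) w)) U)"
    using Cons.prems by (intro antiD(3)[OF assms(1)]) auto
  finally show ?case by (simp add: algebra_simps)
qed simp

lemma foldr_repeat:
  assumes "anti \<Theta>" "a \<in> set xs" shows "\<Theta> a (foldr \<Theta> xs w) = (\<lambda>_. 0)"
  using assms(2)
proof (induction xs)
  case (Cons b xs)
  show ?case
  proof (cases "a = b")
    case False
    with Cons have "\<Theta> a (foldr \<Theta> xs w) = (\<lambda>_. 0)" by simp
    then show ?thesis
      using antiD(3)[OF assms(1) False] linop_zero[OF antiD(1)[OF assms(1)]] by simp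
  qed (simp add: antiD(2)[OF assms(1)])
qed simp

lemma dm_swap:
  assumes A: "anti \<Theta>" and "a \<noteq> b"
  shows "dm \<Theta> Y (a # b # xs) = (\<lambda>U. - s * dm \<Theta> Y (b # a # xs) U)"
proof
  fix U
  have *: "dm \<Theta> Y (a # b # xs) U = Y a * \<Theta> b (mon \<Theta> xs) U
      - s * (Y b * \<Theta> a (mon \<Theta> xs) U - s * \<Theta> a (\<Theta> b (dm \<Theta> Y xs)) U)" for a b
    by (simp add: linop_diff[OF antiD(1)[OF A]] linop_scale[OF antiD(1)[OF A]])
  have "\<Theta> a (\<Theta> b (dm \<Theta> Y xs)) U = - s * \<Theta> b (\<Theta> a (dm \<Theta> Y xs)) U"
    by (simp add: antiD(3)[OF A assms(2)])
  then show "dm \<Theta> Y (a # b # xs) U = - s * dm \<Theta> Y (b # a # xs) U"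
    unfolding * by (simp add: algebra_simps)
qed

lemma dm_move:
  assumes A: "anti \<Theta>" and "a \<notin> set us"
  shows "dm \<Theta> Y (us @ a # vs) = (\<lambda>U. (- s) ^ length us * dm \<Theta> Y (a # us @ vs) U)"
  using assms(2)
proof (induction us)
  case (Cons b us)
  have "dm \<Theta> Y (us @ a # vs) = (\<lambda>U. (- s) ^ length us * dm \<Theta> Y (a # us @ vs) U)"
    "mon \<Theta> (us @ a # vs) = (\<lambda>U. (- s) ^ length us * mon \<Theta> (a # us @ vs) U)"
    using Cons foldr_move[OF A, of a us vs "bv {}"] by (auto simp del: foldr_append dm.simps)
  then have "dm \<Theta> Y ((b # us) @ a # vs) = (\<lambda>U. (- s) ^ length us * dm \<Theta> Y (b # a # us @ vs) U)"
    by (simp only: append_Cons dm.simps(2)[of \<Theta> Y b] linop_scale[OF antiD(1)[OF A]])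
       (simp add: algebra_simps)
  also have "dm \<Theta> Y (b # a # us @ vs) = (\<lambda>U. - s * dm \<Theta> Y (a # b # us @ vs) U)"
    using Cons.prems by (intro dm_swap[OF A]) auto
  finally show ?case by (simp add: algebra_simps del: dm.simps foldr_append)
qed simp

text \<open>Reordering distinct letters multiplies \<open>dm\<close> by a nonzero scalar, so a
  relation can be written with any chosen letters in front.\<close>

lemma dm_perm:
  assumes A: "anti \<Theta>" and "subsp W" "distinct xs" "distinct ys" "set xs = set ys"
  shows "dm \<Theta> Y xs \<in> W \<longleftrightarrow> dm \<Theta> Y ys \<in> W"
proof -
  \<comment> \<open>\<open>mon\<close> is carried along with the same scalar, because the recursion
    for \<open>dm\<close> on a longer list involves it.\<close>
  have "\<exists>c. c \<noteq> 0 \<and> dm \<Theta> Y ys = (\<lambda>U. c * dm \<Theta> Y xs U) \<and> mon \<Theta> ys = (\<lambda>U. c * mon \<Theta> xs U)"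
    using assms(3-5)
  proof (induction xs arbitrary: ys)
    case Nil
    then show ?case by (intro exI[of _ 1]) auto
  next
    case (Cons a xs)
    then have "a \<in> set ys" by auto
    then obtain us vs where ys: "ys = us @ a # vs" by (auto dest: split_list)
    with Cons.prems have "distinct (us @ vs)" and "a \<notin> set us" by auto
    moreover have "set xs = set (us @ vs)"
      using Cons.prems unfolding ys by (simp add: insert_ident)
    ultimately obtain c where c: "c \<noteq> 0" "dm \<Theta> Y (us @ vs) = (\<lambda>U. c * dm \<Theta> Y xs U)"
        "mon \<Theta> (us @ vs) = (\<lambda>U. c * mon \<Theta> xs U)"
      using Cons.IH[of "us @ vs"] Cons.prems(1) by auto
    have "dm \<Theta> Y ys = (\<lambda>U. ((- s) ^ length us * c) * dm \<Theta> Y (a # xs) U)"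
      unfolding ys using c by (simp del: foldr_append
          add: dm_move[OF A \<open>a \<notin> set us\<close>] linop_scale[OF antiD(1)[OF A]] algebra_simps)
    moreover have "mon \<Theta> ys = (\<lambda>U. ((- s) ^ length us * c) * mon \<Theta> (a # xs) U)"
      unfolding ys using c by (simp del: foldr_append
          add: foldr_move[OF A \<open>a \<notin> set us\<close>] linop_scale[OF antiD(1)[OF A]] algebra_simps)
    ultimately show ?case using c(1) by (intro exI[of _ "(- s) ^ length us * c"]) simp
  qed
  then show ?thesis using subsp_scale[OF assms(2)] subsp_scaleE[OF assms(2)] by metis
qed

lemma dm_cong: "(\<And>a. a \<in> set xs \<Longrightarrow> Y a = Y' a) \<Longrightarrow> dm \<Theta> Y xs = dm \<Theta> Y' xs"
  by (induction xs) auto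

text \<open>Since \<open>\<Theta> a\<close> squares to zero, applying it to the boundary of a
  product that starts with a leaves the product itself times \<open>Y a\<close>.\<close>

lemma mon_mem_of_dm:
  assumes A: "anti \<Theta>" and W: "subsp W" "\<And>v. v \<in> W \<Longrightarrow> \<Theta> a v \<in> W"
    and "Y a \<noteq> 0" "dm \<Theta> Y (a # xs) \<in> W"
  shows "mon \<Theta> (a # xs) \<in> W"
proof -
  have "\<Theta> a (dm \<Theta> Y (a # xs)) = (\<lambda>U. Y a * mon \<Theta> (a # xs) U)"
    by (simp add: linop_diff[OF antiD(1)[OF A]] linop_scale[OF antiD(1)[OF A]] antiD(2)[OF A])
  then show ?thesis using W(2)[OF assms(5)] subsp_scaleE[OF W(1) _ assms(4)] by metis
qed

lemma dm_append_mem: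
  assumes A: "anti \<Theta>" and W: "subsp W" "\<And>a v. a \<in> set rs \<Longrightarrow> v \<in> W \<Longrightarrow> \<Theta> a v \<in> W"
    and "mon \<Theta> xs \<in> W" "dm \<Theta> Y xs \<in> W"
  shows "mon \<Theta> (rs @ xs) \<in> W \<and> dm \<Theta> Y (rs @ xs) \<in> W"
  using W(2)
proof (induction rs)
  case (Cons a rs)
  then have *: "mon \<Theta> (rs @ xs) \<in> W" "dm \<Theta> Y (rs @ xs) \<in> W" by auto
  then have "dm \<Theta> Y ((a # rs) @ xs) \<in> W"
    using Cons.prems by (auto simp del: foldr_append intro!: subsp_diff[OF W(1)] subsp_scale[OF W(1)])
  then show ?case using * Cons.prems by auto
qed (use assms in auto)

text \<open>The standard argument that an ideal containing the boundary of a circuit also contains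
  the product and the boundary of every larger set: the product over \<open>ks\<close> comes from
  \<open>mon_mem_of_dm\<close>, and the remaining letters are multiplied on by the Leibniz
  rule.\<close>

lemma dm_subset_mem:
  assumes A: "anti \<Theta>" and W: "subsp W" "\<And>a v. a \<in> L \<Longrightarrow> v \<in> W \<Longrightarrow> \<Theta> a v \<in> W"
    and K: "distinct ks" "ks \<noteq> []" "dm \<Theta> Y ks \<in> W" "Y (hd ks) \<noteq> 0"
    and L: "distinct ls" "set ls = L" "set ks \<subseteq> L"
  shows "dm \<Theta> Y ls \<in> W" and "mon \<Theta> ls \<in> W"
proof -
  have m: "mon \<Theta> ks \<in> W"
    using mon_mem_of_dm[OF A W(1) W(2), of "hd ks" Y "tl ks"] K L by (cases ks) auto
  define rs where "rs = filter (\<lambda>x. x \<notin> set ks) ls"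
  have rs: "distinct (rs @ ks)" "set (rs @ ks) = set ls"
    using K L by (auto simp: rs_def)
  have "set rs \<subseteq> L" using L by (auto simp: rs_def)
  then have *: "mon \<Theta> (rs @ ks) \<in> W \<and> dm \<Theta> Y (rs @ ks) \<in> W"
    by (intro dm_append_mem[OF A W(1) _ m K(3)]) (use W(2) in blast)
  with dm_perm[OF A W(1) rs(1) L(1) rs(2)] show d: "dm \<Theta> Y ls \<in> W" by blast
  then show "mon \<Theta> ls \<in> W"
  proof (cases ls)
    case (Cons a zs)
    \<comment> \<open>A letter of nonzero weight is brought to the front, since
      \<open>mon_mem_of_dm\<close> needs one there.\<close>
    have "mon \<Theta> (a # zs) \<in> W"
    proof -
      have "hd ks \<in> set ls" using K L by (cases ks) auto
      then obtain us vs where ls: "ls = us @ hd ks # vs" by (auto dest: split_list)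
      then have "hd ks \<notin> set us" using L by auto
      then have "dm \<Theta> Y (hd ks # us @ vs) \<in> W"
        using dm_perm[OF A W(1), of ls "hd ks # us @ vs" Y] L(1) d ls by auto
      then have "mon \<Theta> (hd ks # us @ vs) \<in> W"
        using K L ls by (intro mon_mem_of_dm[OF A W(1) W(2), of _ Y]) auto
      then show ?thesis using foldr_move[OF A \<open>hd ks \<notin> set us\<close>, of vs "bv {}"] ls Cons
        subsp_scale[OF W(1)] by metis
    qed
    then show ?thesis using Cons by simp
  qed (use K L in auto)
qed

end

section \<open>Evaluation of algebra elements at operators\<close>

context sign_alg
begin

definition extU :: "nat set \<Rightarrow> (nat set \<Rightarrow> 'k) set" where
  "extU E = {v. \<forall>S. v S \<noteq> 0 \<longrightarrow> S \<subseteq> E}"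

lemma extU_D: "v \<in> extU E \<Longrightarrow> v S \<noteq> 0 \<Longrightarrow> S \<subseteq> E"
  unfolding extU_def by blast

lemma subsp_extU: "subsp (extU E)"
proof -
  have "c * u S + v S \<noteq> 0 \<Longrightarrow> u S \<noteq> 0 \<or> v S \<noteq> 0" for c and u v :: "nat set \<Rightarrow> 'k" and S
    by auto
  then show ?thesis unfolding subsp_def extU_def by blast
qed

lemma subsp_extsp: "subsp (extsp E d :: (nat set \<Rightarrow> 'k) set)"
proof -
  have "c * u S + v S \<noteq> 0 \<Longrightarrow> u S \<noteq> 0 \<or> v S \<noteq> 0" for c and u v :: "nat set \<Rightarrow> 'k" and S
    by auto
  then show ?thesis unfolding subsp_def extsp_def by blast
qed

lemma extsp_extU: "extsp E d \<subseteq> extU E"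
  unfolding extU_def extsp_def by auto

lemma xm_extU: "a \<in> E \<Longrightarrow> v \<in> extU E \<Longrightarrow> xm a v \<in> extU E"
proof -
  assume *: "a \<in> E" "v \<in> extU E"
  have "S \<subseteq> E" if "xm a v S \<noteq> 0" for S
    using extU_D[OF *(2), of "S - {a}"] *(1) that by (auto simp: xm_def split: if_splits)
  then show ?thesis unfolding extU_def by blast
qed

lemma ct_extU: "v \<in> extU E \<Longrightarrow> ct a v \<in> extU E"
proof -
  assume *: "v \<in> extU E"
  have "S \<subseteq> E" if "ct a v S \<noteq> 0" for S
    using extU_D[OF *, of "insert a S"] that by (auto simp: ct_def split: if_splits)
  then show ?thesis unfolding extU_def by blast
qed

lemma bv_extU: "S \<subseteq> E \<Longrightarrow> bv S \<in> extU E"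
  unfolding extU_def bv_def by auto

lemma mon_extU: "set xs \<subseteq> E \<Longrightarrow> mon xm xs \<in> extU E"
  by (induction xs) (auto simp: bv_extU xm_extU)

lemma dm_extU: "set xs \<subseteq> E \<Longrightarrow> dm xm Y xs \<in> extU E"
  by (induction xs)
     (auto simp: mon_extU xm_extU subsp_zero[OF subsp_extU] intro!: subsp_diff[OF subsp_extU] subsp_scale[OF subsp_extU])

lemma mon_insort:
  assumes A: "anti \<Theta>" and "sorted xs" "a \<notin> set xs" "distinct xs"
  shows "mon \<Theta> (insort a xs) = (\<lambda>U. sn a (set xs) * \<Theta> a (mon \<Theta> xs) U)"
  using assms(2-4)
proof (induction xs)
  case Nil
  then show ?case by (simp add: sn_def)
next
  case (Cons b xs)
  show ?case
  proof (cases "a \<le> b")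
    case True
    with Cons.prems have "{x \<in> set (b # xs). x < a} = {}" by auto
    then have "sn a (set (b # xs)) = 1" unfolding sn_def by (simp only:) simp
    then show ?thesis using True by simp
  next
    case False
    with Cons.prems have "sn a (set (b # xs)) = - s * sn a (set xs)" by (simp add: sn_insert)
    moreover have "\<Theta> b (\<Theta> a (mon \<Theta> xs)) = (\<lambda>U. - s * \<Theta> a (\<Theta> b (mon \<Theta> xs)) U)"
      using Cons.prems by (intro antiD(3)[OF A]) auto
    ultimately show ?thesis using False Cons
      by (simp add: linop_scale[OF antiD(1)[OF A]] algebra_simps)
  qed
qed

lemma mon_sorted: "finite S \<Longrightarrow> mon xm (sorted_list_of_set S) = bv S"
proof (induction S rule: finite_induct)
  case (insert a S)
  then show ?case by (simp add: mon_insort[OF anti_xm] xm_bv)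
qed simp

lemma extsp_mon_induct:
  assumes "finite E" "v \<in> extsp E d" "subsp W"
    and "\<And>xs. set xs \<subseteq> E \<Longrightarrow> distinct xs \<Longrightarrow> length xs = d \<Longrightarrow> mon xm xs \<in> W"
  shows "v \<in> W"
proof (rule lspan_bv[where A = "{S. S \<subseteq> E \<and> card S = d}"])
  fix S assume "S \<in> {S. S \<subseteq> E \<and> card S = d}"
  then have "finite S" "S \<subseteq> E" "card S = d" using assms(1) finite_subset by auto
  then show "bv S \<in> W"
    using assms(4)[of "sorted_list_of_set S"] mon_sorted by simp
qed (use assms in \<open>auto simp: extsp_def\<close>)

lemma extU_mon_induct:
  assumes "finite E" "v \<in> extU E" "subsp W"
    and "\<And>xs. set xs \<subseteq> E \<Longrightarrow> distinct xs \<Longrightarrow> mon xm xs \<in> W"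
  shows "v \<in> W"
proof (rule lspan_bv[where A = "Pow E"])
  fix S assume "S \<in> Pow E"
  then have "finite S" "S \<subseteq> E" using assms(1) finite_subset by auto
  then show "bv S \<in> W"
    using assms(4)[of "sorted_list_of_set S"] mon_sorted by simp
qed (use assms in \<open>auto simp: extU_def\<close>)

text \<open>The action of v through the operators \<open>\<Theta>\<close>, applied to the unit
  \<open>bv {}\<close>. When each \<open>\<Theta> a\<close> is multiplication by some element, this
  is the algebra map that sends x_a to that element.\<close>

definition hom :: "nat set \<Rightarrow> (nat \<Rightarrow> (nat set \<Rightarrow> 'k) \<Rightarrow> nat set \<Rightarrow> 'k) \<Rightarrow> (nat set \<Rightarrow> 'k) \<Rightarrow> nat set \<Rightarrow> 'k" where
  "hom E \<Theta> v = (\<lambda>U. \<Sum>S\<in>Pow E. v S * mon \<Theta> (sorted_list_of_set S) U)"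

lemma linop_hom: "linop (hom E \<Theta>)"
  unfolding linop_def hom_def by (simp add: sum.distrib sum_distrib_left algebra_simps)

lemma hom_bv:
  assumes "finite E" "S \<subseteq> E" shows "hom E \<Theta> (bv S) = mon \<Theta> (sorted_list_of_set S)"
proof
  fix U
  have "hom E \<Theta> (bv S) U = (\<Sum>T\<in>Pow E. if T = S then mon \<Theta> (sorted_list_of_set T) U else 0)"
    unfolding hom_def by (rule sum.cong) (auto simp: bv_def)
  then show "hom E \<Theta> (bv S) U = mon \<Theta> (sorted_list_of_set S) U" using assms by simp
qed

lemma hom_xm:
  assumes A: "anti \<Theta>" and "finite E" "a \<in> E" "v \<in> extU E"
  shows "hom E \<Theta> (xm a v) = \<Theta> a (hom E \<Theta> v)"
proof -
  have "v \<in> {v. hom E \<Theta> (xm a v) = \<Theta> a (hom E \<Theta> v)}"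
  proof (rule lspan_bv[where A = "Pow E"])
    fix S assume S: "S \<in> Pow E"
    then have fS: "finite S" using assms(2) finite_subset by auto
    show "bv S \<in> {v. hom E \<Theta> (xm a v) = \<Theta> a (hom E \<Theta> v)}"
    proof (cases "a \<in> S")
      case True
      then have "\<Theta> a (mon \<Theta> (sorted_list_of_set S)) = (\<lambda>_. 0)"
        using foldr_repeat[OF A] fS by simp
      then show ?thesis using True S assms(2)
        by (simp add: xm_bv_mem hom_bv linop_zero[OF linop_hom])
    next
      case False
      then have "mon \<Theta> (sorted_list_of_set (insert a S))
          = (\<lambda>U. sn a S * \<Theta> a (mon \<Theta> (sorted_list_of_set S)) U)"
        using fS mon_insort[OF A, of "sorted_list_of_set S" a] by simp
      then show ?thesis using False S assms(2,3)
        by (simp add: xm_bv linop_scale[OF linop_hom] hom_bv)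
    qed
  next
    show "subsp {v. hom E \<Theta> (xm a v) = \<Theta> a (hom E \<Theta> v)}"
      using linop_comp[OF linop_hom[of E \<Theta>] linop_xm[of a]]
        linop_comp[OF antiD(1)[OF A, of a] linop_hom[of E \<Theta>]] by (rule subsp_equalizer)
  qed (use assms in \<open>auto simp: extU_def\<close>)
  then show ?thesis by simp
qed

lemma hom_mon:
  assumes "anti \<Theta>" "finite E" "set xs \<subseteq> E"
  shows "hom E \<Theta> (mon xm xs) = mon \<Theta> xs"
  using assms(3)
proof (induction xs)
  case Nil
  then show ?case using hom_bv[OF assms(2), of "{}"] by simp
next
  case (Cons a xs)
  then show ?case using hom_xm[OF assms(1,2), of a "mon xm xs"] mon_extU[of xs E] by simp
qed

lemma hom_dm:
  assumes "anti \<Theta>" "finite E" "set xs \<subseteq> E"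
  shows "hom E \<Theta> (dm xm Y xs) = dm \<Theta> Y xs"
  using assms(3)
proof (induction xs)
  case Nil
  then show ?case by (simp add: linop_zero[OF linop_hom])
next
  case (Cons a xs)
  then show ?case using hom_xm[OF assms(1,2), of a "dm xm Y xs"] dm_extU[of xs E Y]
    by (simp add: linop_diff[OF linop_hom] linop_scale[OF linop_hom] hom_mon[OF assms(1,2)])
qed

text \<open>\<open>dm xm\<close> of an increasing word in coordinates. It specialises to
  \<open>osrel\<close> for weights 1 in the exterior case and to \<open>vgrel\<close> for signs in
  the commutative case.\<close>

definition relw :: "(nat \<Rightarrow> 'k) \<Rightarrow> nat set \<Rightarrow> nat set \<Rightarrow> 'k" where
  "relw Y C = (\<lambda>U. \<Sum>c\<in>C. if U = C - {c} then sn c C * Y c else 0)"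

lemma dm_eq_relw:
  assumes "sorted xs" "distinct xs" shows "dm xm Y xs = relw Y (set xs)"
  using assms
proof (induction xs)
  case Nil
  then show ?case by (simp add: relw_def)
next
  case (Cons a xs)
  let ?S = "set xs"
  have aS: "a \<notin> ?S" and lt: "\<And>c. c \<in> ?S \<Longrightarrow> a < c" using Cons.prems by (auto simp: le_less)
  have mon: "mon xm xs = bv ?S"
    using mon_sorted[of ?S] Cons.prems sorted_list_of_set.idem_if_sorted_distinct by fastforce
  \<comment> \<open>The head a is smaller than all other letters, so putting x_a in front costs no
    sign.\<close>
  have "{x \<in> insert a ?S. x < a} = {}" "\<And>c. {x \<in> ?S - {c}. x < a} = {}" by (auto dest: lt)
  then have sa: "sn a (insert a ?S) = 1" "\<And>U. U \<subseteq> insert a ?S \<Longrightarrow> sn a U = 1"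
  proof -
    fix U assume "U \<subseteq> insert a ?S"
    then have "{x \<in> U. x < a} = {}" by (auto dest: lt dest!: subsetD)
    then show "sn a U = 1" unfolding sn_def by (simp only:) simp
  next
    assume "{x \<in> insert a ?S. x < a} = {}"
    then show "sn a (insert a ?S) = 1" unfolding sn_def by (simp only:) simp
  qed
  show ?case
  proof
    fix U
    have "xm a (dm xm Y xs) U = (\<Sum>c\<in>?S. if U = insert a ?S - {c} then sn c ?S * Y c else 0)"
    proof (cases "a \<in> U")
      case True
      have "xm a (dm xm Y xs) U = sn a U * (\<Sum>c\<in>?S. if U - {a} = ?S - {c} then sn c ?S * Y c else 0)"
      proof -
        have IH: "dm xm Y xs = relw Y ?S" using Cons by auto
        have "xm a (relw Y ?S) U = sn a U * relw Y ?S (U - {a})" using True by (simp add: xm_def)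
        then show ?thesis unfolding IH by (simp only: relw_def)
      qed
      also have "\<dots> = (\<Sum>c\<in>?S. if U = insert a ?S - {c} then sn c ?S * Y c else 0)"
        unfolding sum_distrib_left
      proof (rule sum.cong[OF refl])
        fix c assume c: "c \<in> ?S"
        have "U - {a} = ?S - {c} \<longleftrightarrow> U = insert a ?S - {c}" using c True aS by blast
        then show "sn a U * (if U - {a} = ?S - {c} then sn c ?S * Y c else 0)
            = (if U = insert a ?S - {c} then sn c ?S * Y c else 0)"
          using sa(2)[of U] by auto
      qed
      finally show ?thesis .
    next
      case False
      then have "\<And>c. c \<in> ?S \<Longrightarrow> U \<noteq> insert a ?S - {c}" using aS by auto
      then show ?thesis using False by (simp add: xm_def)
    qed
    moreover have "(if U = insert a ?S - {a} then sn a (insert a ?S) * Y a else 0) = Y a * bv ?S U"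
      using aS sa(1) by (simp add: bv_def)
    moreover have "(\<Sum>c\<in>?S. if U = insert a ?S - {c} then sn c (insert a ?S) * Y c else 0)
      = - s * (\<Sum>c\<in>?S. if U = insert a ?S - {c} then sn c ?S * Y c else 0)"
      unfolding sum_distrib_left by (rule sum.cong) (use lt aS in \<open>auto simp: sn_insert\<close>)
    ultimately show "dm xm Y (a # xs) U = relw Y (set (a # xs)) U"
      unfolding relw_def list.set dm.simps mon by (subst sum.insert) (use aS in simp_all)
  qed
qed

section \<open>Ideals generated by relations\<close>

lemma lmul_eq:
  assumes "finite E" "T \<subseteq> E"
  shows "lmul ext E T (v :: nat set \<Rightarrow> 'k) = (\<lambda>U. if T \<subseteq> U \<and> U \<subseteq> E then cf ext T (U - T) * v (U - T) else 0)"
proof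
  fix U
  have "lmul ext E T v U = (\<Sum>S\<in>Pow E. if S = U - T then if T \<subseteq> U \<and> U \<subseteq> E then cf ext T S * v S else 0 else 0)"
    unfolding lmul_def by (rule sum.cong) (use assms in \<open>auto simp: cf_def\<close>)
  also have "\<dots> = (if U - T \<in> Pow E then if T \<subseteq> U \<and> U \<subseteq> E then cf ext T (U - T) * v (U - T) else 0 else 0)"
    using assms by (subst sum.delta) auto
  finally show "lmul ext E T v U = (if T \<subseteq> U \<and> U \<subseteq> E then cf ext T (U - T) * v (U - T) else 0)"
    by auto
qed

lemma cf_insert:
  assumes "finite T" "finite S" "a \<notin> T" "a \<notin> S"
  shows "(cf ext (insert a T) S :: 'k) = sn a S * cf ext T S"
proof -
  have "{(t,x). t \<in> insert a T \<and> x \<in> S \<and> x < t}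
      = Pair a ` {x \<in> S. x < a} \<union> {(t,x). t \<in> T \<and> x \<in> S \<and> x < t}" by auto
  moreover have "finite {(t,x). t \<in> T \<and> x \<in> S \<and> x < t}"
    by (rule finite_subset[of _ "T \<times> S"]) (use assms in auto)
  ultimately have "card {(t,x). t \<in> insert a T \<and> x \<in> S \<and> x < t}
      = card {x \<in> S. x < a} + card {(t,x). t \<in> T \<and> x \<in> S \<and> x < t}"
    using assms by (simp only:) (subst card_Un_disjoint; auto simp: card_image inj_on_def)
  then show ?thesis using assms(4) by (auto simp: cf_def sn_def power_add)
qed

text \<open>Left multiplication by e_T is iterated \<open>xm\<close> up to sign; hence closure under
  the single operators \<open>xm\<close> is all that has to be checked for an ideal.\<close>

lemma lmul_insert:
  assumes "finite E" "insert a T \<subseteq> E" "a \<notin> T"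
  shows "lmul ext E (insert a T) (v :: nat set \<Rightarrow> 'k) = (\<lambda>U. sn a T * xm a (lmul ext E T v) U)"
proof
  fix U
  show "lmul ext E (insert a T) v U = sn a T * xm a (lmul ext E T v) U"
  proof (cases "insert a T \<subseteq> U \<and> U \<subseteq> E")
    case True
    then have f: "finite U" "finite T" using assms finite_subset by auto
    let ?S = "U - insert a T"
    have "U - {a} = T \<union> ?S" using True assms(3) by auto
    then have "sn a U = sn a T * sn a ?S" using sn_Un[of T ?S a] sn_self(2)[of a U] by auto
    moreover have "U - {a} - T = ?S" by auto
    moreover have "T \<subseteq> U - {a}" using True assms(3) by auto
    moreover have "(cf ext (insert a T) ?S :: 'k) = sn a ?S * cf ext T ?S"
      using f assms(3) by (intro cf_insert) auto
    ultimately show ?thesis using True assms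
      by (subst lmul_eq; simp add: xm_def; subst lmul_eq) (auto simp: mult.assoc)
  next
    case False
    then show ?thesis using assms by (subst lmul_eq; simp add: xm_def; subst lmul_eq) auto
  qed
qed

lemma lmul_empty:
  assumes "finite E" "v \<in> extU E" shows "lmul ext E {} v = v"
  using assms by (subst lmul_eq) (auto simp: cf_def fun_eq_iff extU_def)

lemma xm_lmul_mem:
  assumes "finite E" "T \<subseteq> E" "a \<in> T"
  shows "xm a (lmul ext E T (v :: nat set \<Rightarrow> 'k)) = (\<lambda>_. 0)"
  using assms by (subst lmul_eq) (auto simp: xm_def fun_eq_iff)

lemma lmul_mem:
  assumes "finite E" "T \<subseteq> E" "v \<in> extU E" "v \<in> W" "subsp W"
    and "\<And>a w. a \<in> E \<Longrightarrow> w \<in> W \<Longrightarrow> xm a w \<in> W"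
  shows "lmul ext E T v \<in> W"
proof -
  have "finite T" by (rule finite_subset[OF assms(2,1)])
  then show ?thesis using assms(2)
  proof (induction T rule: finite_induct)
    case empty
    then show ?case using assms by (simp add: lmul_empty)
  next
    case (insert a T)
    then show ?case using assms(1,6) by (simp add: lmul_insert subsp_scale[OF assms(5)])
  qed
qed

definition rels_in :: "nat set \<Rightarrow> (nat \<times> (nat set \<Rightarrow> 'k)) set \<Rightarrow> bool" where
  "rels_in E R \<longleftrightarrow> (\<forall>(k, r)\<in>R. r \<in> extsp E k)"

lemma subsp_idl: "subsp (idl ext E R d)"
  unfolding idl_def by (rule subsp_lspan)

lemma xm_idl:
  assumes "finite E" "a \<in> E" "v \<in> idl ext E R d" shows "xm a (v :: nat set \<Rightarrow> 'k) \<in> idl ext E R (Suc d)"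
proof -
  have "idl ext E R d \<subseteq> {v :: nat set \<Rightarrow> 'k. xm a v \<in> idl ext E R (Suc d)}"
    unfolding idl_def[of ext E R d]
  proof (rule lspan_minimal, rule subsp_vimage[OF subsp_idl linop_xm], clarify)
    fix T k r assume T: "T \<subseteq> E" "(k, r) \<in> R" "d = card T + k"
    show "xm a (lmul ext E T r) \<in> idl ext E R (Suc (card T + k))"
    proof (cases "a \<in> T")
      case True
      then show ?thesis using T assms(1) by (simp add: xm_lmul_mem subsp_zero[OF subsp_idl])
    next
      case False
      then have "lmul ext E (insert a T) r = (\<lambda>U. sn a T * xm a (lmul ext E T r) U)"
        using T assms by (intro lmul_insert) auto
      moreover have "card (insert a T) = Suc (card T)" using False finite_subset[OF T(1) assms(1)] by simp
      then have "lmul ext E (insert a T) r \<in> idl ext E R (Suc (card T + k))"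
        unfolding idl_def using T assms(2) by (intro lspan_base) force
      ultimately show ?thesis using subsp_scaleE[OF subsp_idl _ sn_nz] by metis
    qed
  qed
  then show ?thesis using assms(3) by auto
qed

text \<open>The closure step may assume that v lies in \<open>extU E\<close>, which is where rules
  such as \<open>phi_xm\<close> and \<open>res_xm\<close> are available.\<close>

lemma idl_induct:
  assumes "finite E" "rels_in E R" "subsp W"
    and "\<And>k r. (k, r) \<in> R \<Longrightarrow> r \<in> W" "\<And>a v. a \<in> E \<Longrightarrow> v \<in> W \<Longrightarrow> v \<in> extU E \<Longrightarrow> xm a v \<in> W"
  shows "idl ext E R d \<subseteq> W"
proof -
  have "lmul ext E T r \<in> W \<inter> extU E" if "T \<subseteq> E" "(k, r) \<in> R" for T k r
  proof (rule lmul_mem)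
    show "r \<in> extU E" using that assms(2) extsp_extU unfolding rels_in_def by blast
    then show "r \<in> W \<inter> extU E" using that assms(4) by blast
    show "subsp (W \<inter> extU E)" by (rule subsp_Int[OF assms(3) subsp_extU])
  qed (use that assms xm_extU in auto)
  then show ?thesis unfolding idl_def by (intro lspan_minimal assms(3)) auto
qed

lemma lmul_extsp:
  assumes "finite E" "T \<subseteq> E" "v \<in> extsp E k"
  shows "lmul ext E T v \<in> (extsp E (card T + k) :: (nat set \<Rightarrow> 'k) set)"
proof -
  have "card U = card T + k" if "T \<subseteq> U" "U \<subseteq> E" "v (U - T) \<noteq> 0" for U
  proof -
    have "card (U - T) = k" using that assms(3) by (auto simp: extsp_def)
    moreover have "finite U" using that assms(1) finite_subset by auto
    ultimately show ?thesis using that(1) card_Diff_subset[of T U] card_mono[of U T] finite_subset by fastforce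
  qed
  then show ?thesis using assms by (subst lmul_eq) (auto simp: extsp_def)
qed

lemma idl_extsp:
  assumes "finite E" "rels_in E R" shows "idl ext E R d \<subseteq> extsp E d"
  unfolding idl_def
proof (rule lspan_minimal[OF subsp_extsp], clarify)
  fix T k r assume "T \<subseteq> E" "(k, r) \<in> R"
  then show "lmul ext E T r \<in> extsp E (card T + k)"
    using assms by (intro lmul_extsp) (auto simp: rels_in_def)
qed

lemma idl_gen:
  assumes "finite E" "rels_in E R" "(k, r) \<in> R" shows "r \<in> idl ext E R k"
proof -
  have "lmul ext E {} r = r" using assms subsetD[OF extsp_extU, of r E k] by (intro lmul_empty) (auto simp: rels_in_def)
  then show ?thesis unfolding idl_def using assms(3) by (intro lspan_base CollectI exI[of _ "{}"]) force
qed

text \<open>The ideal without its grading: all homogeneous components lie in \<open>idl\<close>.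
  Maps such as residues, which shift the degree, can then be treated without degree indices, and
  \<open>uidl_idl\<close> returns to a fixed degree.\<close>

definition uidl :: "nat set \<Rightarrow> (nat \<times> (nat set \<Rightarrow> 'k)) set \<Rightarrow> (nat set \<Rightarrow> 'k) set" where
  "uidl E R = {v. \<forall>d. (\<lambda>U. if card U = d then v U else 0) \<in> idl ext E R d}"

lemma subsp_uidl: "subsp (uidl E R)"
  unfolding subsp_def uidl_def
proof (intro conjI allI ballI)
  show "(\<lambda>_. 0) \<in> {v. \<forall>d. (\<lambda>U. if card U = d then v U else 0) \<in> idl ext E R d}"
    using subsp_zero[OF subsp_idl] by auto
  fix c u v
  assume *: "u \<in> {v. \<forall>d. (\<lambda>U. if card U = d then v U else 0) \<in> idl ext E R d}"
    "v \<in> {v. \<forall>d. (\<lambda>U. if card U = d then v U else 0) \<in> idl ext E R d}"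
  have "(\<lambda>U. if card U = d then c * u U + v U else 0) \<in> idl ext E R d" for d
  proof -
    have "(\<lambda>U. c * (if card U = d then u U else 0) + (if card U = d then v U else 0)) \<in> idl ext E R d"
      using * by (intro subspD[OF subsp_idl]) auto
    moreover have "(\<lambda>U. c * (if card U = d then u U else 0) + (if card U = d then v U else 0))
        = (\<lambda>U. if card U = d then c * u U + v U else 0)" by auto
    ultimately show ?thesis by simp
  qed
  then show "(\<lambda>U. c * u U + v U) \<in> {v. \<forall>d. (\<lambda>U. if card U = d then v U else 0) \<in> idl ext E R d}"
    by simp
qed

lemma uidl_extU: assumes "finite E" "rels_in E R" shows "uidl E R \<subseteq> extU E"
proof
  fix v assume v: "v \<in> uidl E R"
  have "S \<subseteq> E" if "v S \<noteq> 0" for S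
  proof -
    have "(\<lambda>U. if card U = card S then v U else 0) \<in> extU E"
    proof (rule subsetD[OF extsp_extU], rule subsetD[OF idl_extsp[OF assms]])
      show "(\<lambda>U. if card U = card S then v U else 0) \<in> idl ext E R (card S)"
        using v unfolding uidl_def by simp
    qed
    from extU_D[OF this, of S] that show ?thesis by simp
  qed
  then show "v \<in> extU E" unfolding extU_def by blast
qed

lemma xm_uidl:
  assumes "finite E" "rels_in E R" "a \<in> E" "v \<in> uidl E R" shows "xm a v \<in> uidl E R"
proof -
  \<comment> \<open>\<open>card\<close> is 0 on infinite sets, so the component of degree 0 sees
    them, and v has to vanish there.\<close>
  have fin: "v U = 0" if "infinite U" for U
  proof (rule ccontr)
    assume "v U \<noteq> 0"
    moreover have "v \<in> extU E" using assms(4) uidl_extU[OF assms(1,2)] by (rule rev_subsetD)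
    ultimately have "U \<subseteq> E" by (rule extU_D[rotated])
    then show False using that assms(1) finite_subset by metis
  qed
  have "(\<lambda>U. if card U = d then xm a v U else 0) \<in> idl ext E R d" for d
  proof (cases d)
    case 0
    then have "(\<lambda>U. if card U = d then xm a v U else 0) = (\<lambda>_. 0)"
      using fin by (auto simp: xm_def card_eq_0_iff fun_eq_iff)
    then show ?thesis by (simp add: subsp_zero[OF subsp_idl])
  next
    case (Suc d')
    have "(\<lambda>U. if card U = d then xm a v U else 0) = xm a (\<lambda>U. if card U = d' then v U else 0)"
    proof
      fix U
      show "(if card U = d then xm a v U else 0) = xm a (\<lambda>U. if card U = d' then v U else 0) U"
        using fin[of "U - {a}"] Suc card_Suc_Diff1[of U a] by (cases "finite U") (auto simp: xm_def)
    qed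
    then show ?thesis using assms(4) Suc unfolding uidl_def by (auto intro!: xm_idl assms)
  qed
  then show ?thesis unfolding uidl_def by blast
qed

lemma idl_uidl:
  assumes "finite E" "rels_in E R" shows "idl ext E R d \<subseteq> uidl E R"
proof
  fix v :: "nat set \<Rightarrow> 'k" assume v: "v \<in> idl ext E R d"
  then have "v \<in> extsp E d" using idl_extsp[OF assms] by blast
  then have "(\<lambda>U. if card U = d' then v U else 0) = (if d' = d then v else (\<lambda>_. 0))" for d'
    by (auto simp: extsp_def fun_eq_iff)
  then show "v \<in> uidl E R" unfolding uidl_def using v subsp_zero[OF subsp_idl] by auto
qed

lemma uidl_idl:
  assumes "v \<in> uidl E R" "v \<in> extsp E d" shows "v \<in> idl ext E R d"
proof -
  have "(\<lambda>U. if card U = d then v U else 0) = v" using assms(2) by (auto simp: extsp_def fun_eq_iff)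
  moreover have "(\<lambda>U. if card U = d then v U else 0) \<in> idl ext E R d"
    using assms(1) unfolding uidl_def by simp
  ultimately show ?thesis by simp
qed

end

context sign_alg
begin

lemma xm_extsp:
  assumes "finite E" "a \<in> E" "v \<in> extsp E d" shows "xm a v \<in> extsp E (Suc d)"
proof -
  have "U \<subseteq> E \<and> card U = Suc d" if "xm a v U \<noteq> 0" for U
  proof -
    have a: "a \<in> U" "v (U - {a}) \<noteq> 0" using that by (auto simp: xm_def split: if_splits)
    then have U: "U - {a} \<subseteq> E" "card (U - {a}) = d" using assms(3) by (auto simp: extsp_def)
    then have "U \<subseteq> E" using assms(2) by auto
    then show ?thesis using a(1) U(2) card_Suc_Diff1[of U a] finite_subset[OF _ assms(1)] by auto
  qed
  then show ?thesis unfolding extsp_def by simp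
qed

lemma mon_extsp: "finite E \<Longrightarrow> set xs \<subseteq> E \<Longrightarrow> mon xm xs \<in> extsp E (length xs)"
proof (induction xs)
  case Nil
  then show ?case by (auto simp: extsp_def bv_def)
qed (auto simp: xm_extsp)

lemma dm_extsp: "finite E \<Longrightarrow> set xs \<subseteq> E \<Longrightarrow> dm xm Y xs \<in> extsp E (length xs - 1)"
proof (induction xs)
  case Nil
  then show ?case by (auto simp: extsp_def)
next
  case (Cons a xs)
  then have "xm a (dm xm Y xs) \<in> extsp E (length xs)"
    using xm_extsp[of E a "dm xm Y xs" "length xs - 1"]
    by (cases xs) (auto simp: linop_zero[OF linop_xm] subsp_zero[OF subsp_extsp])
  then show ?case
    using Cons by (auto intro!: subsp_diff[OF subsp_extsp] subsp_scale[OF subsp_extsp] mon_extsp)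
qed

lemma dm_op_cong:
  assumes "\<And>a v. a \<in> set xs \<Longrightarrow> \<Theta> a v = \<Theta>' a v" shows "dm \<Theta> Y xs = dm \<Theta>' Y xs"
proof -
  have "mon \<Theta> xs = mon \<Theta>' xs \<and> dm \<Theta> Y xs = dm \<Theta>' Y xs"
    using assms by (induction xs) auto
  then show ?thesis ..
qed

end

section \<open>Circuits weighted by signs, and a modular hyperplane\<close>

definition supp :: "('a \<Rightarrow> 'k::zero) \<Rightarrow> 'a set" where
  "supp X = {e. X e \<noteq> 0}"

lemma supp_iff [simp]: "e \<in> supp X \<longleftrightarrow> X e \<noteq> 0"
  by (simp add: supp_def)

lemma supp_nz: "supp X = A \<Longrightarrow> e \<in> A \<Longrightarrow> X e \<noteq> 0"
  by (auto simp: supp_def)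

text \<open>Signed circuits are their sign functions and circuits are their indicator functions; with the sign
  \<open>s\<close> the two elimination axioms take the same form. Modularity of \<open>F\<close> only enters through
  the last two assumptions.\<close>

locale fibration = sign_alg ext s for ext and s :: "'k::field" +
  fixes E F :: "nat set" and XX :: "(nat \<Rightarrow> 'k) set"
  assumes finE: "finite E" and FE: "F \<subseteq> E"
    and circ_val: "X \<in> XX \<Longrightarrow> X e = 0 \<or> X e = 1 \<or> X e = - 1"
    and circ_E: "X \<in> XX \<Longrightarrow> supp X \<subseteq> E"
    and circ_card: "X \<in> XX \<Longrightarrow> 3 \<le> card (supp X)"
    and circ_eq: "X \<in> XX \<Longrightarrow> Y \<in> XX \<Longrightarrow> supp X = supp Y \<Longrightarrow> X = Y \<or> X = (\<lambda>e. - Y e)"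
    and elim: "X \<in> XX \<Longrightarrow> Y \<in> XX \<Longrightarrow> supp X \<noteq> supp Y \<Longrightarrow> X e \<noteq> 0 \<Longrightarrow> Y e \<noteq> 0 \<Longrightarrow>
      \<exists>Z\<in>XX. Z e = 0 \<and> (\<forall>c. Z c = 0 \<or> Z c = X c \<or> Z c = s * X e * Y e * Y c)"
    and hyperplane: "X \<in> XX \<Longrightarrow> supp X - F \<noteq> {m}"
    and line_meets: "m \<in> E - F \<Longrightarrow> l \<in> E - F \<Longrightarrow> m \<noteq> l \<Longrightarrow> \<exists>f\<in>F. \<exists>Y\<in>XX. supp Y = {m, l, f}"
begin

lemma circ_sq: "X \<in> XX \<Longrightarrow> X e \<noteq> 0 \<Longrightarrow> X e * X e = 1"
  using circ_val[of X e] by auto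

lemma circ_sq': "X \<in> XX \<Longrightarrow> X e \<noteq> 0 \<Longrightarrow> X e * (X e * c) = c"
  using circ_sq by (simp add: mult.assoc[symmetric])

lemma supp_fin: "X \<in> XX \<Longrightarrow> finite (supp X)"
  using circ_E finE finite_subset by blast

lemma finF: "finite F"
  using FE finE finite_subset by blast

text \<open>In the signed case the multiple of Y by s X_e Y_e has at e the sign opposite to X, as
  elimination requires; in the unsigned case the factor is 1. A nonzero value of Z comes from X or
  from Y, which bounds its support.\<close>

lemma elim_supp:
  assumes "X \<in> XX" "Y \<in> XX" "supp X \<noteq> supp Y" "X e \<noteq> 0" "Y e \<noteq> 0"
  obtains Z where "Z \<in> XX" "Z e = 0" "supp Z \<subseteq> (supp X \<union> supp Y) - {e}"
    "\<And>c. Z c = 0 \<or> Z c = X c \<or> Z c = s * X e * Y e * Y c"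
proof -
  obtain Z where Z: "Z \<in> XX" "Z e = 0" "\<And>c. Z c = 0 \<or> Z c = X c \<or> Z c = s * X e * Y e * Y c"
    using elim[OF assms] by blast
  have "X c \<noteq> 0 \<or> Y c \<noteq> 0" if "Z c \<noteq> 0" for c
    using Z(3)[of c] that by auto
  then have "supp Z \<subseteq> (supp X \<union> supp Y) - {e}" using Z(2) by auto
  with Z that show thesis by blast
qed

text \<open>The line through \<open>m\<close> and \<open>a\<close> meets \<open>F\<close> in \<open>psi m a\<close>, and \<open>x\<^sub>a = kap m a x\<^bsub>psi m a\<^esub>\<close> holds in
  the contraction by \<open>m\<close>. The value \<open>psi m m\<close> is junk, and always comes with the factor \<open>kap m m = 0\<close>.\<close>

definition psi :: "nat \<Rightarrow> nat \<Rightarrow> nat" where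
  "psi m a = (if a \<in> F then a else SOME f. f \<in> F \<and> (\<exists>Y\<in>XX. supp Y = {m, a, f}))"

definition kap :: "nat \<Rightarrow> nat \<Rightarrow> 'k" where
  "kap m a = (if a \<in> F then 1 else if a \<notin> E \<or> a = m then 0
     else SOME k. \<exists>Y\<in>XX. supp Y = {m, a, psi m a} \<and> k = s * Y a * Y (psi m a))"

lemma psi_mem [simp]: "a \<in> F \<Longrightarrow> psi m a = a"
  by (simp add: psi_def)

lemma kap_mem [simp]: "a \<in> F \<Longrightarrow> kap m a = 1"
  by (simp add: kap_def)

lemma kap_self [simp]: "m \<notin> F \<Longrightarrow> kap m m = 0"
  by (simp add: kap_def)

lemma kap_outside: "a \<notin> E \<Longrightarrow> kap m a = 0"
  using FE by (auto simp: kap_def)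

lemma not_small: "X \<in> XX \<Longrightarrow> \<not> supp X \<subseteq> {a, b}"
proof
  assume "X \<in> XX" "supp X \<subseteq> {a, b}"
  then have "3 \<le> card (supp X)" "card (supp X) \<le> card {a, b}"
    using circ_card card_mono[of "{a, b}" "supp X"] by auto
  then show False by (auto simp: card_insert_if split: if_splits)
qed

text \<open>Two points f and f' of F on the line through m and a would give, after elimination of m,
  a circuit inside {a, f, f'}. It cannot contain a, which would be its only element outside F, and
  inside {f, f'} it would be too small.\<close>

lemma psi_unique:
  assumes "m \<in> E - F" "a \<in> E - F" "f \<in> F" "Y \<in> XX" "supp Y = {m, a, f}"
  shows "psi m a = f"
proof -
  have "f' = f" if f': "f' \<in> F" "Y' \<in> XX" "supp Y' = {m, a, f'}" for f' Y'
  proof (rule ccontr)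
    assume "f' \<noteq> f"
    have ne: "supp Y' \<noteq> supp Y"
    proof
      assume "supp Y' = supp Y"
      moreover have "f \<noteq> m" "f \<noteq> a" using assms(1-3) by auto
      ultimately show False using \<open>f' \<noteq> f\<close> unfolding assms(5) f'(3) by auto
    qed
    have nz: "Y' m \<noteq> 0" "Y m \<noteq> 0" by (simp_all add: supp_nz[OF assms(5)] supp_nz[OF f'(3)])
    obtain Z where Z: "Z \<in> XX" "supp Z \<subseteq> (supp Y' \<union> supp Y) - {m}"
      by (rule elim_supp[OF f'(2) assms(4) ne nz])
    then have sub: "supp Z \<subseteq> {a, f, f'}" using assms(5) f'(3) by auto
    have "a \<notin> supp Z"
    proof
      assume "a \<in> supp Z"
      then have "supp Z - F = {a}" using sub assms(2,3) f'(1) by auto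
      then show False using hyperplane[OF Z(1)] by blast
    qed
    with sub have "supp Z \<subseteq> {f, f'}" by auto
    with not_small[OF Z(1)] show False by blast
  qed
  moreover have "f \<in> F \<and> (\<exists>Y\<in>XX. supp Y = {m, a, f})"
    by (intro conjI bexI[of _ Y] assms)
  ultimately have "(SOME f. f \<in> F \<and> (\<exists>Y\<in>XX. supp Y = {m, a, f})) = f"
    by (intro some_equality) auto
  then show ?thesis using assms(2) by (simp add: psi_def)
qed

text \<open>The value is quadratic in Y, hence the same for the two opposite circuits on one
  support. This makes the choice in \<open>kap\<close> harmless.\<close>

lemma kap_unique:
  assumes "m \<in> E - F" "a \<in> E - F" "m \<noteq> a" "f \<in> F" "Y \<in> XX" "supp Y = {m, a, f}"
  shows "kap m a = s * Y a * Y f"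
proof -
  have psi: "psi m a = f" using psi_unique assms by blast
  have "(SOME k. \<exists>Y\<in>XX. supp Y = {m, a, f} \<and> k = s * Y a * Y f) = s * Y a * Y f"
  proof (rule some_equality)
    fix k assume "\<exists>Y\<in>XX. supp Y = {m, a, f} \<and> k = s * Y a * Y f"
    then obtain Y' where Y': "Y' \<in> XX" "supp Y' = supp Y" "k = s * Y' a * Y' f" using assms(6) by auto
    then have "Y' = Y \<or> Y' = (\<lambda>e. - Y e)" using circ_eq assms(5) by metis
    with Y'(3) show "k = s * Y a * Y f" by auto
  qed (use assms in blast)
  then show ?thesis using assms(2,3) by (simp add: kap_def psi)
qed

lemma line_circuit:
  assumes "m \<in> E - F" "a \<in> E - F" "m \<noteq> a"
  obtains Y where "Y \<in> XX" "supp Y = {m, a, psi m a}" "kap m a = s * Y a * Y (psi m a)"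
    "kap a m = s * Y m * Y (psi m a)" "psi m a \<in> F" "psi a m = psi m a"
proof -
  obtain f Y where Y: "f \<in> F" "Y \<in> XX" "supp Y = {m, a, f}" using line_meets[OF assms] by blast
  have "psi m a = f" using psi_unique[OF assms(1,2) Y] .
  moreover have Y3: "supp Y = {a, m, f}" using Y by auto
  then have "psi a m = f" using psi_unique[OF assms(2,1) Y(1,2)] by blast
  ultimately show thesis
    using that[of Y] Y Y3 kap_unique[OF assms Y] kap_unique[OF assms(2,1) _ Y(1,2) Y3] assms(3) by auto
qed

lemma psi_F: assumes "m \<in> E - F" "a \<in> E" "a \<noteq> m" shows "psi m a \<in> F"
  using assms line_circuit[of m a] by (cases "a \<in> F") auto

lemma kap_sq:
  assumes "m \<in> E - F" "a \<in> E" "a \<noteq> m" shows "kap m a * kap m a = 1"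
proof (cases "a \<in> F")
  case False
  then obtain Y where Y: "Y \<in> XX" "supp Y = {m, a, psi m a}" "kap m a = s * Y a * Y (psi m a)"
    using line_circuit[of m a] assms by auto
  then have "Y a \<noteq> 0" "Y (psi m a) \<noteq> 0" by (simp_all add: supp_nz[of Y])
  then show ?thesis using Y by (simp add: algebra_simps circ_sq' circ_sq)
qed simp

text \<open>Multiplication by the image of x_a under the projection from m; it is zero for a =
  m.\<close>

definition Th :: "nat \<Rightarrow> nat \<Rightarrow> (nat set \<Rightarrow> 'k) \<Rightarrow> nat set \<Rightarrow> 'k" where
  "Th m a v = (\<lambda>U. kap m a * xm (psi m a) v U)"

lemma anti_Th: "anti (Th m)"
proof -
  have "Th m a (Th m b v) = (\<lambda>U. - s * Th m b (Th m a v) U)" for a b v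
  proof (cases "psi m a = psi m b")
    case True
    then show ?thesis by (simp add: Th_def linop_scale[OF linop_xm])
  next
    case False
    then show ?thesis by (simp add: Th_def linop_scale[OF linop_xm] xm_anticomm[OF False] algebra_simps)
  qed
  moreover have "linop (Th m a)" for a
    unfolding Th_def by (rule linop_smult[OF linop_xm])
  ultimately show ?thesis
    unfolding anti_def by (simp add: Th_def linop_scale[OF linop_xm])
qed

definition rel :: "(nat \<Rightarrow> 'k) \<Rightarrow> nat \<times> (nat set \<Rightarrow> 'k)" where
  "rel X = (card (supp X) - 1, dm xm X (sorted_list_of_set (supp X)))"

definition RA :: "(nat \<times> (nat set \<Rightarrow> 'k)) set" where "RA = rel ` XX"
definition RB :: "(nat \<times> (nat set \<Rightarrow> 'k)) set" where "RB = rel ` {X \<in> XX. supp X \<subseteq> F}"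

lemma rels_in_RA: "rels_in E RA"
proof -
  have "dm xm X (sorted_list_of_set (supp X)) \<in> extsp E (card (supp X) - 1)" if "X \<in> XX" for X
    using dm_extsp[OF finE, of "sorted_list_of_set (supp X)" X] circ_E[OF that] supp_fin[OF that] by simp
  then show ?thesis unfolding rels_in_def RA_def rel_def by auto
qed

lemma rels_in_RB: "rels_in F RB"
proof -
  have "dm xm X (sorted_list_of_set (supp X)) \<in> extsp F (card (supp X) - 1)"
    if "X \<in> XX" "supp X \<subseteq> F" for X
    using dm_extsp[OF finF, of "sorted_list_of_set (supp X)" X] that supp_fin[OF that(1)] by simp
  then show ?thesis unfolding rels_in_def RB_def rel_def by auto
qed

lemma Th_uidl:
  assumes "m \<in> E - F" "a \<in> E" "v \<in> uidl F RB" shows "Th m a v \<in> uidl F RB"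
proof (cases "a = m")
  case True
  then show ?thesis using assms(1) by (simp add: Th_def subsp_zero[OF subsp_uidl])
next
  case False
  then show ?thesis unfolding Th_def
    by (intro subsp_scale[OF subsp_uidl] xm_uidl finF rels_in_RB psi_F assms)
qed

lemma Th_mem: "f \<in> F \<Longrightarrow> Th m f = xm f"
  by (simp add: Th_def fun_eq_iff)

text \<open>The relations of the contraction by \<open>m\<close>, with every element replaced by the parallel
  element of \<open>F\<close>, are consequences of the relations of the restriction to \<open>F\<close>: elements
  outside \<open>F\<close> are eliminated one at a time by means of the three-point lines through \<open>m\<close>.\<close>

lemma contraction_relation:
  assumes m: "m \<in> E - F"
  shows "X \<in> XX \<Longrightarrow> distinct xs \<Longrightarrow> set xs = supp X - {m} \<Longrightarrow> dm (Th m) X xs \<in> uidl F RB"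
proof (induction "card (supp X - F - {m})" arbitrary: X xs rule: less_induct)
  case less
  note X = less.prems(1)
  let ?J = "uidl F RB"
  note J = subsp_uidl[of F RB]
  have clos: "\<And>a v. a \<in> E \<Longrightarrow> v \<in> ?J \<Longrightarrow> Th m a v \<in> ?J" using Th_uidl[OF m] .
  note perm = dm_perm[OF anti_Th[of m] J less.prems(2)]
  show ?case
  proof (cases "supp X - F - {m} = {}")
    case True
    \<comment> \<open>Whether or not m lies in the support, no circuit leaves F in m alone.\<close>
    then have XF: "supp X \<subseteq> F" using hyperplane[OF X] by blast
    let ?zs = "sorted_list_of_set (supp X)"
    have "rel X \<in> RB" using X XF by (auto simp: RB_def)
    then have "dm xm X ?zs \<in> ?J"
      using idl_gen[OF finF rels_in_RB] subsetD[OF idl_uidl[OF finF rels_in_RB]] by (metis rel_def)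
    moreover have "dm (Th m) X ?zs = dm xm X ?zs"
      by (rule dm_op_cong) (use XF supp_fin[OF X] in \<open>auto simp: Th_mem\<close>)
    ultimately have "dm (Th m) X ?zs \<in> ?J" by simp
    moreover have "set xs = set ?zs" using XF m less.prems(3) supp_fin[OF X] by auto
    ultimately show ?thesis using perm[of ?zs X] by simp
  next
    case False
    then obtain l where l: "l \<in> supp X" "l \<notin> F" "l \<noteq> m" by blast
    then have lE: "l \<in> E - F" using circ_E[OF X] by blast
    define f where "f = psi m l"
    obtain Y where Y: "Y \<in> XX" "supp Y = {m, l, f}" "kap m l = s * Y l * Y f" "f \<in> F"
      using line_circuit[OF m lE l(3)[symmetric]] unfolding f_def by metis
    have fl: "f \<noteq> l" "f \<noteq> m" using Y(4) l m by auto
    have Yl: "Y l \<noteq> 0" by (simp add: supp_nz[OF Y(2)])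
    have fE: "f \<in> E" using Y(4) FE by blast
    have kk: "kap m l * kap m l = 1" "\<And>c. kap m l * (kap m l * c) = c"
      using kap_sq[OF m, of l] lE l(3) by (simp_all add: mult.assoc[symmetric])
    have Thl: "Th m l v = (\<lambda>U. kap m l * Th m f v U)" for v
      using Y(4) by (simp add: Th_def f_def[symmetric])
    show ?thesis
    proof (cases "supp X = supp Y")
      \<comment> \<open>X is the three-point circuit through m and l. Its contraction is a relation
        on l and f alone, which becomes 0 once x_l is replaced by \<open>kap m l\<close>
        x_f.\<close>
      case True
      then have "kap m l = s * X l * X f"
        using kap_unique[OF m lE l(3)[symmetric] Y(4) X] Y(2) by simp
      moreover have "X f \<noteq> 0" using True Y(2) by (simp add: supp_nz[of X])
      ultimately have Xl: "X l = s * (kap m l * X f)"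
        using circ_sq'[OF X] circ_sq[OF X] by (simp add: algebra_simps)
      then have "dm (Th m) X [l, f] = (\<lambda>_. 0)"
        by (simp add: Xl Thl linop_zero[OF antiD(1)[OF anti_Th]] linop_scale[OF antiD(1)[OF anti_Th]]
            algebra_simps)
      then have "dm (Th m) X [l, f] \<in> ?J" by (simp add: subsp_zero[OF J])
      moreover have "set xs = set [l, f]" using True Y(2) less.prems(3) l fl by auto
      ultimately show ?thesis using perm[of "[l, f]" X] fl by simp
    next
      case False
      \<comment> \<open>Eliminating l against the line trades l for at most f and m, so the number
        of outside elements other than m drops.\<close>
      obtain Z where Z: "Z \<in> XX" "Z l = 0" "supp Z \<subseteq> (supp X \<union> supp Y) - {l}"
        "\<And>c. Z c = 0 \<or> Z c = X c \<or> Z c = s * X l * Y l * Y c"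
        using elim_supp[OF X Y(1) False, of l] l(1) Yl by auto
      define ks where "ks = sorted_list_of_set (supp Z - {m})"
      have ks: "distinct ks" "set ks = supp Z - {m}" using supp_fin[OF Z(1)] by (auto simp: ks_def)
      have ksub: "set ks \<subseteq> insert f (supp X - {m, l})" using ks(2) Z(3) Y(2) by auto
      have "supp Z - F - {m} \<subset> supp X - F - {m}" using Z(3) Y(2,4) l by auto
      then have "card (supp Z - F - {m}) < card (supp X - F - {m})"
        using supp_fin[OF X] by (intro psubset_card_mono) auto
      then have Zks: "dm (Th m) Z ks \<in> ?J" using less.hyps Z(1) ks by blast
      have ks_ne: "ks \<noteq> []"
      proof
        assume "ks = []"
        then have "supp Z \<subseteq> {m, m}" using ks(2) by auto
        then show False using not_small[OF Z(1)] by blast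
      qed
      then have hd: "hd ks \<in> supp Z" using ks(2) hd_in_set by blast
      have LE: "insert f (supp X - {m, l}) \<subseteq> E" using fE circ_E[OF X] by auto
      then have clos': "\<And>a v. a \<in> insert f (supp X - {m, l}) \<Longrightarrow> v \<in> ?J \<Longrightarrow> Th m a v \<in> ?J"
        using clos by blast
      define ws where "ws = sorted_list_of_set (supp X - {m, l, f})"
      have ws: "distinct (f # ws)" "set (f # ws) = insert f (supp X - {m, l})"
        using supp_fin[OF X] by (auto simp: ws_def)
      show ?thesis
      proof (cases "X f = 0")
        case False
        \<comment> \<open>Here X contains both l and the parallel element f. Boundary terms that
          keep both vanish, and the two others are multiples of the product over f and
          \<open>ws\<close>, which contains the product over \<open>ks\<close>.\<close>
        have "mon (Th m) (f # ws) \<in> ?J"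
          by (rule dm_subset_mem(2)[OF anti_Th J clos' ks(1) ks_ne Zks _ ws ksub]) (use hd in auto)
        then have "(\<lambda>U. (X l - s * kap m l * X f) * mon (Th m) (f # ws) U) \<in> ?J"
          by (rule subsp_scale[OF J])
        moreover have "dm (Th m) X (l # f # ws) = (\<lambda>U. (X l - s * kap m l * X f) * mon (Th m) (f # ws) U)"
          by (simp add: Thl linop_diff[OF antiD(1)[OF anti_Th]] linop_scale[OF antiD(1)[OF anti_Th]]
              antiD(2)[OF anti_Th] algebra_simps)
        ultimately have "dm (Th m) X (l # f # ws) \<in> ?J" by simp
        moreover have "distinct (l # f # ws)" "set xs = set (l # f # ws)"
          using ws l fl m Y(4) False less.prems(3) by auto
        ultimately show ?thesis using perm by blast
      next
        case True
        \<comment> \<open>X with l replaced by the parallel element f, weight included. On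
          \<open>ks\<close> it agrees with Z: at f the function X vanishes, so elimination forces
          the value s X_l Y_l Y_f, and at the other letters Y vanishes.\<close>
        define X' where "X' = X(f := kap m l * X l)"
        have "Z c = X' c" if "c \<in> set ks" for c
        proof -
          have "Z c \<noteq> 0" "c \<noteq> m" "c \<noteq> l" using that ks(2) Z(2) by auto
          then show ?thesis
            using Z(4)[of c] Y(2,3) True supp_iff[of c Y] by (cases "c = f") (auto simp: X'_def)
        qed
        then have "dm (Th m) X' ks \<in> ?J" "X' (hd ks) \<noteq> 0"
          using Zks dm_cong[of ks Z X' "Th m"] hd ks_ne by (auto simp: hd_in_set)
        then have "dm (Th m) X' (f # ws) \<in> ?J"
          by (intro dm_subset_mem(1)[OF anti_Th J clos' ks(1) ks_ne _ _ ws ksub])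
        then have "(\<lambda>U. kap m l * dm (Th m) X' (f # ws) U) \<in> ?J" by (rule subsp_scale[OF J])
        moreover have "dm (Th m) X' ws = dm (Th m) X ws"
          by (rule dm_cong) (use ws in \<open>auto simp: X'_def\<close>)
        then have "(\<lambda>U. kap m l * dm (Th m) X' (f # ws) U) = dm (Th m) X (l # ws)"
          by (simp add: kk Thl X'_def algebra_simps)
        ultimately have "dm (Th m) X (l # ws) \<in> ?J" by simp
        moreover have "distinct (l # ws)" "set xs = set (l # ws)"
          using ws l fl True less.prems(3) supp_fin[OF X] by (auto simp: ws_def)
        ultimately show ?thesis using perm by blast
      qed
    qed
  qed
qed

end

section \<open>Residues along the elements outside the hyperplane\<close>

context fibration
begin

definition phi :: "nat \<Rightarrow> (nat set \<Rightarrow> 'k) \<Rightarrow> nat set \<Rightarrow> 'k" where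
  "phi m = hom E (Th m)"

definition res :: "nat \<Rightarrow> (nat set \<Rightarrow> 'k) \<Rightarrow> nat set \<Rightarrow> 'k" where
  "res m v = phi m (ct m v)"

text \<open>The retraction of A onto B that sends x_a to 0 for a outside F.\<close>

definition rho :: "(nat set \<Rightarrow> 'k) \<Rightarrow> nat set \<Rightarrow> 'k" where
  "rho v = (\<lambda>U. if U \<subseteq> F then v U else 0)"

lemma linop_phi: "linop (phi m)"
  unfolding phi_def by (rule linop_hom)

lemma linop_res: "linop (res m)"
  unfolding res_def by (rule linop_comp[OF linop_phi linop_ct])

lemma linop_rho: "linop rho"
  unfolding linop_def rho_def by auto

lemma linop_Th: "linop (Th m a)"
  by (rule antiD(1)[OF anti_Th])

lemma phi_xm: "a \<in> E \<Longrightarrow> v \<in> extU E \<Longrightarrow> phi m (xm a v) = Th m a (phi m v)"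
  unfolding phi_def by (rule hom_xm[OF anti_Th finE])

lemma phi_mon: "set xs \<subseteq> E \<Longrightarrow> phi m (mon xm xs) = mon (Th m) xs"
  unfolding phi_def by (rule hom_mon[OF anti_Th finE])

lemma phi_dm: "set xs \<subseteq> E \<Longrightarrow> phi m (dm xm Y xs) = dm (Th m) Y xs"
  unfolding phi_def by (rule hom_dm[OF anti_Th finE])

text \<open>\<open>res m\<close> is a skew derivation over the projection \<open>phi m\<close>:
  moving x_a past the contraction costs the commutation sign, and \<open>phi m\<close> is
  multiplicative.\<close>

lemma res_xm:
  assumes "a \<in> E" "v \<in> extU E" "a \<noteq> m"
  shows "res m (xm a v) = (\<lambda>U. - s * Th m a (res m v) U)"
  using assms unfolding res_def
  by (simp add: ct_xm linop_scale[OF linop_phi] phi_xm ct_extU del: mult_minus_left)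

lemma Th_self: "m \<notin> F \<Longrightarrow> Th m m v = (\<lambda>_. 0)"
  by (simp add: Th_def)

lemma mon_Th_zero: "m \<notin> F \<Longrightarrow> m \<in> set xs \<Longrightarrow> mon (Th m) xs = (\<lambda>_. 0)"
  by (induction xs) (auto simp: Th_self linop_zero[OF linop_Th])

lemma extU_zero: "v \<in> extU A \<Longrightarrow> m \<notin> A \<Longrightarrow> m \<in> U \<Longrightarrow> v U = 0"
  using extU_D by blast

lemma ct_zero: "v \<in> extU A \<Longrightarrow> m \<notin> A \<Longrightarrow> ct m v = (\<lambda>_. 0)"
  by (auto simp: ct_def fun_eq_iff intro: extU_zero)

lemma res_zero: "v \<in> extU A \<Longrightarrow> m \<notin> A \<Longrightarrow> res m v = (\<lambda>_. 0)"
  unfolding res_def by (simp add: ct_zero linop_zero[OF linop_phi])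

lemma res_xm_self:
  assumes m: "m \<in> E - F" and "v \<in> extU E" shows "res m (xm m v) = phi m v"
proof -
  have "v \<in> {v. res m (xm m v) = phi m v}"
  proof (rule extU_mon_induct[OF finE assms(2)])
    show "subsp {v. res m (xm m v) = phi m v}"
      by (rule subsp_equalizer[OF linop_comp[OF linop_res[of m] linop_xm[of m]] linop_phi])
    fix xs assume xs: "set xs \<subseteq> E" "distinct xs"
    show "mon xm xs \<in> {v. res m (xm m v) = phi m v}"
    proof (cases "m \<in> set xs")
      \<comment> \<open>x_m occurs twice on the left, and \<open>phi m\<close> kills x_m on the
        right.\<close>
      case True
      then show ?thesis using xs m
        by (simp add: foldr_repeat[OF anti_xm] linop_zero[OF linop_res] phi_mon mon_Th_zero)
    next
      case False
      have "ct m (xm m (mon xm xs)) = mon xm xs"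
        by (intro ct_xm_same extU_zero[OF mon_extU[OF order_refl] False])
      then show ?thesis by (simp add: res_def)
    qed
  qed
  then show ?thesis by simp
qed

lemma sorted_supp:
  assumes "X \<in> XX"
  shows "set (sorted_list_of_set (supp X)) = supp X" "set (sorted_list_of_set (supp X)) \<subseteq> E"
    "set (sorted_list_of_set (supp X - A)) = supp X - A"
  using supp_fin[OF assms] circ_E[OF assms] by auto

lemma dm_sorted_supp:
  assumes "X \<in> XX" "anti \<Theta>" "subsp W" "dm \<Theta> Y xs \<in> W" "distinct xs" "set xs = supp X"
  shows "dm \<Theta> Y (sorted_list_of_set (supp X)) \<in> W"
  using dm_perm[OF assms(2,3,5), of "sorted_list_of_set (supp X)" Y] sorted_supp(1)[OF assms(1)] assms(4,6)
  by simp

text \<open>If m lies in the circuit, \<open>Th_self\<close> leaves only the boundary term that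
  omits m. This product is in the ideal because the boundary of the contracted circuit is.\<close>

lemma phi_rel:
  assumes m: "m \<in> E - F" and X: "X \<in> XX"
  shows "phi m (dm xm X (sorted_list_of_set (supp X))) \<in> uidl F RB"
proof (cases "m \<in> supp X")
  case False
  then have "set (sorted_list_of_set (supp X)) = supp X - {m}"
    unfolding sorted_supp(1)[OF X] by auto
  then show ?thesis
    by (simp add: phi_dm[OF sorted_supp(2)[OF X]] contraction_relation[OF m X])
next
  case True
  obtain ys where ys: "distinct ys" "set ys = supp X - {m}"
    using finite_distinct_list[OF finite_Diff[OF supp_fin[OF X]]] by metis
  have ne: "ys \<noteq> []"
  proof
    assume "ys = []"
    then have "supp X - {m} = {}" using ys(2) by (metis list.set(1))
    then have "supp X \<subseteq> {m, m}" by auto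
    then show False using not_small[OF X] by blast
  qed
  have "hd ys \<in> supp X - {m}" using hd_in_set[OF ne] unfolding ys(2) .
  then have hd: "X (hd ys) \<noteq> 0" by simp
  have "mon (Th m) ys \<in> uidl F RB"
    by (rule dm_subset_mem(2)[OF anti_Th subsp_uidl _ ys(1) ne contraction_relation[OF m X ys] hd ys eq_refl[OF ys(2)]])
       (use circ_E[OF X] Th_uidl[OF m] in blast)
  then have "dm (Th m) X (m # ys) \<in> uidl F RB"
    using m by (simp add: Th_self subsp_scale[OF subsp_uidl])
  moreover have "distinct (m # ys)" "set (m # ys) = supp X"
    using ys(1) True by (simp_all only: list.set ys(2) distinct.simps insert_Diff) simp_all
  ultimately have "dm (Th m) X (sorted_list_of_set (supp X)) \<in> uidl F RB"
    by (rule dm_sorted_supp[OF X anti_Th subsp_uidl])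
  then show ?thesis by (simp add: phi_dm[OF sorted_supp(2)[OF X]])
qed

text \<open>For a circuit through m the residue is, up to sign, the contracted relation: the
  boundary term without m has residue zero.\<close>

lemma res_rel:
  assumes m: "m \<in> E - F" and X: "X \<in> XX"
  shows "res m (dm xm X (sorted_list_of_set (supp X))) \<in> uidl F RB"
proof (cases "m \<in> supp X")
  case False
  then have "res m (dm xm X (sorted_list_of_set (supp X))) = (\<lambda>_. 0)"
    by (intro res_zero[OF dm_extU[OF order_refl]]) (simp only: sorted_supp(1)[OF X] not_False_eq_True)
  then show ?thesis by (simp add: subsp_zero[OF subsp_uidl])
next
  case True
  obtain ys where ys: "distinct ys" "set ys = supp X - {m}"
    using finite_distinct_list[OF finite_Diff[OF supp_fin[OF X]]] by metis
  then have ysE: "set ys \<subseteq> E" "m \<notin> set ys" using circ_E[OF X] by auto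
  have "res m (dm xm X (m # ys)) = (\<lambda>U. - s * dm (Th m) X ys U)"
    using res_zero[OF mon_extU[OF order_refl], of m ys] ysE m
    by (simp add: linop_diff[OF linop_res] linop_scale[OF linop_res] res_xm_self dm_extU phi_dm)
  then have "dm xm X (m # ys) \<in> {v. res m v \<in> uidl F RB}"
    using subsp_scale[OF subsp_uidl contraction_relation[OF m X ys], of "- s"] by simp
  moreover have "distinct (m # ys)" "set (m # ys) = supp X"
    using ys(1) True by (simp_all only: list.set ys(2) distinct.simps insert_Diff) simp_all
  ultimately have "dm xm X (sorted_list_of_set (supp X)) \<in> {v. res m v \<in> uidl F RB}"
    by (rule dm_sorted_supp[OF X anti_xm subsp_vimage[OF subsp_uidl linop_res]])
  then show ?thesis by simp
qed

text \<open>Both claims go through one induction, since \<open>res_xm_self\<close> turns the residue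
  of x_m v into \<open>phi m v\<close>.\<close>

lemma phi_res_idl:
  assumes m: "m \<in> E - F" and v: "v \<in> idl ext E RA d"
  shows "phi m v \<in> uidl F RB" "res m v \<in> uidl F RB"
proof -
  have "idl ext E RA d \<subseteq> {v. phi m v \<in> uidl F RB} \<inter> {v. res m v \<in> uidl F RB}"
  proof (rule idl_induct[OF finE rels_in_RA])
    show "subsp ({v. phi m v \<in> uidl F RB} \<inter> {v. res m v \<in> uidl F RB})"
      by (intro subsp_Int subsp_vimage subsp_uidl linop_phi linop_res)
    show "r \<in> {v. phi m v \<in> uidl F RB} \<inter> {v. res m v \<in> uidl F RB}" if "(k, r) \<in> RA" for k r
      using that phi_rel[OF m] res_rel[OF m] by (auto simp: RA_def rel_def)
    show "xm a v \<in> {v. phi m v \<in> uidl F RB} \<inter> {v. res m v \<in> uidl F RB}"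
      if "a \<in> E" "v \<in> {v. phi m v \<in> uidl F RB} \<inter> {v. res m v \<in> uidl F RB}" "v \<in> extU E" for a v
    proof (cases "a = m")
      case True
      then show ?thesis using that m by (simp add: phi_xm Th_uidl res_xm_self)
    next
      case False
      then show ?thesis using that m
        by (simp add: phi_xm Th_uidl res_xm subsp_scale[OF subsp_uidl] del: mult_minus_left)
    qed
  qed
  with v show "phi m v \<in> uidl F RB" "res m v \<in> uidl F RB" by auto
qed

lemma rho_xm: "rho (xm a v) = (if a \<in> F then xm a (rho v) else (\<lambda>_. 0))"
  by (auto simp: rho_def xm_def fun_eq_iff)

lemma rho_extU: "v \<in> extU F \<Longrightarrow> rho v = v"
  by (auto simp: rho_def fun_eq_iff extU_def)

lemma rho_extsp: "v \<in> extsp E d \<Longrightarrow> rho v \<in> extsp F d"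
  by (auto simp: rho_def extsp_def)

lemma RB_uidl:
  assumes "X \<in> XX" "supp X \<subseteq> F" shows "dm xm X (sorted_list_of_set (supp X)) \<in> uidl F RB"
proof -
  have "rel X \<in> RB" using assms by (auto simp: RB_def)
  then show ?thesis
    using idl_gen[OF finF rels_in_RB] subsetD[OF idl_uidl[OF finF rels_in_RB]] by (metis rel_def)
qed

text \<open>A circuit not inside F has at least two elements outside F, so every term of its
  boundary keeps one of them and dies under \<open>rho\<close>.\<close>

lemma rho_rel:
  assumes X: "X \<in> XX" shows "rho (dm xm X (sorted_list_of_set (supp X))) \<in> uidl F RB"
proof (cases "supp X \<subseteq> F")
  case True
  then have "dm xm X (sorted_list_of_set (supp X)) \<in> extU F"
    using sorted_supp(1)[OF X] by (intro dm_extU) auto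
  then show ?thesis using RB_uidl[OF X True] by (simp add: rho_extU)
next
  case False
  then obtain l where l: "l \<in> supp X - F" by blast
  then obtain l' where l': "l' \<in> supp X - F" "l' \<noteq> l" using hyperplane[OF X] by blast
  obtain ys where ys0: "distinct ys" "set ys = supp X - {l, l'}"
    using finite_distinct_list[OF finite_Diff[OF supp_fin[OF X]]] by metis
  have "insert l (insert l' (supp X - {l, l'})) = supp X" using l l'(1) by blast
  then have ys: "distinct (l # l' # ys)" "set (l # l' # ys) = supp X"
    using ys0(1) l'(2) by (simp_all only: list.set ys0(2)) (simp add: ys0(2))
  have "rho (dm xm X (l # l' # ys)) = (\<lambda>_. 0)"
    using l l' by (simp add: linop_diff[OF linop_rho] linop_scale[OF linop_rho] rho_xm)
  then have "dm xm X (l # l' # ys) \<in> {v. rho v \<in> uidl F RB}"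
    by (simp add: subsp_zero[OF subsp_uidl])
  then have "dm xm X (sorted_list_of_set (supp X)) \<in> {v. rho v \<in> uidl F RB}"
    using ys by (rule dm_sorted_supp[OF X anti_xm subsp_vimage[OF subsp_uidl linop_rho]])
  then show ?thesis by simp
qed

lemma rho_idl: "rho ` idl ext E RA d \<subseteq> idl ext F RB d"
proof -
  have "idl ext E RA d \<subseteq> {v. rho v \<in> uidl F RB}"
  proof (rule idl_induct[OF finE rels_in_RA subsp_vimage[OF subsp_uidl linop_rho]])
    show "r \<in> {v. rho v \<in> uidl F RB}" if "(k, r) \<in> RA" for k r
      using that rho_rel by (auto simp: RA_def rel_def)
    show "xm a v \<in> {v. rho v \<in> uidl F RB}" if "v \<in> {v. rho v \<in> uidl F RB}" for a v
      using that by (simp add: rho_xm xm_uidl[OF finF rels_in_RB] subsp_zero[OF subsp_uidl])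
  qed
  moreover have "idl ext E RA d \<subseteq> extsp E d" by (rule idl_extsp[OF finE rels_in_RA])
  ultimately show ?thesis using rho_extsp by (auto intro!: uidl_idl)
qed

lemma mon_Th_extsp:
  assumes "m \<in> E - F" shows "set xs \<subseteq> E \<Longrightarrow> mon (Th m) xs \<in> extsp F (length xs)"
proof (induction xs)
  case Nil
  then show ?case by (auto simp: extsp_def bv_def)
next
  case (Cons a xs)
  then show ?case
    using psi_F[of m a] assms kap_self[of m]
    by (cases "a = m") (auto simp: Th_def subsp_zero[OF subsp_extsp] intro!: subsp_scale[OF subsp_extsp] xm_extsp finF)
qed

lemma phi_extsp:
  assumes "m \<in> E - F" "v \<in> extsp E d" shows "phi m v \<in> extsp F d"
proof -
  have "v \<in> {v. phi m v \<in> extsp F d}"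
    by (rule extsp_mon_induct[OF finE assms(2) subsp_vimage[OF subsp_extsp linop_phi]])
       (use mon_Th_extsp[OF assms(1)] phi_mon in auto)
  then show ?thesis by simp
qed

lemma ct_extsp:
  assumes "v \<in> extsp E d" shows "ct m v \<in> extsp E (d - 1)"
proof -
  have "U \<subseteq> E \<and> card U = d - 1" if "ct m v U \<noteq> 0" for U
  proof -
    have "m \<notin> U" "insert m U \<subseteq> E" "card (insert m U) = d"
      using that assms by (auto simp: ct_def extsp_def split: if_splits)
    then show ?thesis using finite_subset[of U E] finE by auto
  qed
  then show ?thesis unfolding extsp_def by simp
qed

lemma res_extsp: "m \<in> E - F \<Longrightarrow> v \<in> extsp E d \<Longrightarrow> res m v \<in> extsp F (d - 1)"
  unfolding res_def by (intro phi_extsp ct_extsp)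

lemma res_degree_zero:
  assumes "v \<in> extsp E 0" shows "res m v = (\<lambda>_. 0)"
proof -
  have "ct m v U = 0" for U
  proof -
    have "insert m U \<subseteq> E \<Longrightarrow> card (insert m U) \<noteq> 0"
      using finite_subset[OF _ finE, of "insert m U"] by auto
    then show ?thesis using assms by (auto simp: ct_def extsp_def)
  qed
  then have "ct m v = (\<lambda>_. 0)" by blast
  then show ?thesis unfolding res_def by (simp add: linop_zero[OF linop_phi])
qed

lemma phi_F:
  assumes "v \<in> extU F" shows "phi m v = v"
proof -
  have "v \<in> {v. phi m v = v}"
  proof (rule extU_mon_induct[OF finF assms])
    show "subsp {v. phi m v = v}"
      by (rule subsp_equalizer[OF linop_phi]) (simp add: linop_def)
    fix xs assume xs: "set xs \<subseteq> F"
    then have "mon (Th m) xs = mon xm xs" by (induction xs) (auto simp: Th_mem)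
    then show "mon xm xs \<in> {v. phi m v = v}" using phi_mon[of xs m] xs FE by auto
  qed
  then show ?thesis by simp
qed

lemma res_F: "v \<in> extU F \<Longrightarrow> m \<notin> F \<Longrightarrow> res m v = (\<lambda>_. 0)"
  by (rule res_zero)

lemma extU_FE: "v \<in> extU F \<Longrightarrow> v \<in> extU E"
  using FE by (auto simp: extU_def)

lemma res_xm_F:
  assumes "m \<in> E - F" "l \<in> E - F" "v \<in> extU F"
  shows "res m (xm l v) = (if l = m then v else (\<lambda>_. 0))"
  using assms
  by (auto simp: res_xm_self res_xm extU_FE phi_F res_F linop_zero[OF linop_Th])

end

section \<open>The exact sequence of algebras\<close>

context fibration
begin

lemma xm_anticomm': "xm a (xm b v) = (\<lambda>U. - s * xm b (xm a v) U)"
proof (cases "a = b")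
  case False
  then show ?thesis by (rule xm_anticomm)
qed simp

lemma xm_comm2: "xm e (xm b (xm c v)) = xm b (xm c (xm e v))"
proof -
  have "xm e (xm b (xm c v)) = (\<lambda>U. - s * xm b (xm e (xm c v)) U)" by (rule xm_anticomm')
  also have "xm e (xm c v) = (\<lambda>U. - s * xm c (xm e v) U)" by (rule xm_anticomm')
  finally show ?thesis
    by (simp only: linop_scale[OF linop_xm, of b "- s"]) simp
qed

lemma RA_uidl:
  assumes X: "X \<in> XX" and xs: "distinct xs" "set xs = supp X" shows "dm xm X xs \<in> uidl E RA"
proof -
  have "rel X \<in> RA" using X by (auto simp: RA_def)
  then have "dm xm X (sorted_list_of_set (supp X)) \<in> uidl E RA"
    using idl_gen[OF finE rels_in_RA] subsetD[OF idl_uidl[OF finE rels_in_RA]] by (metis rel_def)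
  then show ?thesis
    using dm_perm[OF anti_xm subsp_uidl xs(1), of "sorted_list_of_set (supp X)"] sorted_supp(1)[OF X] xs(2)
    by simp
qed

text \<open>The ideal is built from left multiples, while here v stands on the right. The relation
  has degree 2, so each factor x_e of v can be carried across it by \<open>xm_comm2\<close>.\<close>

lemma triangle_uidl:
  assumes Y: "Y \<in> XX" "supp Y = {a, b, c}" and v: "v \<in> extU E"
  shows "(\<lambda>U. Y a * xm b (xm c v) U - s * Y b * xm a (xm c v) U + Y c * xm a (xm b v) U) \<in> uidl E RA"
    (is "?Q v \<in> _")
proof -
  have lin: "linop (\<lambda>v. ?Q v)"
    unfolding linop_def by (simp only: linopD[OF linop_xm]) (simp add: algebra_simps)
  have dist: "distinct [a, b, c]"
    using circ_card[OF Y(1)] unfolding Y(2) by (auto simp: card_insert_if split: if_splits)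
  have step: "xm e (?Q v) = ?Q (xm e v)" for e v
    unfolding xm_comm2[of e, symmetric]
    by (simp add: linop_add[OF linop_xm] linop_diff[OF linop_xm] linop_scale[OF linop_xm])
  have "v \<in> {v. ?Q v \<in> uidl E RA}"
  proof (rule extU_mon_induct[OF finE v subsp_vimage[OF subsp_uidl lin]])
    fix xs assume "set xs \<subseteq> E"
    then have "?Q (mon xm xs) \<in> uidl E RA"
    proof (induction xs)
      case Nil
      have "?Q (bv {}) = dm xm Y [a, b, c]"
        by (simp add: linop_diff[OF linop_xm] linop_scale[OF linop_xm] linop_zero[OF linop_xm] algebra_simps)
      then show ?case using RA_uidl[OF Y(1) dist] Y(2) by simp
    next
      case (Cons e xs)
      then have "xm e (?Q (mon xm xs)) \<in> uidl E RA" by (intro xm_uidl finE rels_in_RA) auto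
      then show ?case unfolding step by simp
    qed
    then show "mon xm xs \<in> {v. ?Q v \<in> uidl E RA}" by simp
  qed
  then show ?thesis by simp
qed

text \<open>The triangle relation of the line through m and l, scaled by Y_f, which is 1 or -1. It
  replaces a product of two outside factors by products of one outside factor and one factor in
  F.\<close>

lemma line_rewrite:
  assumes "m \<in> E - F" "l \<in> E - F" "m \<noteq> l" "v \<in> extU E"
  shows "(\<lambda>U. xm m (xm l v) U - (kap m l * xm m (xm (psi m l) v) U - s * kap l m * xm l (xm (psi m l) v) U))
    \<in> uidl E RA"
proof -
  obtain Y where Y: "Y \<in> XX" "supp Y = {m, l, psi m l}" "kap m l = s * Y l * Y (psi m l)"
    "kap l m = s * Y m * Y (psi m l)"
    using line_circuit[OF assms(1-3)] by metis
  let ?f = "psi m l"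
  have "Y ?f * Y ?f = 1" using circ_sq[OF Y(1)] supp_nz[OF Y(2)] by simp
  then have *: "Y ?f * (Y ?f * c) = c" for c by (simp add: mult.assoc[symmetric])
  have "(\<lambda>U. Y ?f * (Y m * xm l (xm ?f v) U - s * Y l * xm m (xm ?f v) U + Y ?f * xm m (xm l v) U)) \<in> uidl E RA"
    by (rule subsp_scale[OF subsp_uidl triangle_uidl[OF Y(1,2) assms(4)]])
  also have "(\<lambda>U. Y ?f * (Y m * xm l (xm ?f v) U - s * Y l * xm m (xm ?f v) U + Y ?f * xm m (xm l v) U))
    = (\<lambda>U. xm m (xm l v) U - (kap m l * xm m (xm ?f v) U - s * kap l m * xm l (xm ?f v) U))"
    unfolding Y(3,4) by (simp add: * algebra_simps)
  finally show ?thesis .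
qed

definition spanning :: "(nat set \<Rightarrow> 'k) set" where
  "spanning = extU F \<union> {xm m w | m w. m \<in> E - F \<and> w \<in> extU F} \<union> uidl E RA"

text \<open>The one case with content is x_a x_m w for distinct a and m outside F, where
  \<open>line_rewrite\<close> restores the required form.\<close>

lemma xm_lspan_spanning:
  assumes a: "a \<in> E" and v: "v \<in> lspan spanning" shows "xm a v \<in> lspan spanning"
proof -
  have "lspan spanning \<subseteq> {v. xm a v \<in> lspan spanning}"
  proof (rule lspan_minimal[OF subsp_vimage[OF subsp_lspan linop_xm]], rule subsetI)
    fix v assume "v \<in> spanning"
    then consider "v \<in> extU F" | m w where "v = xm m w" "m \<in> E - F" "w \<in> extU F" | "v \<in> uidl E RA"
      unfolding spanning_def by blast
    then have "xm a v \<in> lspan spanning"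
    proof cases
      case 1
      then have "xm a v \<in> spanning" unfolding spanning_def using xm_extU[of a F v] a by blast
      then show ?thesis by (rule lspan_base)
    next
      case 2
      show ?thesis
      proof (cases "a \<in> F")
        case True
        then have "xm m (xm a w) \<in> spanning" unfolding spanning_def using 2 xm_extU by blast
        then show ?thesis unfolding 2(1) xm_anticomm'[of a m]
          by (intro subsp_scale[OF subsp_lspan] lspan_base)
      next
        case False
        show ?thesis
        proof (cases "a = m")
          case True
          then show ?thesis using 2 by (simp add: subsp_zero[OF subsp_lspan])
        next
          case ne: False
          let ?f = "psi a m"
          have aF: "a \<in> E - F" using a False by simp
          have fF: "?f \<in> F" using psi_F[OF aF, of m] ne 2 by simp
          have "xm a (xm ?f w) \<in> spanning" "xm m (xm ?f w) \<in> spanning"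
            unfolding spanning_def using aF 2 xm_extU[OF fF 2(3)] by blast+
          then have "(\<lambda>U. kap a m * xm a (xm ?f w) U - s * kap m a * xm m (xm ?f w) U) \<in> lspan spanning"
            by (intro subsp_diff[OF subsp_lspan] subsp_scale[OF subsp_lspan] lspan_base)
          moreover have "(\<lambda>U. xm a (xm m w) U - (kap a m * xm a (xm ?f w) U - s * kap m a * xm m (xm ?f w) U))
              \<in> lspan spanning"
            by (rule lspan_base) (use line_rewrite[OF aF 2(2) ne extU_FE[OF 2(3)]] in \<open>simp add: spanning_def\<close>)
          ultimately have "(\<lambda>U. (kap a m * xm a (xm ?f w) U - s * kap m a * xm m (xm ?f w) U)
            + (xm a (xm m w) U - (kap a m * xm a (xm ?f w) U - s * kap m a * xm m (xm ?f w) U))) \<in> lspan spanning"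
            by (rule subsp_add[OF subsp_lspan])
          then show ?thesis using 2(1) by simp
        qed
      qed
    next
      case 3
      then show ?thesis unfolding spanning_def by (intro lspan_base UnI2 xm_uidl finE rels_in_RA a)
    qed
    then show "v \<in> {v. xm a v \<in> lspan spanning}" by simp
  qed
  with v show ?thesis by blast
qed

lemma extU_decompose:
  assumes "v \<in> extU E"
  obtains u w where "u \<in> extU F" "\<forall>m. w m \<in> extU F"
    "(\<lambda>U. v U - (u U + (\<Sum>m\<in>E-F. xm m (w m) U))) \<in> uidl E RA"
proof -
  define P where "P = (\<lambda>v u w. u \<in> extU F \<and> (\<forall>m. w m \<in> extU F) \<and>
    (\<lambda>U. v U - (u U + (\<Sum>m\<in>E-F. xm m (w m) U))) \<in> uidl E RA)"
  have zero: "(\<lambda>_. 0) \<in> extU F" by (rule subsp_zero[OF subsp_extU])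
  have sub: "subsp {v. \<exists>u w. P v u w}"
    unfolding subsp_def
  proof (intro conjI allI ballI)
    have "P (\<lambda>_. 0) (\<lambda>_. 0) (\<lambda>_ _. 0)"
      by (simp add: P_def zero linop_zero[OF linop_xm] subsp_zero[OF subsp_uidl])
    then show "(\<lambda>_. 0) \<in> {v. \<exists>u w. P v u w}" by blast
    fix c v1 v2 assume "v1 \<in> {v. \<exists>u w. P v u w}" "v2 \<in> {v. \<exists>u w. P v u w}"
    then obtain u1 w1 u2 w2 where P: "P v1 u1 w1" "P v2 u2 w2" by blast
    have "(\<lambda>U. c * (v1 U - (u1 U + (\<Sum>m\<in>E-F. xm m (w1 m) U)))
        + (v2 U - (u2 U + (\<Sum>m\<in>E-F. xm m (w2 m) U)))) \<in> uidl E RA"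
      using P unfolding P_def by (intro subspD[OF subsp_uidl]) blast+
    also have "(\<lambda>U. c * (v1 U - (u1 U + (\<Sum>m\<in>E-F. xm m (w1 m) U)))
        + (v2 U - (u2 U + (\<Sum>m\<in>E-F. xm m (w2 m) U))))
      = (\<lambda>U. (c * v1 U + v2 U) - ((c * u1 U + u2 U) + (\<Sum>m\<in>E-F. xm m (\<lambda>U. c * w1 m U + w2 m U) U)))"
      by (simp only: linopD[OF linop_xm] sum.distrib sum_distrib_left[symmetric]) (simp add: algebra_simps)
    finally have "P (\<lambda>U. c * v1 U + v2 U) (\<lambda>U. c * u1 U + u2 U) (\<lambda>m U. c * w1 m U + w2 m U)"
      using P unfolding P_def by (auto intro!: subspD[OF subsp_extU])
    then show "(\<lambda>U. c * v1 U + v2 U) \<in> {v. \<exists>u w. P v u w}" by blast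
  qed
  have "spanning \<subseteq> {v. \<exists>u w. P v u w}"
  proof
    fix v assume "v \<in> spanning"
    then consider "v \<in> extU F" | m w where "v = xm m w" "m \<in> E - F" "w \<in> extU F" | "v \<in> uidl E RA"
      unfolding spanning_def by blast
    then have "\<exists>u w. P v u w"
    proof cases
      case 1
      then have "P v v (\<lambda>_ _. 0)"
        by (simp add: P_def zero linop_zero[OF linop_xm] subsp_zero[OF subsp_uidl])
      then show ?thesis by blast
    next
      case 2
      have "(\<Sum>l\<in>E-F. xm l (if l = m then w else (\<lambda>_. 0)) U) = v U" for U
      proof -
        have "(\<Sum>l\<in>E-F. xm l (if l = m then w else (\<lambda>_. 0)) U) = (\<Sum>l\<in>E-F. if l = m then v U else 0)"
          by (rule sum.cong) (auto simp: 2(1) linop_zero[OF linop_xm])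
        then show ?thesis using 2(2) finE by simp
      qed
      then have "P v (\<lambda>_. 0) (\<lambda>l. if l = m then w else (\<lambda>_. 0))"
        using 2(3) by (simp add: P_def zero subsp_zero[OF subsp_uidl])
      then show ?thesis by blast
    next
      case 3
      then have "P v (\<lambda>_. 0) (\<lambda>_ _. 0)"
        by (simp add: P_def zero linop_zero[OF linop_xm])
      then show ?thesis by blast
    qed
    then show "v \<in> {v. \<exists>u w. P v u w}" by simp
  qed
  then have *: "lspan spanning \<subseteq> {v. \<exists>u w. P v u w}" by (rule lspan_minimal[OF sub])
  have "v \<in> lspan spanning"
  proof (rule extU_mon_induct[OF finE assms subsp_lspan])
    fix xs assume "set xs \<subseteq> E"
    then show "mon xm xs \<in> lspan spanning"
    proof (induction xs)
      case Nil
      then show ?case by (auto intro!: lspan_base simp: spanning_def bv_extU)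
    qed (simp add: xm_lspan_spanning)
  qed
  with * have "\<exists>u w. P v u w" by auto
  with that show thesis unfolding P_def by blast
qed

lemma uidl_FE: "uidl F RB \<subseteq> uidl E RA"
proof
  fix v assume v: "v \<in> uidl F RB"
  have *: "idl ext F RB d \<subseteq> uidl E RA" for d
  proof (rule idl_induct[OF finF rels_in_RB subsp_uidl])
    fix k r assume "(k, r) \<in> RB"
    then have "(k, r) \<in> RA" by (auto simp: RB_def RA_def)
    then show "r \<in> uidl E RA" using idl_gen[OF finE rels_in_RA] idl_uidl[OF finE rels_in_RA] by blast
  next
    show "xm a v \<in> uidl E RA" if "a \<in> F" "v \<in> uidl E RA" for a v
      using that FE by (intro xm_uidl finE rels_in_RA) auto
  qed
  have fd: "(\<lambda>U. if card U = d then v U else 0) \<in> idl ext E RA d" for d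
  proof (rule uidl_idl)
    show "(\<lambda>U. if card U = d then v U else 0) \<in> uidl E RA"
      by (rule subsetD[OF *[of d]]) (use v in \<open>simp add: uidl_def\<close>)
    have "v \<in> extU E" by (rule extU_FE[OF subsetD[OF uidl_extU[OF finF rels_in_RB] v]])
    then show "(\<lambda>U. if card U = d then v U else 0) \<in> extsp E d" by (auto simp: extU_def extsp_def)
  qed
  then show "v \<in> uidl E RA" by (simp add: uidl_def)
qed

lemma idl_FE: "idl ext F RB d \<subseteq> idl ext E RA d"
proof
  fix v :: "nat set \<Rightarrow> 'k" assume v: "v \<in> idl ext F RB d"
  have "v \<in> uidl E RA" by (rule subsetD[OF uidl_FE subsetD[OF idl_uidl[OF finF rels_in_RB] v]])
  moreover have "extsp F d \<subseteq> (extsp E d :: (nat set \<Rightarrow> 'k) set)"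
    using FE unfolding extsp_def by blast
  then have "v \<in> extsp E d" by (rule subsetD) (rule subsetD[OF idl_extsp[OF finF rels_in_RB] v])
  ultimately show "v \<in> idl ext E RA d" by (rule uidl_idl)
qed

definition resmap :: "(nat set \<Rightarrow> 'k) \<Rightarrow> nat \<times> nat set \<Rightarrow> 'k" where
  "resmap v = (\<lambda>(j, S). if j \<in> E - F then res j v S else 0)"

lemma resmap_tsp_iff:
  assumes v: "v \<in> extsp E d"
  shows "resmap v \<in> tsp (E - F) (idl ext F RB) d \<longleftrightarrow> (\<forall>j\<in>E-F. res j v \<in> uidl F RB)"
proof (cases d)
  case 0
  then have "resmap v = (\<lambda>_. 0)" using res_degree_zero v by (auto simp: resmap_def)
  then show ?thesis using 0 res_degree_zero v by (simp add: tsp_def subsp_zero[OF subsp_uidl])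
next
  case (Suc d')
  have "res j v \<in> uidl F RB \<longleftrightarrow> res j v \<in> idl ext F RB d'" if "j \<in> E - F" for j
    using uidl_idl[of "res j v" F RB d'] res_extsp[OF that v] idl_uidl[OF finF rels_in_RB, of d'] Suc by auto
  then show ?thesis using Suc by (auto simp: tsp_def resmap_def)
qed

lemma linop_resmap: "linop resmap"
  unfolding linop_def resmap_def by (auto simp: linopD[OF linop_res])

lemma res_combo:
  assumes j: "j \<in> E - F" and u: "u \<in> extU F" and w: "\<And>m. m \<in> E - F \<Longrightarrow> w m \<in> extU F"
  shows "res j (\<lambda>U. u U + (\<Sum>m\<in>E-F. xm m (w m) U)) = w j"
proof
  fix S
  have "res j (\<lambda>U. \<Sum>m\<in>E-F. 1 * xm m (w m) U) S = (\<Sum>m\<in>E-F. 1 * res j (xm m (w m)) S)"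
    unfolding linop_sum[OF linop_res] ..
  also have "\<dots> = (\<Sum>m\<in>E-F. if m = j then w j S else 0)"
    by (rule sum.cong) (use res_xm_F[OF j] w in auto)
  also have "\<dots> = w j S" using j finE by simp
  finally show "res j (\<lambda>U. u U + (\<Sum>m\<in>E-F. xm m (w m) U)) S = w j S"
    using res_F[OF u, of j] j by (simp add: linop_add[OF linop_res])
qed

lemma ses_algebra:
  "ses (extsp F d) (idl ext F RB d) (extsp E d) (idl ext E RA d)
     (tsp (E - F) (extsp F) d) (tsp (E - F) (idl ext F RB) d) (\<lambda>v. v) resmap"
  unfolding ses_def
proof (intro conjI ballI impI)
  have FEsp: "extsp F d \<subseteq> extsp E d" using FE by (auto simp: extsp_def)
  show "lin_map (extsp F d) (extsp E d) (\<lambda>v. v)"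
    using FEsp by (auto simp: lin_map_def)
  show "lin_map (extsp E d) (tsp (E - F) (extsp F) d) resmap"
    unfolding lin_map_def
  proof (intro conjI ballI allI)
    fix u :: "nat set \<Rightarrow> 'k" assume u: "u \<in> extsp E d"
    show "resmap u \<in> tsp (E - F) (extsp F) d"
    proof (cases d)
      case 0
      then show ?thesis using res_degree_zero u by (auto simp: resmap_def tsp_def)
    next
      case (Suc d')
      then show ?thesis using res_extsp[OF _ u] by (auto simp: resmap_def tsp_def)
    qed
  qed (rule linopD[OF linop_resmap])
  show "(\<lambda>v. v) ` idl ext F RB d \<subseteq> idl ext E RA d"
    using idl_FE by auto
  show "resmap ` idl ext E RA d \<subseteq> tsp (E - F) (idl ext F RB) d"
  proof clarify
    fix v :: "nat set \<Rightarrow> 'k" assume v: "v \<in> idl ext E RA d"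
    have "v \<in> extsp E d" by (rule subsetD[OF idl_extsp[OF finE rels_in_RA] v])
    then show "resmap v \<in> tsp (E - F) (idl ext F RB) d"
      by (simp add: resmap_tsp_iff phi_res_idl(2)[OF _ v])
  qed
  show "v \<in> idl ext F RB d" if "v \<in> extsp F d" "v \<in> idl ext E RA d" for v :: "nat set \<Rightarrow> 'k"
  proof -
    \<comment> \<open>Injectivity: \<open>rho\<close> fixes v and maps the ideal of A into the ideal
      of B.\<close>
    have "rho v = v" by (rule rho_extU[OF subsetD[OF extsp_extU that(1)]])
    then show ?thesis using subsetD[OF rho_idl imageI[OF that(2)]] by simp
  qed
  show "resmap v \<in> tsp (E - F) (idl ext F RB) d \<longleftrightarrow> (\<exists>u\<in>extsp F d. (\<lambda>x. v x - u x) \<in> idl ext E RA d)"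
    if v: "v \<in> extsp E d" for v
  proof
    assume "resmap v \<in> tsp (E - F) (idl ext F RB) d"
    then have D: "\<And>j. j \<in> E - F \<Longrightarrow> res j v \<in> uidl F RB" using resmap_tsp_iff[OF v] by blast
    obtain u w where uw: "u \<in> extU F" "\<forall>m. w m \<in> extU F"
      "(\<lambda>U. v U - (u U + (\<Sum>m\<in>E-F. xm m (w m) U))) \<in> uidl E RA"
      by (rule extU_decompose[OF subsetD[OF extsp_extU v]])
    \<comment> \<open>\<open>phi_res_idl\<close> is stated degree by degree, so an element of
      \<open>uidl\<close> is cut into its finitely many homogeneous parts.\<close>
    have resu: "res j z \<in> uidl F RB" if "z \<in> uidl E RA" "j \<in> E - F" for z j
    proof -
      have "z = (\<lambda>U. \<Sum>e\<in>{..card E}. 1 * (if card U = e then z U else 0))"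
      proof
        fix U
        have "z U \<noteq> 0 \<Longrightarrow> card U \<le> card E"
          using extU_D[OF subsetD[OF uidl_extU[OF finE rels_in_RA] that(1)]] card_mono[OF finE] by blast
        then show "z U = (\<Sum>e\<in>{..card E}. 1 * (if card U = e then z U else 0))" by auto
      qed
      then have "res j z = res j (\<lambda>U. \<Sum>e\<in>{..card E}. 1 * (if card U = e then z U else 0))"
        by (rule arg_cong)
      also have "\<dots> = (\<lambda>S. \<Sum>e\<in>{..card E}. 1 * res j (\<lambda>U. if card U = e then z U else 0) S)"
        by (rule linop_sum[OF linop_res])
      finally have "res j z = (\<lambda>S. \<Sum>e\<in>{..card E}. 1 * res j (\<lambda>U. if card U = e then z U else 0) S)" .
      moreover have "res j (\<lambda>U. if card U = e then z U else 0) \<in> uidl F RB" for e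
        by (rule phi_res_idl(2)[OF that(2), of _ e]) (use that(1) in \<open>simp add: uidl_def\<close>)
      ultimately show ?thesis by (simp add: subsp_sum[OF subsp_uidl])
    qed
    \<comment> \<open>The residues read off the coefficients \<open>w j\<close> of the spanning
      expression. These therefore lie in the ideal of B, and v is congruent to u.\<close>
    have "w j \<in> uidl F RB" if j: "j \<in> E - F" for j
    proof -
      have "(\<lambda>S. res j v S - w j S) \<in> uidl F RB"
        using resu[OF uw(3) j] res_combo[OF j uw(1) uw(2)[rule_format]] by (simp add: linop_diff[OF linop_res])
      from subsp_diff[OF subsp_uidl D[OF j] this] show ?thesis by simp
    qed
    then have "xm m (w m) \<in> uidl E RA" if "m \<in> E - F" for m
      using that subsetD[OF uidl_FE] by (intro xm_uidl finE rels_in_RA) auto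
    then have "(\<lambda>U. \<Sum>m\<in>E-F. xm m (w m) U) \<in> uidl E RA" by (rule subsp_sum[OF subsp_uidl])
    from subsp_add[OF subsp_uidl uw(3) this] have vu: "(\<lambda>U. v U - u U) \<in> uidl E RA" by simp
    \<comment> \<open>v is homogeneous and the ideal is graded, so only the part of u of degree d
      matters.\<close>
    define u' where "u' = (\<lambda>U. if card U = d then u U else 0)"
    have "(\<lambda>U. if card U = d then v U - u U else 0) = (\<lambda>U. v U - u' U)"
      using v by (auto simp: u'_def extsp_def fun_eq_iff)
    moreover have "(\<lambda>U. if card U = d then v U - u U else 0) \<in> idl ext E RA d"
      using vu unfolding uidl_def by simp
    ultimately have "(\<lambda>U. v U - u' U) \<in> idl ext E RA d" by simp
    moreover have "u' \<in> extsp F d" using uw(1) by (auto simp: u'_def extU_def extsp_def)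
    ultimately show "\<exists>u\<in>extsp F d. (\<lambda>x. v x - u x) \<in> idl ext E RA d" by blast
  next
    assume "\<exists>u\<in>extsp F d. (\<lambda>x. v x - u x) \<in> idl ext E RA d"
    then obtain u where u: "u \<in> extsp F d" "(\<lambda>x. v x - u x) \<in> idl ext E RA d" by blast
    have "res j v \<in> uidl F RB" if j: "j \<in> E - F" for j
    proof -
      have "res j (\<lambda>x. v x - u x) \<in> uidl F RB" by (rule phi_res_idl(2)[OF j u(2)])
      then show ?thesis using res_F[OF subsetD[OF extsp_extU u(1)], of j] j
        by (simp add: linop_diff[OF linop_res])
    qed
    then show "resmap v \<in> tsp (E - F) (idl ext F RB) d" using resmap_tsp_iff[OF v] by blast
  qed
  show "\<exists>v\<in>extsp E d. (\<lambda>x. resmap v x - w x) \<in> tsp (E - F) (idl ext F RB) d"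
    if w: "w \<in> tsp (E - F) (extsp F) d" for w
  proof (cases d)
    case 0
    then have "w = (\<lambda>_. 0)" using w by (simp add: tsp_def)
    then have "(\<lambda>x. resmap (\<lambda>_. 0) x - w x) \<in> tsp (E - F) (idl ext F RB) d"
      using 0 by (simp add: linop_zero[OF linop_resmap] tsp_def)
    then show ?thesis using subsp_zero[OF subsp_extsp] by blast
  next
    case (Suc d')
    define v where "v = (\<lambda>U. \<Sum>m\<in>E-F. xm m (\<lambda>S. w (m, S)) U)"
    have wF: "(\<lambda>S. w (m, S)) \<in> extsp F d'" if "m \<in> E - F" for m
      using w Suc that by (simp add: tsp_def)
    have "xm m (\<lambda>S. w (m, S)) \<in> extsp E d" if "m \<in> E - F" for m
      unfolding Suc using wF[OF that] that FE by (intro xm_extsp finE) (auto simp: extsp_def)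
    then have "v \<in> extsp E d" unfolding v_def by (rule subsp_sum[OF subsp_extsp])
    moreover have "res j v = (\<lambda>S. w (j, S))" if "j \<in> E - F" for j
      using res_combo[OF that subsp_zero[OF subsp_extU], of "\<lambda>m S. w (m, S)"]
        subsetD[OF extsp_extU wF] by (simp add: v_def)
    then have "resmap v = w" using w Suc by (auto simp: resmap_def tsp_def fun_eq_iff)
    then have "(\<lambda>x. resmap v x - w x) \<in> tsp (E - F) (idl ext F RB) d"
      using Suc by (simp add: tsp_def subsp_zero[OF subsp_idl])
    ultimately show ?thesis by blast
  qed
qed

end

section \<open>Automorphisms acting on the algebras\<close>

context sign_alg
begin

lemma linop_act_ext: "linop (act_ext ext E g :: (nat set \<Rightarrow> 'k) \<Rightarrow> _)"
  unfolding linop_def act_ext_def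
  by (auto simp: sum_distrib_left sum.distrib[symmetric] algebra_simps fun_eq_iff intro!: sum.cong)

definition sgn_act :: "sperm \<Rightarrow> nat set \<Rightarrow> 'k" where
  "sgn_act g S = (\<Prod>x\<in>S. sg (snd g x)) *
     (if ext then (-1) ^ card {(a,b). a \<in> S \<and> b \<in> S \<and> a < b \<and> fst g b < fst g a} else 1)"

lemma act_ext_bv:
  assumes "finite E" "S \<subseteq> E"
  shows "act_ext ext E g (bv S) = (\<lambda>U. sgn_act g S * bv (fst g ` S) U)"
proof
  fix U
  have "act_ext ext E g (bv S) U = (\<Sum>T\<in>Pow E. if T = S then if fst g ` S = U then sgn_act g S else 0 else 0)"
    unfolding act_ext_def sgn_act_def by (rule sum.cong) (auto simp: bv_def)
  then show "act_ext ext E g (bv S) U = sgn_act g S * bv (fst g ` S) U"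
    using assms by (simp add: bv_def)
qed

text \<open>Let I count the inversions in S, let A and B count the two kinds of inversions that
  involve a, and let C count the smaller elements whose images stay smaller. The four summands are I
  + A + B, I, A + C and B + C, and their sum is twice I + A + B + C.\<close>

lemma inversions_insert:
  fixes \<pi> :: "nat \<Rightarrow> nat"
  assumes "finite S" "a \<notin> S" "inj_on \<pi> (insert a S)"
  shows "even (card {(x,y). x \<in> insert a S \<and> y \<in> insert a S \<and> x < y \<and> \<pi> y < \<pi> x}
    + card {(x,y). x \<in> S \<and> y \<in> S \<and> x < y \<and> \<pi> y < \<pi> x}
    + card {x \<in> S. x < a} + card {y \<in> \<pi> ` S. y < \<pi> a})"
proof -
  let ?I = "{(x,y). x \<in> S \<and> y \<in> S \<and> x < y \<and> \<pi> y < \<pi> x}"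
  let ?A = "{x \<in> S. x < a \<and> \<pi> a < \<pi> x}" and ?B = "{x \<in> S. a < x \<and> \<pi> x < \<pi> a}"
    and ?C = "{x \<in> S. x < a \<and> \<pi> x < \<pi> a}"
  have ne: "\<pi> x \<noteq> \<pi> a" "x \<noteq> a" if "x \<in> S" for x
    using assms(2,3) that unfolding inj_on_def by auto
  have fI: "finite ?I" by (rule finite_subset[of _ "S \<times> S"]) (use assms(1) in auto)
  have "{(x,y). x \<in> insert a S \<and> y \<in> insert a S \<and> x < y \<and> \<pi> y < \<pi> x}
      = ?I \<union> ((\<lambda>x. (x, a)) ` ?A \<union> Pair a ` ?B)" using assms(2) by auto
  moreover have "card (?I \<union> ((\<lambda>x. (x, a)) ` ?A \<union> Pair a ` ?B)) = card ?I + (card ?A + card ?B)"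
  proof -
    have "card ((\<lambda>x. (x, a)) ` ?A \<union> Pair a ` ?B) = card ?A + card ?B"
      using assms(1) by (subst card_Un_disjoint) (auto simp: card_image inj_on_def)
    moreover have "?I \<inter> ((\<lambda>x. (x, a)) ` ?A \<union> Pair a ` ?B) = {}" using assms(2) by auto
    ultimately show ?thesis using fI assms(1) by (subst card_Un_disjoint) auto
  qed
  moreover have "card {x \<in> S. x < a} = card ?A + card ?C"
  proof -
    have "{x \<in> S. x < a} = ?A \<union> ?C" using ne by (auto simp: neq_iff)
    then have "card {x \<in> S. x < a} = card (?A \<union> ?C)" by (rule arg_cong)
    also have "\<dots> = card ?A + card ?C"
      using assms(1) by (intro card_Un_disjoint) auto
    finally show ?thesis .
  qed
  moreover have "card {y \<in> \<pi> ` S. y < \<pi> a} = card ?B + card ?C"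
  proof -
    have "{y \<in> \<pi> ` S. y < \<pi> a} = \<pi> ` (?B \<union> ?C)" using ne by (auto simp: neq_iff)
    then have "card {y \<in> \<pi> ` S. y < \<pi> a} = card (\<pi> ` (?B \<union> ?C))" by (rule arg_cong)
    also have "inj_on \<pi> (?B \<union> ?C)" by (rule inj_on_subset[OF assms(3)]) auto
    then have "card (\<pi> ` (?B \<union> ?C)) = card (?B \<union> ?C)" by (rule card_image)
    also have "\<dots> = card ?B + card ?C"
      using assms(1) by (intro card_Un_disjoint) auto
    finally show ?thesis .
  qed
  ultimately have "card {(x,y). x \<in> insert a S \<and> y \<in> insert a S \<and> x < y \<and> \<pi> y < \<pi> x}
    + card ?I + card {x \<in> S. x < a} + card {y \<in> \<pi> ` S. y < \<pi> a}
    = 2 * (card ?I + card ?A + card ?B + card ?C)" by simp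
  then show ?thesis by (simp only: dvd_triv_left)
qed

lemma sgn_act_insert:
  assumes "finite S" "a \<notin> S" "inj_on (fst g) (insert a S)"
  shows "sn a S * sgn_act g (insert a S) = sg (snd g a) * sn (fst g a) (fst g ` S) * sgn_act g S"
proof -
  have "(-1 :: 'k) ^ (i + j + k + l) = 1 \<Longrightarrow> (-1 :: 'k) ^ k * (-1) ^ i = (-1) ^ l * (-1) ^ j" for i j k l :: nat
    by (cases "even i"; cases "even j"; cases "even k"; cases "even l") auto
  from this[OF neg_one_even_power[OF inversions_insert[OF assms]]]
  show ?thesis using assms(1,2) by (simp add: sgn_act_def sn_def algebra_simps)
qed

text \<open>Multiplicativity of the action, one generator at a time; in the exterior case the signs
  agree by the parity count of inversions.\<close>

lemma act_ext_xm:
  assumes fE: "finite E" and g: "bij_betw (fst g) E E" and a: "a \<in> E" and v: "v \<in> extU E"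
  shows "act_ext ext E g (xm a v) = (\<lambda>U. sg (snd g a) * xm (fst g a) (act_ext ext E g v) U)"
proof -
  let ?R = "\<lambda>v U. sg (snd g a) * xm (fst g a) (act_ext ext E g v) U"
  have "v \<in> {v. act_ext ext E g (xm a v) = ?R v}"
  proof (rule lspan_bv[where A = "Pow E"])
    show "subsp {v. act_ext ext E g (xm a v) = ?R v}"
      by (rule subsp_equalizer[OF linop_comp[OF linop_act_ext[of E g] linop_xm[of a]]
            linop_smult[OF linop_comp[OF linop_xm[of "fst g a"] linop_act_ext[of E g]]]])
    fix S assume "S \<in> Pow E"
    then have S: "S \<subseteq> E" "finite S" using fE finite_subset by auto
    have inj: "inj_on (fst g) (insert a S)"
      by (rule inj_on_subset[OF bij_betw_imp_inj_on[OF g]]) (use a S in auto)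
    show "bv S \<in> {v. act_ext ext E g (xm a v) = ?R v}"
    proof (cases "a \<in> S")
      case True
      then show ?thesis using S fE
        by (simp add: xm_bv_mem linop_zero[OF linop_act_ext] act_ext_bv linop_scale[OF linop_xm])
    next
      case False
      then have "fst g a \<notin> fst g ` S" using inj by (auto simp: inj_on_def)
      then show ?thesis using S fE a False sgn_act_insert[OF S(2) False inj]
        by (simp add: xm_bv linop_scale[OF linop_act_ext] act_ext_bv linop_scale[OF linop_xm]
            mult.assoc[symmetric]) (simp add: mult_ac)
    qed
  qed (use fE v in \<open>auto simp: extU_def\<close>)
  then show ?thesis by simp
qed

lemma act_ext_extU:
  assumes "bij_betw (fst g) E E" shows "act_ext ext E g (v :: nat set \<Rightarrow> 'k) \<in> extU E"
proof -
  have "S \<subseteq> E" if "act_ext ext E g v S \<noteq> 0" for S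
  proof -
    have "\<exists>T\<in>Pow E. fst g ` T = S"
    proof (rule ccontr)
      assume "\<not> (\<exists>T\<in>Pow E. fst g ` T = S)"
      then have "act_ext ext E g v S = 0" unfolding act_ext_def by (intro sum.neutral) auto
      with that show False by simp
    qed
    then obtain T where "T \<in> Pow E" "fst g ` T = S" by blast
    then show ?thesis using bij_betw_imp_surj_on[OF assms] by blast
  qed
  then show ?thesis unfolding extU_def by blast
qed

lemma act_ext_subset:
  assumes "finite E" "F \<subseteq> E" "v \<in> extU F"
  shows "act_ext ext F g v = (act_ext ext E g v :: nat set \<Rightarrow> 'k)"
  unfolding act_ext_def
  by (intro HOL.ext sum.mono_neutral_left) (use assms in \<open>auto simp: extU_def\<close>)

end

section \<open>Equivariance of inclusion and residues\<close>

context fibration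
begin

text \<open>The common form of both kinds of automorphisms that stabilise F: circuits go to
  circuits, with values twisted by the signs of g. For an unsigned permutation all signs are
  1.\<close>

definition aut :: "sperm \<Rightarrow> bool" where
  "aut g \<longleftrightarrow> bij_betw (fst g) E E \<and> fst g ` F = F \<and>
     (\<forall>X\<in>XX. \<exists>X'\<in>XX. \<forall>e\<in>E. X' (fst g e) = sg (snd g e) * X e)"

lemma autD:
  assumes "aut g"
  shows "bij_betw (fst g) E E" "fst g ` F = F" "a \<in> F \<Longrightarrow> fst g a \<in> F" "a \<in> E \<Longrightarrow> fst g a \<in> E"
    "m \<in> E - F \<Longrightarrow> fst g m \<in> E - F"
proof -
  show *: "bij_betw (fst g) E E" "fst g ` F = F" using assms by (auto simp: aut_def)
  show "fst g a \<in> F" if "a \<in> F" for a using *(2) that by blast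
  show E: "fst g a \<in> E" if "a \<in> E" for a using bij_betwE[OF *(1)] that by blast
  show "fst g m \<in> E - F" if m: "m \<in> E - F"
  proof -
    have "fst g m \<noteq> fst g f" if "f \<in> F" for f
      using bij_betw_imp_inj_on[OF *(1)] m that FE by (auto dest: inj_onD)
    then have "fst g m \<notin> fst g ` F" by blast
    then show ?thesis using *(2) E m by simp
  qed
qed

lemma aut_surj:
  assumes "aut g" "k \<in> E" obtains i where "i \<in> E" "fst g i = k"
proof -
  have "k \<in> fst g ` E" using bij_betw_imp_surj_on[OF autD(1)[OF assms(1)]] assms(2) by simp
  then show thesis using that by auto
qed

lemma aut_inj: "aut g \<Longrightarrow> a \<in> E \<Longrightarrow> b \<in> E \<Longrightarrow> fst g a = fst g b \<longleftrightarrow> a = b"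
  using autD(1) bij_betw_imp_inj_on inj_on_eq_iff by metis

lemma sg_sq [simp]: "sg b * sg b = (1 :: 'k)" "sg b * (sg b * c) = (c :: 'k)" "sg b \<noteq> (0 :: 'k)"
  by (auto simp: sg_def)

text \<open>An automorphism carries the circuit on m, a and \<open>psi m a\<close> to a circuit on
  their images, and any circuit of this shape determines \<open>psi\<close> and
  \<open>kap\<close>.\<close>

lemma psi_kap_aut:
  assumes g: "aut g" and m: "m \<in> E - F" and a: "a \<in> E" "a \<noteq> m"
  shows "psi (fst g m) (fst g a) = fst g (psi m a)"
    and "sg (snd g a) * kap (fst g m) (fst g a) = kap m a * sg (snd g (psi m a))"
proof -
  have "psi (fst g m) (fst g a) = fst g (psi m a) \<and>
    sg (snd g a) * kap (fst g m) (fst g a) = kap m a * sg (snd g (psi m a))"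
  proof (cases "a \<in> F")
    case True
    then show ?thesis using autD(3)[OF g True] by simp
  next
    case False
    then have aF: "a \<in> E - F" using a by simp
    let ?f = "psi m a"
    obtain Y where Y: "Y \<in> XX" "supp Y = {m, a, ?f}" "kap m a = s * Y a * Y ?f" "?f \<in> F"
      by (rule line_circuit[OF m aF a(2)[symmetric]])
    obtain X where X: "X \<in> XX" "\<forall>e\<in>E. X (fst g e) = sg (snd g e) * Y e"
      using g Y(1) unfolding aut_def by blast
    have fE: "?f \<in> E" using Y(4) FE by blast
    have "supp X = {fst g m, fst g a, fst g ?f}"
    proof
      have "e \<in> {fst g m, fst g a, fst g ?f}" if e: "e \<in> supp X" for e
      proof -
        have "e \<in> E" using circ_E[OF X(1)] e by (rule subsetD)
        then obtain e' where e': "e' \<in> E" "e = fst g e'"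
          using aut_surj[OF g] by metis
        then have "e' \<in> supp Y" using X(2) e by auto
        then show ?thesis unfolding Y(2) e' by blast
      qed
      then show "supp X \<subseteq> {fst g m, fst g a, fst g ?f}" by (rule subsetI)
      have "X (fst g m) \<noteq> 0" "X (fst g a) \<noteq> 0" "X (fst g ?f) \<noteq> 0"
        using X(2) m a(1) fE supp_nz[OF Y(2)] by simp_all
      then show "{fst g m, fst g a, fst g ?f} \<subseteq> supp X" by simp
    qed
    moreover have "fst g m \<noteq> fst g a" using aut_inj[OF g, of m a] m a by auto
    ultimately show ?thesis
      using psi_unique[OF autD(5)[OF g m] autD(5)[OF g aF] autD(3)[OF g Y(4)] X(1)]
        kap_unique[OF autD(5)[OF g m] autD(5)[OF g aF] _ autD(3)[OF g Y(4)] X(1)]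
        X(2) a(1) fE Y(3) by (simp add: algebra_simps)
  qed
  then show "psi (fst g m) (fst g a) = fst g (psi m a)"
    "sg (snd g a) * kap (fst g m) (fst g a) = kap m a * sg (snd g (psi m a))" by auto
qed

lemma act_one: "act_ext ext E g (bv {}) = (bv {} :: nat set \<Rightarrow> 'k)"
  using act_ext_bv[OF finE, of "{}" g] by (simp add: sgn_act_def)

lemma phi_one: "phi m (bv {}) = bv {}"
  using phi_mon[of "[]" m] by simp

lemma mon_Th_extU: "m \<in> E - F \<Longrightarrow> set xs \<subseteq> E \<Longrightarrow> mon (Th m) xs \<in> extU E"
  using extU_FE subsetD[OF extsp_extU mon_Th_extsp] by blast

lemma act_Th:
  assumes g: "aut g" and m: "m \<in> E - F" and a: "a \<in> E" and v: "v \<in> extU E"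
  shows "act_ext ext E g (Th m a v) = (\<lambda>U. sg (snd g a) * Th (fst g m) (fst g a) (act_ext ext E g v) U)"
proof (cases "a = m")
  case True
  then show ?thesis using m autD(5)[OF g m] by (simp add: Th_self linop_zero[OF linop_act_ext])
next
  case False
  note pk = psi_kap_aut[OF g m a False]
  have "psi m a \<in> E" using psi_F[OF m a False] FE by blast
  then have "act_ext ext E g (Th m a v)
      = (\<lambda>U. (kap m a * sg (snd g (psi m a))) * xm (fst g (psi m a)) (act_ext ext E g v) U)"
    unfolding Th_def
    by (simp add: linop_scale[OF linop_act_ext] act_ext_xm[OF finE autD(1)[OF g] _ v] mult.assoc)
  then show ?thesis unfolding pk(2)[symmetric] by (simp add: Th_def pk(1) mult.assoc)
qed

text \<open>The two identities need a joint induction over monomials: at the letter m the residue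
  turns into the projection.\<close>

lemma phi_act:
  assumes g: "aut g" and m: "m \<in> E - F" and v: "v \<in> extU E"
  shows "phi (fst g m) (act_ext ext E g v) = act_ext ext E g (phi m v)"
    and "res (fst g m) (act_ext ext E g v) = (\<lambda>U. sg (snd g m) * act_ext ext E g (res m v) U)"
proof -
  let ?A = "act_ext ext E g :: (nat set \<Rightarrow> 'k) \<Rightarrow> _"
  let ?W1 = "{v. phi (fst g m) (?A v) = ?A (phi m v)}"
  let ?W2 = "{v. res (fst g m) (?A v) = (\<lambda>U. sg (snd g m) * ?A (res m v) U)}"
  have "subsp ?W1"
    by (rule subsp_equalizer[OF linop_comp[OF linop_phi[of "fst g m"] linop_act_ext[of E g]]
          linop_comp[OF linop_act_ext[of E g] linop_phi[of m]]])
  moreover have "subsp ?W2"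
    by (rule subsp_equalizer[OF linop_comp[OF linop_res[of "fst g m"] linop_act_ext[of E g]]
          linop_smult[OF linop_comp[OF linop_act_ext[of E g] linop_res[of m]]]])
  ultimately have W: "subsp (?W1 \<inter> ?W2)" by (rule subsp_Int)
  have gm: "fst g m \<in> E - F" by (rule autD(5)[OF g m])
  have "v \<in> ?W1 \<inter> ?W2"
  proof (rule extU_mon_induct[OF finE v W])
    fix xs assume "set xs \<subseteq> E"
    then show "mon xm xs \<in> ?W1 \<inter> ?W2"
    proof (induction xs)
      case Nil
      have "res (fst g m) (bv {}) = (\<lambda>_. 0)" "res m (bv {}) = (\<lambda>_. 0)"
        by (rule res_zero[of _ "{}"]; simp add: bv_extU)+
      then show ?case by (simp add: act_one phi_one linop_zero[OF linop_act_ext])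
    next
      case (Cons a xs)
      then have a: "a \<in> E" and xs: "set xs \<subseteq> E" by auto
      let ?v = "mon xm xs"
      have vE: "?v \<in> extU E" by (rule mon_extU[OF xs])
      have pE: "phi m ?v \<in> extU E" unfolding phi_mon[OF xs] by (rule mon_Th_extU[OF m xs])
      have rE: "res m ?v \<in> extU E"
        by (rule extU_FE[OF subsetD[OF extsp_extU res_extsp[OF m mon_extsp[OF finE xs]]]])
      have IH: "phi (fst g m) (?A ?v) = ?A (phi m ?v)"
        "res (fst g m) (?A ?v) = (\<lambda>U. sg (snd g m) * ?A (res m ?v) U)" using Cons by auto
      have AE: "?A w \<in> extU E" for w by (rule act_ext_extU[OF autD(1)[OF g]])
      have ga: "fst g a \<in> E" by (rule autD(4)[OF g a])
      have Axm: "?A (xm a ?v) = (\<lambda>U. sg (snd g a) * xm (fst g a) (?A ?v) U)"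
        by (rule act_ext_xm[OF finE autD(1)[OF g] a vE])
      have "phi (fst g m) (?A (xm a ?v)) = ?A (phi m (xm a ?v))"
        unfolding Axm by (simp add: linop_scale[OF linop_phi] phi_xm ga AE IH a vE act_Th[OF g m a pE])
      moreover have "res (fst g m) (?A (xm a ?v)) = (\<lambda>U. sg (snd g m) * ?A (res m (xm a ?v)) U)"
      proof (cases "a = m")
        case True
        then show ?thesis unfolding Axm using m gm
          by (simp add: linop_scale[OF linop_res] res_xm_self AE vE IH)
      next
        case False
        then have "fst g a \<noteq> fst g m" using aut_inj[OF g a, of m] m by auto
        then show ?thesis unfolding Axm using False
          by (simp add: linop_scale[OF linop_res] res_xm ga AE IH a vE linop_scale[OF linop_act_ext, of _ _ "- s"]
              act_Th[OF g m a rE] linop_scale[OF linop_Th] mult_ac del: mult_minus_left)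
      qed
      ultimately show ?case by simp
    qed
  qed
  then show "phi (fst g m) (?A v) = ?A (phi m v)"
    "res (fst g m) (?A v) = (\<lambda>U. sg (snd g m) * ?A (res m v) U)" by auto
qed

lemma equivar_incl:
  assumes "\<And>h. h \<in> H \<Longrightarrow> aut h"
  shows "equivar (extsp F d) (idl ext E RA d) (\<lambda>v. v) (act_ext ext F) (act_ext ext E) H"
  unfolding equivar_def
proof (intro ballI)
  fix h and v :: "nat set \<Rightarrow> 'k" assume "v \<in> extsp F d"
  then have "act_ext ext F h v = act_ext ext E h v"
    by (intro act_ext_subset[OF finE FE] subsetD[OF extsp_extU])
  then show "(\<lambda>x. act_ext ext F h v x - act_ext ext E h v x) \<in> idl ext E RA d"
    by (simp add: subsp_zero[OF subsp_idl])
qed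

lemma subsp_tsp:
  assumes "\<And>d. subsp (V d)" shows "subsp (tsp Er V d)"
  unfolding subsp_def
proof (intro conjI allI ballI)
  show "(\<lambda>_. 0) \<in> tsp Er V d" by (simp add: tsp_def subsp_zero[OF assms])
  show "(\<lambda>x. c * u x + v x) \<in> tsp Er V d" if "u \<in> tsp Er V d" "v \<in> tsp Er V d" for c u v
    using that by (auto simp: tsp_def subspD[OF assms] split: if_splits)
qed

lemma sum_aut_delta:
  assumes "aut h"
  shows "(\<Sum>j\<in>E-F. if fst h j = k then G j else 0)
    = (if k \<in> E - F then G (THE j. j \<in> E - F \<and> fst h j = k) else (0 :: 'k))"
proof (cases "k \<in> E - F")
  case True
  then obtain i where i: "i \<in> E" "fst h i = k"
    using aut_surj[OF assms, of k] by auto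
  then have iF: "i \<in> E - F" using True autD(3)[OF assms, of i] by auto
  have eq: "fst h j = k \<longleftrightarrow> j = i" if "j \<in> E - F" for j
    using aut_inj[OF assms, of j i] that i by auto
  then have "(THE j. j \<in> E - F \<and> fst h j = k) = i" using iF by (intro the_equality) auto
  moreover have "(\<Sum>j\<in>E-F. if fst h j = k then G j else 0) = (\<Sum>j\<in>E-F. if j = i then G i else 0)"
    by (rule sum.cong) (auto simp: eq)
  ultimately show ?thesis using True iF finE by simp
next
  case False
  then have "\<And>j. j \<in> E - F \<Longrightarrow> fst h j \<noteq> k" using autD(5)[OF assms] by blast
  then show ?thesis unfolding if_not_P[OF False] by (intro sum.neutral ballI if_not_P)
qed

lemma aut_preimage:
  assumes "aut h" "k \<in> E - F"
  shows "(THE j. j \<in> E - F \<and> fst h j = k) \<in> E - F \<and> fst h (THE j. j \<in> E - F \<and> fst h j = k) = k"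
proof (rule theI')
  obtain i where i: "i \<in> E" "fst h i = k"
    using aut_surj[OF assms(1), of k] assms(2) by auto
  then have "i \<in> E - F" using assms(2) autD(3)[OF assms(1), of i] by auto
  then show "\<exists>!j. j \<in> E - F \<and> fst h j = k" using i aut_inj[OF assms(1)] by auto
qed

lemma equivar_resmap:
  assumes H: "\<And>h. h \<in> H \<Longrightarrow> aut h"
  shows "equivar (extsp E d) (tsp (E - F) (idl ext F RB) d) resmap (act_ext ext E)
    (act_tensor (E - F) (act_ext ext F)) H"
  unfolding equivar_def
proof (intro ballI)
  fix h and v :: "nat set \<Rightarrow> 'k" assume h: "h \<in> H" and v: "v \<in> extsp E d"
  \<comment> \<open>Equality holds already on representatives, before passing to the
    quotient.\<close>
  have "resmap (act_ext ext E h v) = act_tensor (E - F) (act_ext ext F) h (resmap v)"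
  proof (rule HOL.ext, clarify)
    fix k U
    show "resmap (act_ext ext E h v) (k, U) = act_tensor (E - F) (act_ext ext F) h (resmap v) (k, U)"
    proof (cases "k \<in> E - F")
      case True
      define j where "j = (THE j. j \<in> E - F \<and> fst h j = k)"
      have j: "j \<in> E - F" "fst h j = k" using aut_preimage[OF H[OF h] True] by (auto simp: j_def)
      have "resmap (act_ext ext E h v) (k, U) = sg (snd h j) * act_ext ext E h (res j v) U"
        using phi_act(2)[OF H[OF h] j(1) subsetD[OF extsp_extU v]] j(2) True by (simp add: resmap_def)
      also have "act_ext ext E h (res j v) = act_ext ext F h (res j v)"
        using subsetD[OF extsp_extU res_extsp[OF j(1) v]] by (simp add: act_ext_subset[OF finE FE])
      also have "res j v = (\<lambda>b. resmap v (j, b))" using j(1) by (simp add: resmap_def)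
      finally show ?thesis
        unfolding act_tensor_def prod.case sum_aut_delta[OF H[OF h]] if_P[OF True] j_def[symmetric] .
    next
      case False
      show ?thesis
        unfolding act_tensor_def prod.case sum_aut_delta[OF H[OF h]] resmap_def if_not_P[OF False] by (rule refl)
    qed
  qed
  then show "(\<lambda>x. resmap (act_ext ext E h v) x - act_tensor (E - F) (act_ext ext F) h (resmap v) x)
      \<in> tsp (E - F) (idl ext F RB) d"
    by (simp add: subsp_zero[OF subsp_tsp[OF subsp_idl]])
qed

end

section \<open>Quadratic duals\<close>

definition lw :: "nat \<Rightarrow> (nat list \<Rightarrow> 'k::field) \<Rightarrow> nat list \<Rightarrow> 'k" where
  "lw a u = (\<lambda>w. case w of [] \<Rightarrow> 0 | b # w' \<Rightarrow> if b = a then u w' else 0)"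

text \<open>The product of r and \<open>\<psi>\<close> in the free algebra for r concentrated in
  degree 2; only the values of r on two-letter words are read.\<close>

definition rw :: "(nat list \<Rightarrow> 'k::field) \<Rightarrow> (nat list \<Rightarrow> 'k) \<Rightarrow> nat list \<Rightarrow> 'k" where
  "rw r \<psi> = (\<lambda>w. case w of a # b # w' \<Rightarrow> r [a, b] * \<psi> w' | _ \<Rightarrow> 0)"

lemma lw_simps [simp]: "lw a u [] = 0" "lw a u (b # w) = (if b = a then u w else 0)"
  by (simp_all add: lw_def)

lemma rw_simps [simp]: "rw r \<psi> [] = 0" "rw r \<psi> [a] = 0" "rw r \<psi> (a # b # w) = r [a, b] * \<psi> w"
  by (simp_all add: rw_def)

lemma fun_list_eqI: "f [] = g [] \<Longrightarrow> (\<And>a w. f (a # w) = g (a # w)) \<Longrightarrow> f = g"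
  by (rule HOL.ext) (metis neq_Nil_conv)

lemma fun_list2_eqI:
  "f [] = g [] \<Longrightarrow> (\<And>a. f [a] = g [a]) \<Longrightarrow> (\<And>a b w. f (a # b # w) = g (a # b # w)) \<Longrightarrow> f = g"
  by (rule HOL.ext) (metis neq_Nil_conv)

lemma linop_lw: "linop (lw a)"
  unfolding linop_def by (intro allI fun_list_eqI) simp_all

lemma linop_rw: "linop (rw r)"
  unfolding linop_def by (intro allI fun_list2_eqI) (simp_all add: algebra_simps)

lemma words_Nil [simp]: "[] \<in> words E d \<longleftrightarrow> d = 0"
  by (auto simp: words_def)

lemma words_Cons [simp]: "a # w \<in> words E d \<longleftrightarrow> a \<in> E \<and> (\<exists>d'. d = Suc d' \<and> w \<in> words E d')"
  by (auto simp: words_def)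

lemma finite_words: "finite E \<Longrightarrow> finite (words E d)"
  unfolding words_def using finite_lists_length_eq[of E d] by (simp add: conj_commute)

lemma words2E: assumes "x \<in> words E 2" obtains a b where "x = [a, b]" "a \<in> E" "b \<in> E"
proof -
  have "length x = 2" "set x \<subseteq> E" using assms by (auto simp: words_def)
  then show thesis using that by (auto simp: numeral_2_eq_2 length_Suc_conv)
qed

lemma subsp_frsp: "subsp (frsp E d :: (nat list \<Rightarrow> 'k::field) set)"
proof -
  have "c * u S + v S \<noteq> 0 \<Longrightarrow> u S \<noteq> 0 \<or> v S \<noteq> 0" for c and u v :: "nat list \<Rightarrow> 'k" and S
    by auto
  then show ?thesis unfolding subsp_def frsp_def by blast
qed

lemma frspD: "u \<in> frsp E d \<Longrightarrow> w \<notin> words E d \<Longrightarrow> u w = 0"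
  unfolding frsp_def by blast

lemma frspI: "(\<And>w. u w \<noteq> 0 \<Longrightarrow> w \<in> words E d) \<Longrightarrow> u \<in> frsp E d"
  unfolding frsp_def by blast

lemma bv_frsp: "w \<in> words E d \<Longrightarrow> bv w \<in> frsp E d"
  by (rule frspI) (auto simp: bv_def split: if_splits)

lemma lw_frsp:
  assumes "a \<in> E" "u \<in> frsp E d" shows "lw a u \<in> frsp E (Suc d)"
proof (rule frspI)
  fix w assume "lw a u w \<noteq> 0"
  then show "w \<in> words E (Suc d)" using assms frspD[OF assms(2)]
    by (cases w) (auto split: if_splits)
qed

lemma rw_frsp:
  assumes "r \<in> frsp E 2" "u \<in> frsp E d" shows "rw r u \<in> frsp E (d + 2)"
proof (rule frspI)
  fix w assume w: "rw r u w \<noteq> 0"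
  then obtain a b w' where ww: "w = a # b # w'" by (cases w; cases "tl w") (auto simp: neq_Nil_conv)
  with w have "[a, b] \<in> words E 2" "w' \<in> words E d" using frspD[OF assms(1)] frspD[OF assms(2)] by fastforce+
  then show "w \<in> words E (d + 2)" unfolding ww by (auto simp: numeral_2_eq_2)
qed

lemma lmulw_Cons: "lmulw (c # a) r b = lw c (lmulw a r b)"
  by (rule fun_list_eqI) (auto simp: lmulw_def)

lemma lmulw_Nil: "lmulw [] r b = rw r (bv b)"
  by (rule fun_list2_eqI) (auto simp: lmulw_def bv_def numeral_2_eq_2)

lemma lw_bv: "lw a (bv w) = bv (a # w)"
  by (rule fun_list_eqI) (auto simp: bv_def)

lemma frsp_bv_mem:
  assumes "finite E" "subsp W" "\<And>w. w \<in> words E d \<Longrightarrow> bv w \<in> W" "u \<in> frsp E d" shows "u \<in> W"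
  using lspan_bv[OF finite_words[OF assms(1)] _ assms(3,2)] frspD[OF assms(4)] by blast

lemma subsp_didl: "subsp (didl E P d)"
  unfolding didl_def by (rule subsp_lspan)

lemma lw_didl:
  assumes "c \<in> E" "u \<in> didl E P d" shows "lw c u \<in> didl E P (Suc d)"
proof -
  have "didl E P d \<subseteq> {u. lw c u \<in> didl E P (Suc d)}"
    unfolding didl_def[of E P d]
  proof (rule lspan_minimal[OF subsp_vimage[OF subsp_didl linop_lw]], clarify)
    fix a b and r :: "nat list \<Rightarrow> 'a"
    assume "set a \<subseteq> E" "set b \<subseteq> E" "r \<in> P"
    then show "lw c (lmulw a r b) \<in> didl E P (Suc (length a + 2 + length b))"
      unfolding didl_def lmulw_Cons[symmetric] using assms(1)
      by (intro lspan_base CollectI exI[of _ "c # a"] exI[of _ r] exI[of _ b]) auto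
  qed
  then show ?thesis using assms(2) by blast
qed

lemma rw_didl:
  assumes "finite E" "r \<in> P" "u \<in> frsp E d" shows "rw r u \<in> didl E P (d + 2)"
proof -
  have "u \<in> {u. rw r u \<in> didl E P (d + 2)}"
  proof (rule frsp_bv_mem[OF assms(1) _ _ assms(3)])
    show "subsp {u. rw r u \<in> didl E P (d + 2)}" by (rule subsp_vimage[OF subsp_didl linop_rw])
    fix w assume "w \<in> words E d"
    then have "lmulw [] r w \<in> didl E P (d + 2)"
      unfolding didl_def using assms(2)
      by (intro lspan_base CollectI exI[of _ "[]"] exI[of _ r] exI[of _ w]) (auto simp: words_def)
    then show "bv w \<in> {u. rw r u \<in> didl E P (d + 2)}" by (simp add: lmulw_Nil)
  qed
  then show ?thesis by simp
qed

text \<open>The two-sided ideal is spanned by products of a word, a relation and a word. Building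
  the left word letter by letter reduces a claim to \<open>rw\<close> and \<open>lw\<close>.\<close>

lemma didl_induct:
  assumes W: "\<And>d. subsp (W d)"
    and base: "\<And>r b. r \<in> P \<Longrightarrow> set b \<subseteq> E \<Longrightarrow> rw r (bv b) \<in> W (2 + length b)"
    and step: "\<And>a u d. a \<in> E \<Longrightarrow> u \<in> W d \<Longrightarrow> lw a u \<in> W (Suc d)"
  shows "didl E P d \<subseteq> W d"
  unfolding didl_def
proof (rule lspan_minimal[OF W], clarify)
  fix a b and r :: "nat list \<Rightarrow> 'a"
  assume ab: "set a \<subseteq> E" "set b \<subseteq> E" "r \<in> P"
  then show "lmulw a r b \<in> W (length a + 2 + length b)"
  proof (induction a)
    case Nil
    then show ?case using base by (simp add: lmulw_Nil)
  next
    case (Cons c a)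
    then show ?case using step[of c "lmulw a r b"] by (simp add: lmulw_Cons)
  qed
qed

section \<open>Dual relations as linear forms in degree two\<close>

context sign_alg
begin

abbreviation KP :: "nat set \<Rightarrow> (nat \<times> (nat set \<Rightarrow> 'k)) set \<Rightarrow> (nat list \<Rightarrow> 'k) set" where
  "KP E R \<equiv> perp E (I2 ext E R)"

lemma kidl_didl: "(kidl ext E R d :: (nat list \<Rightarrow> 'k) set) = didl E (KP E R) d"
  by (simp add: kidl_def)

lemma subsp_kidl: "subsp (kidl ext E R d :: (nat list \<Rightarrow> 'k) set)"
  unfolding kidl_didl by (rule subsp_didl)

lemma KP_frsp: "KP E R \<subseteq> frsp E 2"
  by (auto simp: perp_def)

lemma wordproj_mon:
  assumes "finite E"
  shows "wordproj ext E Q = (\<lambda>U. \<Sum>x\<in>words E 2. Q x * mon xm x U)"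
  unfolding wordproj_def
proof (rule HOL.ext, rule sum.cong[OF refl])
  fix U x assume "x \<in> words E 2"
  then obtain a b where x: "x = [a, b]" "a \<in> E" "b \<in> E" by (rule words2E)
  have "(cf ext {a} {b} :: 'k) = (if a = b then 0 else sn a {b})"
  proof -
    have "{(t, x). t \<in> {a} \<and> x \<in> {b} \<and> x < t} = Pair a ` {x \<in> {b}. x < a}" by auto
    then have eq: "card {(t, x). t \<in> {a} \<and> x \<in> {b} \<and> x < t} = card {x \<in> {b}. x < a}"
      by (simp only:) (rule card_image, simp add: inj_on_def)
    show ?thesis unfolding cf_def sn_def eq by simp
  qed
  moreover have "xm b (bv {}) = bv {b}" by (simp add: xm_bv sn_def)
  ultimately have "mon xm x U = cf ext {a} {b} * bv {a, b} U"
    unfolding x by (cases "a = b") (simp_all add: xm_bv xm_bv_mem)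
  moreover have "set x = {a, b}" "x ! 0 = a" "x ! 1 = b" by (simp_all add: x)
  ultimately show "(if set x = U then cf ext {x ! 0} {x ! 1} * Q x else 0) = Q x * mon xm x U"
    by (cases "U = {a, b}") (simp_all add: bv_def)
qed

lemma KP_test:
  assumes fE: "finite E" and u: "u \<in> KP E R" and Q: "Q \<in> frsp E 2"
    and "(\<lambda>U. \<Sum>x\<in>words E 2. Q x * mon xm x U) \<in> idl ext E R 2"
  shows "(\<Sum>x\<in>words E 2. u x * Q x) = 0"
proof -
  have "Q \<in> I2 ext E R" using assms(4) Q by (simp add: I2_def wordproj_mon[OF fE])
  then show ?thesis using u by (simp add: perp_def)
qed

lemma sum_bv:
  assumes "finite A" "p \<in> A"
  shows "(\<Sum>x\<in>A. G x * bv p x) = (G p :: 'k)" "(\<Sum>x\<in>A. bv p x * G x) = (G p :: 'k)"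
proof -
  have "(\<Sum>x\<in>A. G x * bv p x) = (\<Sum>x\<in>A. if x = p then G p else 0)"
    by (rule sum.cong) (auto simp: bv_def)
  then show "(\<Sum>x\<in>A. G x * bv p x) = G p" using assms by simp
  then show "(\<Sum>x\<in>A. bv p x * G x) = G p" by (simp add: mult.commute)
qed

text \<open>Test against x_a x_a and x_a x_b + s x_b x_a, which vanish in A. The diagonal needs a
  test of its own: the swap rule says nothing about it when s = -1 or in characteristic 2.\<close>

lemma KP_swap:
  assumes fE: "finite E" and u: "u \<in> KP E R" and ab: "a \<in> E" "b \<in> E"
  shows "u [a, b] = - s * u [b, a]" and "u [a, a] = 0"
proof -
  have W: "[a, b] \<in> words E 2" "[b, a] \<in> words E 2" "[a, a] \<in> words E 2"
    using ab by (auto simp: numeral_2_eq_2)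
  note [simp] = sum_bv[OF finite_words[OF fE] W(1)] sum_bv[OF finite_words[OF fE] W(2)]
    sum_bv[OF finite_words[OF fE] W(3)]
  have "(\<Sum>x\<in>words E 2. u x * bv [a, a] x) = 0"
    by (rule KP_test[OF fE u bv_frsp[OF W(3)]]) (simp add: subsp_zero[OF subsp_idl])
  then show "u [a, a] = 0" by simp
  let ?Q = "\<lambda>x. s * bv [b, a] x + bv [a, b] x"
  have "xm a (xm b (bv {})) U = - s * xm b (xm a (bv {})) U" for U
    using xm_anticomm[of a b] by (cases "a = b") simp_all
  then have *: "(\<lambda>U. \<Sum>x\<in>words E 2. ?Q x * mon xm x U) = (\<lambda>_. 0)"
    by (simp add: distrib_right sum.distrib mult.assoc sum_distrib_left[symmetric])
  have "(\<Sum>x\<in>words E 2. u x * ?Q x) = 0"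
    by (rule KP_test[OF fE u subspD[OF subsp_frsp bv_frsp[OF W(2)] bv_frsp[OF W(1)]]])
       (simp only: * subsp_zero[OF subsp_idl])
  moreover have "(\<Sum>x\<in>words E 2. u x * ?Q x) = s * u [b, a] + u [a, b]"
    by (simp add: distrib_left sum.distrib mult.left_commute[of _ s] sum_distrib_left[symmetric])
  ultimately show "u [a, b] = - s * u [b, a]" by (simp add: eq_neg_iff_add_eq_0 add.commute)
qed

text \<open>Linear forms take values in functions on \<open>unit\<close>, so that
  \<open>linop\<close> and its lemmas apply to them.\<close>

definition func :: "nat set \<Rightarrow> ((nat set \<Rightarrow> 'k) \<Rightarrow> unit \<Rightarrow> 'k) \<Rightarrow> nat list \<Rightarrow> 'k" where
  "func E L = (\<lambda>x. if x \<in> words E 2 then L (mon xm x) () else 0)"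

text \<open>Elements of the dual relation space are the linear forms on the degree two part of the
  exterior (or commutative) algebra that vanish on the ideal.\<close>

lemma func_KP:
  assumes fE: "finite E" and L: "linop L" "\<And>v. v \<in> idl ext E R 2 \<Longrightarrow> L v () = 0"
  shows "func E L \<in> KP E R"
proof -
  have "(\<Sum>x\<in>words E 2. func E L x * Q x) = 0" if "Q \<in> I2 ext E R" for Q
  proof -
    have "(\<lambda>U. \<Sum>x\<in>words E 2. Q x * mon xm x U) \<in> idl ext E R 2"
      using that by (simp add: I2_def wordproj_mon[OF fE])
    from L(2)[OF this] have "(\<Sum>x\<in>words E 2. Q x * L (mon xm x) ()) = 0"
      unfolding linop_sum[OF L(1)] .
    moreover have "(\<Sum>x\<in>words E 2. func E L x * Q x) = (\<Sum>x\<in>words E 2. Q x * L (mon xm x) ())"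
      by (rule sum.cong) (auto simp: func_def)
    ultimately show ?thesis by simp
  qed
  then show ?thesis unfolding perp_def by (auto simp: func_def frsp_def)
qed

lemma KP_func:
  assumes fE: "finite E" and R: "rels_in E R" and u: "u \<in> KP E R"
  obtains L where "linop L" "\<And>v. v \<in> idl ext E R 2 \<Longrightarrow> L v () = 0" "u = func E L"
proof -
  let ?P = "{x \<in> words E 2. x ! 0 < x ! 1}"
  \<comment> \<open>Increasing two-letter words index the basis of degree 2; the other values of u
    follow from \<open>KP_swap\<close>.\<close>
  define L where "L = (\<lambda>v (_::unit). \<Sum>x\<in>?P. u x * v (set x))"
  have L: "linop L"
    unfolding linop_def L_def by (simp add: sum.distrib sum_distrib_left algebra_simps)
  have fP: "finite ?P" using finite_words[OF fE] by simp
  have mon2: "mon xm x = bv (set x)" if "x \<in> ?P" for x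
  proof -
    have "x \<in> words E 2" "x ! 0 < x ! 1" using that by auto
    then obtain a b where x: "x = [a, b]" "a < b" by (auto elim!: words2E)
    have "{y \<in> {b}. y < a} = {}" using x(2) by auto
    then have "sn a {b} = 1" unfolding sn_def by (simp only:) simp
    moreover have "sn b {} = 1" by (simp add: sn_def)
    ultimately show ?thesis using x by (simp add: xm_bv)
  qed
  have inj: "x = y" if xy: "x \<in> ?P" "y \<in> ?P" "set x = set y" for x y
  proof -
    have "x \<in> words E 2" "x ! 0 < x ! 1" "y \<in> words E 2" "y ! 0 < y ! 1" using xy by auto
    then obtain a b c d where "x = [a, b]" "a < b" "y = [c, d]" "c < d" by (auto elim!: words2E)
    then show ?thesis using xy(3) by (auto simp: doubleton_eq_iff)
  qed
  have Lu: "L (bv (set x)) () = u x" if "x \<in> ?P" for x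
  proof -
    have "L (bv (set x)) () = (\<Sum>y\<in>?P. u y * bv x y)"
      unfolding L_def by (rule sum.cong) (use inj that in \<open>auto simp: bv_def\<close>)
    then show ?thesis using sum_bv[OF fP that] by simp
  qed
  have van: "L v () = 0" if v: "v \<in> idl ext E R 2" for v
  proof -
    \<comment> \<open>A lift of v to the free algebra, supported on increasing words.\<close>
    define Q where "Q = (\<lambda>x. if x \<in> ?P then v (set x) else 0)"
    have vE: "v \<in> extsp E 2" using idl_extsp[OF fE R] v by blast
    have "(\<Sum>x\<in>words E 2. Q x * mon xm x U) = v U" for U
    proof -
      have "(\<Sum>x\<in>words E 2. Q x * mon xm x U) = (\<Sum>x\<in>?P. Q x * mon xm x U)"
        by (rule sum.mono_neutral_right) (use finite_words[OF fE] in \<open>auto simp: Q_def\<close>)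
      also have "\<dots> = (\<Sum>x\<in>?P. if set x = U then v U else 0)"
      proof (rule sum.cong[OF refl])
        fix x assume x: "x \<in> ?P"
        show "Q x * mon xm x U = (if set x = U then v U else 0)"
          unfolding mon2[OF x] using x by (auto simp: Q_def bv_def)
      qed
      also have "\<dots> = v U"
      proof (cases "\<exists>x\<in>?P. set x = U")
        case True
        then obtain x where x: "x \<in> ?P" "set x = U" by blast
        then have "(\<Sum>x\<in>?P. if set x = U then v U else 0) = (\<Sum>y\<in>?P. v U * bv x y)"
          by (intro sum.cong) (use inj in \<open>auto simp: bv_def\<close>)
        then show ?thesis using sum_bv[OF fP x(1)] by simp
      next
        case False
        have "v U = 0"
        proof (rule ccontr)
          assume "v U \<noteq> 0"
          then have "U \<subseteq> E" "card U = 2" using vE by (auto simp: extsp_def)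
          then obtain a b where ab: "U = {a, b}" "a \<noteq> b" by (auto simp: card_2_iff)
          then have "set [min a b, max a b] = U" "[min a b, max a b] \<in> ?P"
            using \<open>U \<subseteq> E\<close> by (auto simp: min_def max_def numeral_2_eq_2)
          then show False using False by blast
        qed
        then show ?thesis using False by simp
      qed
      finally show ?thesis .
    qed
    then have "(\<lambda>U. \<Sum>x\<in>words E 2. Q x * mon xm x U) \<in> idl ext E R 2" using v by simp
    then have "(\<Sum>x\<in>words E 2. u x * Q x) = 0"
      by (intro KP_test[OF fE u]) (auto simp: Q_def frsp_def)
    moreover have "(\<Sum>x\<in>words E 2. u x * Q x) = (\<Sum>x\<in>?P. u x * Q x)"
      by (rule sum.mono_neutral_right) (use finite_words[OF fE] in \<open>auto simp: Q_def\<close>)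
    moreover have "(\<Sum>x\<in>?P. u x * Q x) = (\<Sum>x\<in>?P. u x * v (set x))"
      by (rule sum.cong) (auto simp: Q_def)
    ultimately show ?thesis by (simp add: L_def)
  qed
  have "u x = func E L x" for x
  proof (cases "x \<in> words E 2")
    case True
    then obtain a b where x: "x = [a, b]" "a \<in> E" "b \<in> E" by (rule words2E)
    have *: "L (mon xm [c, d]) () = u [c, d]" if "c < d" "c \<in> E" "d \<in> E" for c d
    proof -
      have "[c, d] \<in> ?P" using that by (auto simp: numeral_2_eq_2)
      then show ?thesis using Lu mon2 by metis
    qed
    consider "a < b" | "a = b" | "b < a" by linarith
    then have "L (mon xm [a, b]) () = u [a, b]"
    proof cases
      case 1
      then show ?thesis using * x by blast
    next
      case 2
      then show ?thesis using KP_swap(2)[OF fE u x(2,2)] by (simp add: linop_zero[OF L])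
    next
      case 3
      then have "xm a (xm b (bv {})) = (\<lambda>U. - s * xm b (xm a (bv {})) U)" by (intro xm_anticomm) simp
      then have "L (mon xm [a, b]) () = - s * L (mon xm [b, a]) ()" by (simp only: foldr.simps o_apply id_apply linop_scale[OF L])
      then show ?thesis using *[OF 3 x(3,2)] KP_swap(1)[OF fE u x(2,3)] by simp
    qed
    then show ?thesis using True x by (simp add: func_def)
  next
    case False
    then show ?thesis using u by (auto simp: func_def perp_def frsp_def)
  qed
  then have "u = func E L" by blast
  with L van that show thesis by blast
qed

end

section \<open>Dual relations from the maps between the two algebras\<close>

context fibration
begin

lemma phi_idl: "m \<in> E - F \<Longrightarrow> v \<in> idl ext E RA d \<Longrightarrow> phi m v \<in> idl ext F RB d"
  using uidl_idl phi_res_idl(1) phi_extsp subsetD[OF idl_extsp[OF finE rels_in_RA]] by blast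

lemma idl_one:
  assumes v: "v \<in> idl ext F RB 1" shows "v = (\<lambda>_. 0)"
proof -
  have "2 \<le> k" if "(k, r) \<in> RB" for k r
    using that circ_card unfolding RB_def rel_def by fastforce
  then have "{lmul ext F T r |T k r. T \<subseteq> F \<and> (k, r) \<in> RB \<and> card T + k = 1} \<subseteq> {\<lambda>_. 0}"
    by fastforce
  then have "idl ext F RB 1 \<subseteq> {\<lambda>_. 0}"
    unfolding idl_def by (intro lspan_minimal) (auto simp: subsp_def)
  then show ?thesis using v by blast
qed

text \<open>The ideal of B is zero in degree 1, because circuits have at least three elements.
  Residues thus vanish outright on quadratic relations, and can be composed with any linear form on
  B_1.\<close>

lemma res_idl_two: "m \<in> E - F \<Longrightarrow> v \<in> idl ext E RA 2 \<Longrightarrow> res m v = (\<lambda>_. 0)"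
proof (rule idl_one)
  assume m: "m \<in> E - F" and v: "v \<in> idl ext E RA 2"
  have "v \<in> extsp E 2" by (rule subsetD[OF idl_extsp[OF finE rels_in_RA] v])
  from res_extsp[OF m this] have "res m v \<in> extsp F 1" by simp
  then show "res m v \<in> idl ext F RB 1" by (rule uidl_idl[OF phi_res_idl(2)[OF m v]])
qed

text \<open>The linear form of u, evaluated on \<open>line_rewrite\<close> with v = 1.\<close>

lemma KP_line:
  assumes u: "u \<in> KP E RA" and m: "m \<in> E - F" "l \<in> E - F" "m \<noteq> l"
  shows "u [m, l] = kap m l * u [m, psi m l] - s * kap l m * u [l, psi m l]"
proof -
  obtain L where L: "linop L" "\<And>v. v \<in> idl ext E RA 2 \<Longrightarrow> L v () = 0" "u = func E L"
    by (rule KP_func[OF finE rels_in_RA u]) blast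
  let ?f = "psi m l"
  have f: "?f \<in> E" using psi_F[of m l] m FE by auto
  let ?v = "\<lambda>U. mon xm [m, l] U - (kap m l * mon xm [m, ?f] U - s * kap l m * mon xm [l, ?f] U)"
  have "?v \<in> uidl E RA" using line_rewrite[OF m bv_extU[of "{}" E]] by simp
  moreover have "?v \<in> extsp E 2"
    using mon_extsp[OF finE, of "[m, l]"] mon_extsp[OF finE, of "[m, ?f]"] mon_extsp[OF finE, of "[l, ?f]"] m f
    by (auto simp del: foldr.simps simp: numeral_2_eq_2 intro!: subsp_diff[OF subsp_extsp] subsp_scale[OF subsp_extsp])
  ultimately have "L ?v () = 0" by (intro L(2) uidl_idl)
  then have "L (mon xm [m, l]) () = kap m l * L (mon xm [m, ?f]) () - s * kap l m * L (mon xm [l, ?f]) ()"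
    by (simp only: linop_diff[OF L(1)] linop_scale[OF L(1)]) simp
  then show ?thesis using m f by (simp add: L(3) func_def numeral_2_eq_2)
qed

definition restr :: "(nat list \<Rightarrow> 'k) \<Rightarrow> nat list \<Rightarrow> 'k" where
  "restr v = (\<lambda>w. if set w \<subseteq> F then v w else 0)"

lemma linop_restr: "linop restr"
  unfolding linop_def restr_def by auto

lemma restr_frsp: "v \<in> frsp E d \<Longrightarrow> restr v \<in> frsp F d"
  by (auto simp: restr_def frsp_def words_def)

lemma frsp_FE: "frsp F d \<subseteq> frsp E d"
  using FE by (auto simp: frsp_def words_def)

lemma restr_F: "v \<in> frsp F d \<Longrightarrow> restr v = v"
  by (auto simp: restr_def frsp_def words_def fun_eq_iff)

lemma restr_lw: "restr (lw a u) = (if a \<in> F then lw a (restr u) else (\<lambda>_. 0))"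
  by (rule fun_list_eqI) (auto simp: restr_def)

lemma restr_rw_bv: "restr (rw r (bv b)) = (if set b \<subseteq> F then rw (restr r) (bv b) else (\<lambda>_. 0))"
  by (rule fun_list2_eqI) (auto simp: restr_def bv_def)

text \<open>The linear form of u is composed with the inclusion of B in A.\<close>

lemma KP_restr:
  assumes u: "u \<in> KP E RA" shows "restr u \<in> KP F RB"
proof -
  obtain L where L: "linop L" "\<And>v. v \<in> idl ext E RA 2 \<Longrightarrow> L v () = 0" "u = func E L"
    by (rule KP_func[OF finE rels_in_RA u]) blast
  have "func F L \<in> KP F RB"
    by (rule func_KP[OF finF L(1)]) (use L(2) idl_FE in blast)
  also have "func F L = restr u"
    using FE by (auto simp: L(3) func_def restr_def words_def fun_eq_iff)
  finally show ?thesis .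
qed

lemma rho_mon: "rho (mon xm xs) = (if set xs \<subseteq> F then mon xm xs else (\<lambda>_. 0))"
proof (induction xs)
  case Nil
  then show ?case by (simp add: rho_extU bv_extU)
qed (auto simp: rho_xm linop_zero[OF linop_xm])

text \<open>A form on B is extended to A through the retraction \<open>rho\<close>; in coordinates
  this is extension by zero.\<close>

lemma KP_FE: "KP F RB \<subseteq> KP E RA"
proof
  fix u assume u: "u \<in> KP F RB"
  obtain L where L: "linop L" "\<And>v. v \<in> idl ext F RB 2 \<Longrightarrow> L v () = 0" "u = func F L"
    by (rule KP_func[OF finF rels_in_RB u]) blast
  have "func E (\<lambda>v. L (rho v)) \<in> KP E RA"
    by (rule func_KP[OF finE linop_comp[OF L(1) linop_rho]]) (use L(2) rho_idl in blast)
  also have "func E (\<lambda>v. L (rho v)) = u"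
    using FE by (auto simp: L(3) func_def rho_mon words_def fun_eq_iff linop_zero[OF L(1)])
  finally show "u \<in> KP E RA" .
qed

text \<open>The linear form u on B composed with \<open>phi m\<close>, in coordinates.\<close>

definition pull :: "nat \<Rightarrow> (nat list \<Rightarrow> 'k) \<Rightarrow> nat list \<Rightarrow> 'k" where
  "pull m u = (\<lambda>x. if x \<in> words E 2
     then kap m (x ! 0) * kap m (x ! 1) * u [psi m (x ! 0), psi m (x ! 1)] else 0)"

lemma KP_pull:
  assumes u: "u \<in> KP F RB" and m: "m \<in> E - F" shows "pull m u \<in> KP E RA"
proof -
  obtain L where L: "linop L" "\<And>v. v \<in> idl ext F RB 2 \<Longrightarrow> L v () = 0" "u = func F L"
    by (rule KP_func[OF finF rels_in_RB u]) blast
  have "func E (\<lambda>v. L (phi m v)) \<in> KP E RA"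
    by (rule func_KP[OF finE linop_comp[OF L(1) linop_phi]]) (use L(2) phi_idl[OF m] in blast)
  also have "func E (\<lambda>v. L (phi m v)) = pull m u"
  proof
    fix x
    show "func E (\<lambda>v. L (phi m v)) x = pull m u x"
    proof (cases "x \<in> words E 2")
      case True
      then obtain a b where x: "x = [a, b]" "a \<in> E" "b \<in> E" by (rule words2E)
      have "phi m (mon xm x) = mon (Th m) [a, b]" using x phi_mon[of x m] by simp
      also have "\<dots> = (\<lambda>U. (kap m a * kap m b) * mon xm [psi m a, psi m b] U)"
        by (simp add: Th_def linop_scale[OF linop_xm] mult.assoc)
      finally have eq: "L (phi m (mon xm x)) () = kap m a * kap m b * L (mon xm [psi m a, psi m b]) ()"
        by (simp only: linop_scale[OF L(1)])
      show ?thesis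
      proof (cases "a = m \<or> b = m")
        case True
        then have "kap m a * kap m b = 0" using m by auto
        then show ?thesis using \<open>x \<in> words E 2\<close> unfolding func_def pull_def by (simp only: eq) (simp add: x)
      next
        case False
        then have "psi m a \<in> F" "psi m b \<in> F" using psi_F[OF m] x by auto
        then have "u [psi m a, psi m b] = L (mon xm [psi m a, psi m b]) ()"
          by (simp add: L(3) func_def numeral_2_eq_2)
        then show ?thesis using True unfolding func_def pull_def by (simp only: eq) (simp add: x)
      qed
    qed (simp add: func_def pull_def)
  qed
  finally show ?thesis .
qed

lemma res_two:
  assumes p: "p \<in> E - F" and xy: "x \<in> E" "y \<in> E"
  shows "res p (mon xm [x, y]) = (\<lambda>U. (if x = p then kap p y * bv {psi p y} U else 0)
    - s * (if y = p then kap p x * bv {psi p x} U else 0))"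
proof -
  have one: "bv {} \<in> extU E" by (simp add: bv_extU)
  have xm1: "xm a (bv {}) = bv {a}" for a by (simp add: xm_bv sn_def)
  have r0: "res p (bv {}) = (\<lambda>_. 0)" by (rule res_zero[of _ "{}"]) (simp_all add: bv_extU)
  have r1: "res p (xm y (bv {})) = (if y = p then bv {} else (\<lambda>_. 0))"
    using p xy one by (simp add: res_xm_self res_xm r0 phi_one linop_zero[OF linop_Th])
  have yE: "xm y (bv {}) \<in> extU E" by (rule xm_extU[OF xy(2) one])
  show ?thesis
  proof (cases "x = p")
    case True
    then have "res p (mon xm [x, y]) = (\<lambda>U. kap p y * bv {psi p y} U)"
      using p yE phi_xm[OF xy(2) one, of p] by (simp add: res_xm_self phi_one Th_def xm1)
    then show ?thesis using True p by (auto simp: fun_eq_iff)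
  next
    case False
    then show ?thesis
      by (simp add: res_xm[OF xy(1) yE False] r1 linop_zero[OF linop_Th]) (simp add: Th_def xm1)
  qed
qed

text \<open>The quadratic relations that commute a letter outside \<open>F\<close> to the front.\<close>

lemma KP_res:
  assumes p: "p \<in> E - F"
  shows "(\<lambda>w. if w \<in> words E 2 then
      (if w ! 0 = p then kap p (w ! 1) * c (psi p (w ! 1)) else 0)
      - s * (if w ! 1 = p then kap p (w ! 0) * c (psi p (w ! 0)) else 0) else 0) \<in> KP E RA"
proof -
  \<comment> \<open>An arbitrary linear form c on B_1, composed with the residue at p.\<close>
  define L where "L = (\<lambda>v (_::unit). \<Sum>f\<in>F. c f * res p v {f})"
  have "linop L"
    unfolding linop_def L_def by (simp only: linopD[OF linop_res]) (simp add: sum.distrib sum_distrib_left algebra_simps)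
  then have "func E L \<in> KP E RA"
    by (rule func_KP[OF finE]) (simp add: L_def res_idl_two[OF p])
  also have "func E L = (\<lambda>w. if w \<in> words E 2 then
      (if w ! 0 = p then kap p (w ! 1) * c (psi p (w ! 1)) else 0)
      - s * (if w ! 1 = p then kap p (w ! 0) * c (psi p (w ! 0)) else 0) else 0)"
  proof
    fix w
    have sumc: "(\<Sum>f\<in>F. c f * (kap p a * bv {psi p a} {f})) = kap p a * c (psi p a)" if "a \<in> E" for a
    proof (cases "a = p")
      case True
      then show ?thesis using p by simp
    next
      case False
      then have "psi p a \<in> F" using psi_F[OF p that] by simp
      moreover have "(\<Sum>f\<in>F. c f * (kap p a * bv {psi p a} {f})) = (\<Sum>f\<in>F. if f = psi p a then kap p a * c f else 0)"
        by (rule sum.cong) (auto simp: bv_def)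
      ultimately show ?thesis using finF by simp
    qed
    show "func E L w = (if w \<in> words E 2 then
      (if w ! 0 = p then kap p (w ! 1) * c (psi p (w ! 1)) else 0)
      - s * (if w ! 1 = p then kap p (w ! 0) * c (psi p (w ! 0)) else 0) else 0)"
    proof (cases "w \<in> words E 2")
      case True
      then obtain a b where w: "w = [a, b]" "a \<in> E" "b \<in> E" by (rule words2E)
      have "L (mon xm w) () = (\<Sum>f\<in>F. c f * (if a = p then kap p b * bv {psi p b} {f} else 0)
          - s * (c f * (if b = p then kap p a * bv {psi p a} {f} else 0)))"
        unfolding L_def w(1) res_two[OF p w(2,3)] by (simp add: algebra_simps)
      also have "\<dots> = (if a = p then kap p b * c (psi p b) else 0) - s * (if b = p then kap p a * c (psi p a) else 0)"
        by (simp only: sum_subtractf sum_distrib_left[symmetric])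
           (auto simp: sumc[OF w(2)] sumc[OF w(3)])
      finally show ?thesis using True unfolding func_def by (simp add: w(1))
    qed (simp add: func_def)
  qed
  finally show ?thesis .
qed

definition tmap :: "(nat \<times> nat list \<Rightarrow> 'k) \<Rightarrow> nat list \<Rightarrow> 'k" where
  "tmap \<phi> = (\<lambda>w. case w of [] \<Rightarrow> 0 | j # w' \<Rightarrow> if j \<in> E - F then \<phi> (j, w') else 0)"

lemma tmap_simps [simp]: "tmap \<phi> [] = 0" "tmap \<phi> (j # w) = (if j \<in> E - F then \<phi> (j, w) else 0)"
  by (simp_all add: tmap_def)

lemma linop_tmap: "linop tmap"
  unfolding linop_def by (intro allI fun_list_eqI) simp_all

lemma restr_tmap: "restr (tmap \<phi>) = (\<lambda>_. 0)"
  by (rule fun_list_eqI) (auto simp: restr_def)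

lemma tmap_sum: "tmap \<phi> = (\<lambda>w. \<Sum>j\<in>E-F. lw j (\<lambda>w. \<phi> (j, w)) w)"
proof (rule fun_list_eqI)
  fix a w
  have "(\<Sum>j\<in>E-F. lw j (\<lambda>w. \<phi> (j, w)) (a # w)) = (\<Sum>j\<in>E-F. if j = a then \<phi> (a, w) else 0)"
    by (rule sum.cong) auto
  then show "tmap \<phi> (a # w) = (\<Sum>j\<in>E-F. lw j (\<lambda>w. \<phi> (j, w)) (a # w))"
    using finE by simp
qed simp

lemma tsp_Suc: "\<phi> \<in> tsp (E - F) V (Suc d) \<longleftrightarrow>
    (\<forall>j a. j \<notin> E - F \<longrightarrow> \<phi> (j, a) = 0) \<and> (\<forall>j\<in>E-F. (\<lambda>a. \<phi> (j, a)) \<in> V d)"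
  by (simp add: tsp_def)

lemma tsp_0: "\<phi> \<in> tsp (E - F) V 0 \<longleftrightarrow> \<phi> = (\<lambda>_. 0)"
  by (simp add: tsp_def)

lemma tmap_frsp:
  assumes "\<phi> \<in> tsp (E - F) (frsp E) d" shows "tmap \<phi> \<in> frsp E d"
proof (cases d)
  case 0
  then show ?thesis using assms by (simp add: tsp_0 linop_zero[OF linop_tmap] subsp_zero[OF subsp_frsp])
next
  case (Suc d')
  then show ?thesis using assms unfolding tmap_sum Suc
    by (intro subsp_sum[OF subsp_frsp] lw_frsp) (auto simp: tsp_Suc)
qed

lemma lw_kidl: "a \<in> E \<Longrightarrow> u \<in> kidl ext E RA d \<Longrightarrow> lw a (u :: nat list \<Rightarrow> 'k) \<in> kidl ext E RA (Suc d)"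
  unfolding kidl_didl by (rule lw_didl)

lemma rw_kidl: "r \<in> KP E RA \<Longrightarrow> u \<in> frsp E d \<Longrightarrow> rw r u \<in> kidl ext E RA (d + 2)"
  unfolding kidl_didl by (rule rw_didl[OF finE])

lemma tmap_kidl:
  assumes "\<phi> \<in> tsp (E - F) (kidl ext E RA) d" shows "tmap \<phi> \<in> kidl ext E RA d"
proof (cases d)
  case 0
  then show ?thesis using assms by (simp add: tsp_0 linop_zero[OF linop_tmap] subsp_zero[OF subsp_kidl])
next
  case (Suc d')
  then show ?thesis using assms unfolding tmap_sum Suc
    by (intro subsp_sum[OF subsp_kidl] lw_kidl) (auto simp: tsp_Suc)
qed

lemma restr_kidl: "kidl ext E RA d \<subseteq> {v. restr v \<in> kidl ext F RB d}"
  unfolding kidl_didl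
proof (rule didl_induct[of "\<lambda>d. {v. restr v \<in> didl F (KP F RB) d}"])
  show "subsp {v. restr v \<in> didl F (KP F RB) d}" for d
    by (rule subsp_vimage[OF subsp_didl linop_restr])
  show "rw r (bv b) \<in> {v. restr v \<in> didl F (KP F RB) (2 + length b)}" if "r \<in> KP E RA" "set b \<subseteq> E" for r b
  proof (cases "set b \<subseteq> F")
    case True
    then have "rw (restr r) (bv b) \<in> didl F (KP F RB) (length b + 2)"
      using that by (intro rw_didl[OF finF] KP_restr bv_frsp) (auto simp: words_def)
    then show ?thesis using True by (simp add: restr_rw_bv add.commute)
  qed (simp add: restr_rw_bv subsp_zero[OF subsp_didl])
  show "lw a u \<in> {v. restr v \<in> didl F (KP F RB) (Suc d)}" if "u \<in> {v. restr v \<in> didl F (KP F RB) d}" for a u d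
    using that by (simp add: restr_lw lw_didl subsp_zero[OF subsp_didl])
qed

lemma kidl_FE: "kidl ext F RB d \<subseteq> (kidl ext E RA d :: (nat list \<Rightarrow> 'k) set)"
  unfolding kidl_didl
proof (rule didl_induct[OF subsp_didl])
  show "rw r (bv b) \<in> didl E (KP E RA) (2 + length b)" if "r \<in> KP F RB" "set b \<subseteq> F" for r b
  proof -
    have "b \<in> words E (length b)" using that(2) FE by (auto simp: words_def)
    then have "rw r (bv b) \<in> didl E (KP E RA) (length b + 2)"
      using KP_FE that(1) by (intro rw_didl[OF finE] bv_frsp) auto
    then show ?thesis by (simp add: add.commute)
  qed
  show "lw a u \<in> didl E (KP E RA) (Suc d)" if "a \<in> F" "u \<in> didl E (KP E RA) d" for a u d
    using that FE by (intro lw_didl) auto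
qed

text \<open>Modulo relations, the right ideal generated by the letters outside F. Once it is closed
  under left multiplication by letters of F, it contains every word with a letter outside F.\<close>

definition right_ideal :: "nat \<Rightarrow> (nat list \<Rightarrow> 'k) set" where
  "right_ideal d = {v. \<exists>\<phi>\<in>tsp (E - F) (frsp E) d. (\<lambda>w. v w - tmap \<phi> w) \<in> kidl ext E RA d}"

lemma subsp_right_ideal: "subsp (right_ideal d)"
  unfolding subsp_def
proof (intro conjI allI ballI)
  have "(\<lambda>_. 0) \<in> tsp (E - F) (frsp E) d" by (rule subsp_zero[OF subsp_tsp[OF subsp_frsp]])
  then show "(\<lambda>_. 0) \<in> right_ideal d"
    unfolding right_ideal_def by (auto intro!: bexI simp: linop_zero[OF linop_tmap] subsp_zero[OF subsp_kidl])
  fix c u v assume "u \<in> right_ideal d" "v \<in> right_ideal d"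
  then obtain \<phi> \<phi>' where *: "\<phi> \<in> tsp (E - F) (frsp E) d" "(\<lambda>w. u w - tmap \<phi> w) \<in> kidl ext E RA d"
    "\<phi>' \<in> tsp (E - F) (frsp E) d" "(\<lambda>w. v w - tmap \<phi>' w) \<in> kidl ext E RA d"
    unfolding right_ideal_def by blast
  have "(\<lambda>w. c * (u w - tmap \<phi> w) + (v w - tmap \<phi>' w)) \<in> kidl ext E RA d"
    by (rule subspD[OF subsp_kidl *(2,4)])
  also have "(\<lambda>w. c * (u w - tmap \<phi> w) + (v w - tmap \<phi>' w))
      = (\<lambda>w. (c * u w + v w) - tmap (\<lambda>x. c * \<phi> x + \<phi>' x) w)"
    by (simp only: linopD[OF linop_tmap]) (simp add: algebra_simps)
  finally show "(\<lambda>w. c * u w + v w) \<in> right_ideal d"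
    unfolding right_ideal_def using subspD[OF subsp_tsp[OF subsp_frsp] *(1,3)] by blast
qed

lemma kidl_right_ideal:
  assumes "v \<in> kidl ext E RA d" shows "v \<in> right_ideal d"
proof -
  have "(\<lambda>_. 0) \<in> tsp (E - F) (frsp E) d" by (rule subsp_zero[OF subsp_tsp[OF subsp_frsp]])
  then show ?thesis
    unfolding right_ideal_def using assms by (auto intro!: bexI simp: linop_zero[OF linop_tmap])
qed

lemma tmap_right_ideal:
  assumes "v \<in> frsp E (Suc d)" "\<And>a w. a \<in> F \<Longrightarrow> v (a # w) = 0" shows "v \<in> right_ideal (Suc d)"
proof -
  define \<phi> where "\<phi> = (\<lambda>(j, w). if j \<in> E - F then v (j # w) else 0)"
  have "\<phi> \<in> tsp (E - F) (frsp E) (Suc d)"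
    using assms(1) by (auto simp: tsp_Suc \<phi>_def frsp_def)
  moreover have "v = tmap \<phi>"
    by (rule fun_list_eqI) (use assms in \<open>auto simp: \<phi>_def frsp_def\<close>)
  then have "(\<lambda>w. v w - tmap \<phi> w) \<in> kidl ext E RA (Suc d)" by (simp add: subsp_zero[OF subsp_kidl])
  ultimately show ?thesis unfolding right_ideal_def by blast
qed

text \<open>The relation of \<open>KP_res\<close> for the indicator of a has a single word with
  first letter in F, namely a m, with coefficient - s. Adding s times its product with u cancels
  every word that starts in F.\<close>

lemma lw_lw_right_ideal:
  assumes a: "a \<in> F" and m: "m \<in> E - F" and u: "u \<in> frsp E d"
  shows "lw a (lw m u) \<in> right_ideal (Suc (Suc d))"
proof -
  define r where "r = (\<lambda>w. if w \<in> words E 2 then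
      (if w ! 0 = m then kap m (w ! 1) * (if psi m (w ! 1) = a then 1 else 0) else 0)
      - s * (if w ! 1 = m then kap m (w ! 0) * (if psi m (w ! 0) = a then 1 else 0) else 0) else 0)"
  have r: "r \<in> KP E RA"
    unfolding r_def using KP_res[OF m, of "\<lambda>f. if f = a then 1 else 0"] by simp
  have rw: "rw r u \<in> kidl ext E RA (Suc (Suc d))" using rw_kidl[OF r u] by simp
  define z where "z = (\<lambda>w. lw a (lw m u) w + s * rw r u w)"
  have aE: "a \<in> E" using a FE by blast
  have "z \<in> right_ideal (Suc (Suc d))"
  proof (rule tmap_right_ideal)
    have "r \<in> frsp E 2" using r KP_frsp by blast
    then have "rw r u \<in> frsp E (Suc (Suc d))" using rw_frsp[of r E u d] u by simp
    then show "z \<in> frsp E (Suc (Suc d))"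
      unfolding z_def using aE m by (intro subsp_add[OF subsp_frsp] subsp_scale[OF subsp_frsp] lw_frsp u) auto
    fix b w assume b: "b \<in> F"
    then have bE: "b \<in> E" "b \<noteq> m" using m FE by auto
    show "z (b # w) = 0"
    proof (cases w)
      case (Cons c w')
      have "r [b, c] = - s * (if c = m \<and> b = a then 1 else 0)"
        using bE b m by (auto simp: r_def numeral_2_eq_2)
      then show ?thesis unfolding z_def Cons by auto
    qed (simp add: z_def)
  qed
  moreover have "(\<lambda>w. s * rw r u w) \<in> right_ideal (Suc (Suc d))"
    by (intro kidl_right_ideal subsp_scale[OF subsp_kidl] rw)
  ultimately have "(\<lambda>w. z w - s * rw r u w) \<in> right_ideal (Suc (Suc d))"
    by (rule subsp_diff[OF subsp_right_ideal])
  then show ?thesis by (simp add: z_def)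
qed

lemma lw_right_ideal:
  assumes a: "a \<in> F" and v: "v \<in> right_ideal d" shows "lw a v \<in> right_ideal (Suc d)"
proof -
  obtain \<phi> where \<phi>: "\<phi> \<in> tsp (E - F) (frsp E) d" "(\<lambda>w. v w - tmap \<phi> w) \<in> kidl ext E RA d"
    using v unfolding right_ideal_def by blast
  have "lw a (tmap \<phi>) \<in> right_ideal (Suc d)"
  proof (cases d)
    case 0
    then show ?thesis using \<phi>(1)
      by (simp add: tsp_0 linop_zero[OF linop_tmap] linop_zero[OF linop_lw] subsp_zero[OF subsp_right_ideal])
  next
    case (Suc d')
    have "lw a (\<lambda>w. \<Sum>j\<in>E-F. 1 * lw j (\<lambda>w. \<phi> (j, w)) w) \<in> right_ideal (Suc d)"
      unfolding linop_sum[OF linop_lw]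
      by (intro subsp_sum[OF subsp_right_ideal] subsp_scale[OF subsp_right_ideal])
         (use \<phi>(1) in \<open>auto simp: Suc tsp_Suc intro!: lw_lw_right_ideal[OF a]\<close>)
    then show ?thesis by (simp add: tmap_sum)
  qed
  moreover have "lw a (\<lambda>w. v w - tmap \<phi> w) \<in> right_ideal (Suc d)"
    using a FE \<phi>(2) by (intro kidl_right_ideal lw_kidl) auto
  ultimately have "(\<lambda>w. lw a (tmap \<phi>) w + lw a (\<lambda>w. v w - tmap \<phi> w) w) \<in> right_ideal (Suc d)"
    by (rule subsp_add[OF subsp_right_ideal])
  then show ?thesis by (simp add: linop_diff[OF linop_lw])
qed

lemma word_right_ideal: "w \<in> words E d \<Longrightarrow> \<not> set w \<subseteq> F \<Longrightarrow> bv w \<in> right_ideal d"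
proof (induction w arbitrary: d)
  case (Cons a w)
  then obtain d' where d: "d = Suc d'" "a \<in> E" "w \<in> words E d'" by auto
  show ?case
  proof (cases "a \<in> F")
    case True
    then have "bv w \<in> right_ideal d'" using Cons d by auto
    from lw_right_ideal[OF True this] show ?thesis by (simp add: lw_bv d(1))
  next
    case False
    have "bv (a # w) \<in> frsp E (Suc d')" using d by (intro bv_frsp) auto
    then show ?thesis unfolding d(1) using False by (intro tmap_right_ideal) (auto simp: bv_def)
  qed
qed simp

text \<open>v minus its restriction is a combination of words with a letter outside F, all of which
  lie in \<open>right_ideal\<close>; the restriction is absorbed by \<open>kidl_FE\<close>.\<close>

lemma restr_kidl_iff:
  assumes v: "v \<in> frsp E d"
  shows "restr v \<in> kidl ext F RB d \<longleftrightarrow>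
    (\<exists>\<phi>\<in>tsp (E - F) (frsp E) d. (\<lambda>w. v w - tmap \<phi> w) \<in> kidl ext E RA d)"
proof
  assume r: "restr v \<in> kidl ext F RB d"
  have "(\<lambda>w. v w - restr v w) \<in> right_ideal d"
  proof (rule lspan_bv[OF _ _ word_right_ideal subsp_right_ideal])
    let ?A = "{w \<in> words E d. \<not> set w \<subseteq> F}"
    show "finite ?A" using finite_words[OF finE] by simp
    show "w \<in> ?A" if "v w - restr v w \<noteq> 0" for w
      using that frspD[OF v, of w] by (auto simp: restr_def split: if_splits)
  qed auto
  moreover have "restr v \<in> right_ideal d" using r kidl_FE kidl_right_ideal by blast
  ultimately have "(\<lambda>w. (v w - restr v w) + restr v w) \<in> right_ideal d"
    by (rule subsp_add[OF subsp_right_ideal])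
  then show "\<exists>\<phi>\<in>tsp (E - F) (frsp E) d. (\<lambda>w. v w - tmap \<phi> w) \<in> kidl ext E RA d"
    by (simp add: right_ideal_def)
next
  assume "\<exists>\<phi>\<in>tsp (E - F) (frsp E) d. (\<lambda>w. v w - tmap \<phi> w) \<in> kidl ext E RA d"
  then obtain \<phi> where "(\<lambda>w. v w - tmap \<phi> w) \<in> kidl ext E RA d" by blast
  then have "restr (\<lambda>w. v w - tmap \<phi> w) \<in> kidl ext F RB d" using restr_kidl by blast
  then show "restr v \<in> kidl ext F RB d" by (simp add: linop_diff[OF linop_restr] restr_tmap)
qed

end

section \<open>Freeness over the dual of the restriction\<close>

context fibration
begin

text \<open>A word starting with \<open>m\<close> outside \<open>F\<close> contributes its tail to the \<open>m\<close>-component; a letter of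
  \<open>F\<close> in front is commuted past the letters outside \<open>F\<close> by the relations of \<open>KP_res\<close>.
  The component of index \<open>m\<close> is the coefficient of \<open>t\<^sub>m\<close> in the normal form of \<open>v\<close>.\<close>

primrec der_at :: "nat list \<Rightarrow> (nat list \<Rightarrow> 'k) \<Rightarrow> nat \<Rightarrow> 'k" where
  "der_at [] v m = v [m]"
| "der_at (b # w) v m = v (m # b # w) + s * kap m b * der_at w (\<lambda>x. v (psi m b # x)) m
     - (if b \<in> E - F then kap b m * der_at w (\<lambda>x. v (psi b m # x)) b else 0)"

definition der :: "nat \<Rightarrow> (nat list \<Rightarrow> 'k) \<Rightarrow> nat list \<Rightarrow> 'k" where
  "der m v = (\<lambda>w. der_at w v m)"

lemma der_simps [simp]:
  "der m v [] = v [m]"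
  "der m v (b # w) = v (m # b # w) + s * kap m b * der m (\<lambda>x. v (psi m b # x)) w
     - (if b \<in> E - F then kap b m * der b (\<lambda>x. v (psi b m # x)) w else 0)"
  by (simp_all add: der_def)

lemma der_linear: "der m (\<lambda>x. c * u x + v x) w = c * der m u w + der m v w"
proof (induction w arbitrary: m u v)
  case (Cons b w)
  show ?case unfolding der_simps Cons by (simp add: algebra_simps)
qed simp

lemma linop_der: "linop (der m)"
  unfolding linop_def by (simp add: der_linear fun_eq_iff)

lemma der_support: "v \<in> frsp E e \<Longrightarrow> der m v w \<noteq> 0 \<Longrightarrow> set w \<subseteq> E \<and> Suc (length w) = e"
proof (induction w arbitrary: v e m)
  case Nil
  then have "[m] \<in> words E e" using frspD[of v E e "[m]"] by auto
  then show ?case by auto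
next
  case (Cons b w)
  have tail: "(\<lambda>x. v (y # x)) \<in> frsp E (e - 1)" for y
  proof (rule frspI)
    fix w assume "v (y # w) \<noteq> 0"
    then have "y # w \<in> words E e" using frspD[OF Cons.prems(1)] by blast
    then show "w \<in> words E (e - 1)" by auto
  qed
  consider "v (m # b # w) \<noteq> 0" | "kap m b \<noteq> 0" "der m (\<lambda>x. v (psi m b # x)) w \<noteq> 0"
    | "b \<in> E" "der b (\<lambda>x. v (psi b m # x)) w \<noteq> 0"
    using Cons.prems(2) by (fastforce split: if_splits)
  then show ?case
  proof cases
    case 1
    then have "m # b # w \<in> words E e" using frspD[OF Cons.prems(1)] by blast
    then show ?thesis by (auto simp: words_def)
  next
    case 2
    then have "b \<in> E" using kap_outside by blast
    then show ?thesis using Cons.IH[OF tail 2(2)] by auto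
  next
    case 3
    then show ?thesis using Cons.IH[OF tail 3(2)] by auto
  qed
qed

lemma der_frsp:
  assumes "v \<in> frsp E (Suc d)" shows "der m v \<in> frsp E d"
  by (rule frspI) (use der_support[OF assms] in \<open>auto simp: words_def\<close>)

lemma der_zero: "der m (\<lambda>_. 0) = (\<lambda>_. 0)"
  by (rule linop_zero[OF linop_der])

lemma tail_lw: "(\<lambda>x. lw c v (y # x)) = (if y = c then v else (\<lambda>_. 0))"
  by auto

text \<open>All terms except the leading one read the argument at words that start in F, where
  \<open>lw c v\<close> vanishes.\<close>

lemma der_lw_out:
  assumes m: "m \<in> E - F" and c: "c \<in> E - F"
  shows "der m (lw c v) = (if c = m then v else (\<lambda>_. 0))"
proof (rule fun_list_eqI)
  fix b w
  have A: "kap m b * der m (\<lambda>x. lw c v (psi m b # x)) w = 0"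
  proof (cases "kap m b = 0")
    case False
    then have "b \<in> E" "b \<noteq> m" using kap_outside m by auto
    then have "psi m b \<noteq> c" using psi_F[OF m] c by auto
    then show ?thesis by (simp add: der_zero)
  qed simp
  have B: "kap b m * der b (\<lambda>x. lw c v (psi b m # x)) w = 0" if b: "b \<in> E - F"
  proof (cases "m = b")
    case False
    then have "psi b m \<noteq> c" using psi_F[OF b, of m] m c by auto
    then show ?thesis by (simp add: der_zero)
  qed (use b in simp)
  have "der m (lw c v) (b # w) = lw c v (m # b # w)"
    unfolding der_simps mult.assoc A using B by (cases "b \<in> E - F") (simp_all only: if_True if_False, simp_all)
  then show "der m (lw c v) (b # w) = (if c = m then v else (\<lambda>_. 0)) (b # w)"
    by auto
qed auto

text \<open>The rewriting rule behind \<open>der\<close>: the relation of \<open>KP_res\<close> for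
  the indicator of f turns y_f y_p into the sum over b with \<open>psi p b = f\<close> of s
  \<open>kap p b\<close> y_p y_b, minus the sum over such b outside F of \<open>kap p b\<close> y_b
  y_p. The m-component receives the first kind from p = m, and the second from p equal to the letter
  that follows m.\<close>

lemma der_lw_in:
  assumes m: "m \<in> E - F" and f: "f \<in> F"
  shows "der m (lw f v) = (\<lambda>w. \<Sum>b\<in>E. lw b (\<lambda>w. s * kap m b * (if psi m b = f then 1 else 0) * der m v w
    - (if b \<in> E - F \<and> psi b m = f then kap b m else 0) * der b v w) w)"
proof (rule fun_list_eqI)
  have "m \<noteq> f" using m f by auto
  then show "der m (lw f v) [] = (\<Sum>b\<in>E. lw b (\<lambda>w. s * kap m b * (if psi m b = f then 1 else 0) * der m v w
    - (if b \<in> E - F \<and> psi b m = f then kap b m else 0) * der b v w) [])" by simp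
  fix c w
  let ?G = "\<lambda>b w. s * kap m b * (if psi m b = f then 1 else 0) * der m v w
    - (if b \<in> E - F \<and> psi b m = f then kap b m else 0) * der b v w"
  have "(\<Sum>b\<in>E. lw b (?G b) (c # w)) = (\<Sum>b\<in>E. if b = c then ?G c w else 0)"
    by (rule sum.cong) auto
  also have "\<dots> = (if c \<in> E then ?G c w else 0)" using finE by simp
  also have "\<dots> = der m (lw f v) (c # w)"
    using kap_outside[of c m] \<open>m \<noteq> f\<close> by (auto simp: tail_lw der_zero)
  finally show "der m (lw f v) (c # w) = (\<Sum>b\<in>E. lw b (?G b) (c # w))" by simp
qed

lemma psi_sym:
  assumes "m \<in> E - F" "a \<in> E - F" "m \<noteq> a" shows "psi a m = psi m a"
  by (rule line_circuit[OF assms])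

text \<open>In the generic case this is \<open>KP_line\<close> for the pullback of \<open>u\<close> along the projection from \<open>c\<close>,
  on the line through \<open>m\<close> and \<open>b\<close>.\<close>

lemma kap_psi_exchange:
  assumes u: "u \<in> KP E RA" and m: "m \<in> E - F" and c: "c \<in> E - F" "c \<noteq> m"
  shows "- s * kap m b * kap c m * u [psi m b, psi m c]
      + (if b \<in> E - F then kap b m * kap c b * u [psi b m, psi c b] else 0)
    = kap c m * kap c b * u [psi c m, psi c b]"
proof -
  have q: "psi m c = psi c m" "psi c m \<in> F"
    using psi_sym[OF c(1) m c(2)] psi_F[OF c(1), of m] c(2) m by simp_all
  have sw: "u [x, y] = - s * u [y, x]" "u [x, x] = 0" if "x \<in> F" "y \<in> F" for x y
  proof -
    have "x \<in> E" "y \<in> E" using that FE by auto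
    then show "u [x, y] = - s * u [y, x]" "u [x, x] = 0" by (rule KP_swap[OF finE u])+
  qed
  consider "b \<notin> E" | "b \<in> F" | "b = m" | "b = c" | "b \<in> E - F" "b \<noteq> m" "b \<noteq> c" by blast
  then show ?thesis
  proof cases
    case 1
    then show ?thesis by (simp add: kap_outside)
  next
    case 2
    then show ?thesis using sw(1)[OF 2 q(2)] q(1) by simp
  next
    case 3
    then show ?thesis using m q sw(2) by simp
  next
    case 4
    then show ?thesis using c q sw(2) by simp
  next
    case 5
    let ?f = "psi m b"
    have f: "?f \<in> F" "psi b m = ?f" using psi_F[OF m, of b] psi_sym[OF m 5(1)] 5 by auto
    have pb: "psi c b \<in> F" using psi_F[OF c(1), of b] 5 by auto
    have u': "pull c (restr u) \<in> KP E RA" by (rule KP_pull[OF KP_restr[OF u] c(1)])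
    have pull: "pull c (restr u) [x, y] = kap c x * kap c y * u [psi c x, psi c y]"
      if "x \<in> E" "y \<in> E" "x \<noteq> c" "y \<noteq> c" for x y
      using that psi_F[OF c(1)] by (simp add: pull_def restr_def numeral_2_eq_2)
    have fE: "?f \<in> E" "?f \<noteq> c" using f FE c by auto
    have "kap c m * kap c b * u [psi c m, psi c b]
      = kap m b * (kap c m * u [psi c m, ?f]) - s * kap b m * (kap c b * u [psi c b, ?f])"
      using KP_line[OF u' m 5(1) 5(2)[symmetric]] m 5 c fE f(1) by (simp add: pull)
    then show ?thesis
      using 5(1) sw(1)[OF q(2) f(1)] sw(1)[OF pb f(1)] q(1) f(2) by (simp add: algebra_simps)
  qed
qed

text \<open>This is the total coefficient with which \<open>\<psi>\<close> itself, untouched by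
  \<open>der\<close>, would occur in \<open>der m (rw u \<psi>)\<close>. For two distinct outside
  letters it vanishes by \<open>KP_line\<close> and the swap rule.\<close>

lemma KP_leading:
  assumes u: "u \<in> KP E RA" and m: "m \<in> E - F"
  shows "u [m, b] + s * kap m b * u [psi m b, m] - (if b \<in> E - F then kap b m * u [psi b m, b] else 0) = 0"
proof -
  have mE: "m \<in> E" using m by simp
  consider "b \<notin> E" | "b \<in> F" | "b = m" | "b \<in> E - F" "b \<noteq> m" by blast
  then show ?thesis
  proof cases
    case 1
    have "u \<in> frsp E 2" using u KP_frsp by blast
    then have "u [m, b] = 0" using 1 by (intro frspD[of u E 2]) (auto simp: numeral_2_eq_2)
    then show ?thesis using 1 by (simp add: kap_outside)
  next
    case 2
    then have "b \<in> E" using FE by blast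
    then have "u [b, m] = - s * u [m, b]" by (rule KP_swap(1)[OF finE u _ mE])
    then show ?thesis using 2 by simp
  next
    case 3
    then show ?thesis using m KP_swap(2)[OF finE u mE mE] by simp
  next
    case 4
    have f: "psi m b \<in> E" "psi b m = psi m b"
      using psi_F[OF m, of b] psi_sym[OF m 4(1)] 4 FE by auto
    show ?thesis
      using 4 KP_line[OF u m 4(1) 4(2)[symmetric]] KP_swap(1)[OF finE u f(1) mE] f(2)
        KP_swap(1)[OF finE u f(1), of b] by (simp add: algebra_simps)
  qed
qed

text \<open>The instance of \<open>KP_res\<close> at p whose values on words starting with p are the
  coefficients that \<open>der m\<close> produces in front of \<open>der p \<psi>\<close>.\<close>

definition moved :: "(nat list \<Rightarrow> 'k) \<Rightarrow> nat \<Rightarrow> nat \<Rightarrow> nat list \<Rightarrow> 'k" where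
  "moved u m p = (\<lambda>w. if w \<in> words E 2 then
      (if w ! 0 = p then kap p (w ! 1) * (- s * kap p m * u [psi p m, psi p (w ! 1)]) else 0)
      - s * (if w ! 1 = p then kap p (w ! 0) * (- s * kap p m * u [psi p m, psi p (w ! 0)]) else 0) else 0)"

lemma KP_moved: "p \<in> E - F \<Longrightarrow> moved u m p \<in> KP E RA"
  unfolding moved_def using KP_res[of p "\<lambda>f. - s * kap p m * u [psi p m, f]"] by simp

text \<open>The reason why \<open>der\<close> descends to the dual algebra: a relation times
  \<open>\<psi>\<close> goes to a sum of relations times components of \<open>\<psi>\<close>. On
  words b c w the coefficients of the components with index m, b and c are matched
  separately.\<close>

lemma der_rw:
  assumes u: "u \<in> KP E RA" and m: "m \<in> E - F"
  shows "der m (rw u \<psi>) = (\<lambda>w. rw (pull m u) (der m \<psi>) w + (\<Sum>p\<in>E-F-{m}. rw (moved u m p) (der p \<psi>) w))"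
proof (rule fun_list2_eqI)
  have uE: "u [x, y] = 0" if "x \<notin> E \<or> y \<notin> E" for x y
    using u KP_frsp that by (intro frspD[of u E 2]) (auto simp: numeral_2_eq_2)
  have lead: "u [m, b] * c + s * kap m b * (u [psi m b, m] * c)
      - (if b \<in> E - F then kap b m * (u [psi b m, b] * c) else 0) = 0" for b c
  proof -
    have "(u [m, b] + s * kap m b * u [psi m b, m] - (if b \<in> E - F then kap b m * u [psi b m, b] else 0)) * c = 0"
      using KP_leading[OF u m, of b] by simp
    then show ?thesis
      by (cases "b \<in> E - F") (simp_all only: if_True if_False, simp_all add: algebra_simps)
  qed
  show "der m (rw u \<psi>) [] = rw (pull m u) (der m \<psi>) [] + (\<Sum>p\<in>E-F-{m}. rw (moved u m p) (der p \<psi>) [])"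
    by simp
  show "der m (rw u \<psi>) [b] = rw (pull m u) (der m \<psi>) [b] + (\<Sum>p\<in>E-F-{m}. rw (moved u m p) (der p \<psi>) [b])" for b
    using lead[of b "\<psi> []"] by simp
  fix b c w
  let ?D = "\<lambda>p. der p \<psi> w"
  have L: "der m (rw u \<psi>) (b # c # w)
    = s * kap m b * (s * kap m c * (u [psi m b, psi m c] * ?D m)
        - (if c \<in> E - F then kap c m * (u [psi m b, psi c m] * ?D c) else 0))
    - (if b \<in> E - F then kap b m * (s * kap b c * (u [psi b m, psi b c] * ?D b)
        - (if c \<in> E - F then kap c b * (u [psi b m, psi c b] * ?D c) else 0)) else 0)"
  proof -
    have d: "der p (\<lambda>x. rw u \<psi> (y # x)) (c # w) = u [y, p] * \<psi> (c # w)
        + s * kap p c * (u [y, psi p c] * ?D p)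
        - (if c \<in> E - F then kap c p * (u [y, psi c p] * ?D c) else 0)" for p y
      by (simp add: linop_scale[OF linop_der])
    show ?thesis
      unfolding der_simps(2)[of m "rw u \<psi>" b] d
      using lead[of b "\<psi> (c # w)"]
      by (cases "b \<in> E - F"; cases "c \<in> E - F") (simp_all only: if_True if_False, simp_all add: algebra_simps)
  qed
  have S: "(\<Sum>p\<in>E-F-{m}. rw (moved u m p) (der p \<psi>) (b # c # w))
    = (if b \<in> E - F - {m} \<and> c \<in> E then - s * kap b m * kap b c * u [psi b m, psi b c] * ?D b else 0)
      + (if c \<in> E - F - {m} \<and> b \<in> E then kap c m * kap c b * u [psi c m, psi c b] * ?D c else 0)"
  proof -
    have "(\<Sum>p\<in>E-F-{m}. rw (moved u m p) (der p \<psi>) (b # c # w))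
      = (\<Sum>p\<in>E-F-{m}. (if p = b then if c \<in> E then - s * kap b m * kap b c * u [psi b m, psi b c] * ?D b else 0 else 0)
        + (if p = c then if b \<in> E then kap c m * kap c b * u [psi c m, psi c b] * ?D c else 0 else 0))"
      by (rule sum.cong) (auto simp: moved_def numeral_2_eq_2 algebra_simps)
    also have "\<dots> = (if b \<in> E - F - {m} then if c \<in> E then - s * kap b m * kap b c * u [psi b m, psi b c] * ?D b else 0 else 0)
      + (if c \<in> E - F - {m} then if b \<in> E then kap c m * kap c b * u [psi c m, psi c b] * ?D c else 0 else 0)"
      unfolding sum.distrib using finE by (simp only: sum.delta finite_Diff)
    finally show ?thesis by simp
  qed
  have P: "rw (pull m u) (der m \<psi>) (b # c # w) = kap m b * kap m c * u [psi m b, psi m c] * ?D m"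
    using kap_outside[of b m] kap_outside[of c m] by (auto simp: pull_def numeral_2_eq_2)
  \<comment> \<open>The coefficient of the c-component. For c different from m this is
    \<open>kap_psi_exchange\<close>; for c = m the right side vanishes, because u is then evaluated
    on a repeated letter or a factor \<open>kap\<close> is zero.\<close>
  have X: "(if c \<in> E - F - {m} \<and> b \<in> E then kap c m * kap c b * u [psi c m, psi c b] * ?D c else 0)
    = (if c \<in> E - F then - s * kap m b * kap c m * u [psi m b, psi m c] * ?D c
        + (if b \<in> E - F then kap b m * kap c b * u [psi b m, psi c b] * ?D c else 0) else 0)"
  proof (cases "c \<in> E - F - {m}")
    case True
    then have c: "c \<in> E - F" "c \<noteq> m" by auto
    have "(if b \<in> E then kap c m * kap c b * u [psi c m, psi c b] * ?D c else 0)
        = (kap c m * kap c b * u [psi c m, psi c b]) * ?D c"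
      using kap_outside[of b c] by simp
    also have "\<dots> = (- s * kap m b * kap c m * u [psi m b, psi m c]
      + (if b \<in> E - F then kap b m * kap c b * u [psi b m, psi c b] else 0)) * ?D c"
      unfolding kap_psi_exchange[OF u m c] ..
    finally show ?thesis using True
      by (cases "b \<in> E - F"; cases "b \<in> E")
         (simp_all only: c if_True if_False simp_thms, simp_all add: algebra_simps)
  next
    case False
    show ?thesis
    proof (cases "c = m \<and> b \<in> E - F \<and> b \<noteq> m")
      case True
      then have "psi m b = psi b m" "psi b m \<in> E" using psi_sym[of b m] psi_F[of b m] m FE by auto
      then show ?thesis using True m KP_swap(2)[OF finE u] by simp
    next
      case F: False
      then show ?thesis using False m by auto
    qed
  qed
  have psi_c: "psi c m = psi m c" if "c \<in> E - F"
    using that psi_sym[OF m that] by (cases "c = m") auto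
  have Y: "(if b \<in> E - F - {m} \<and> c \<in> E then - s * kap b m * kap b c * u [psi b m, psi b c] * ?D b else 0)
    = (if b \<in> E - F then - s * kap b m * kap b c * u [psi b m, psi b c] * ?D b else 0)"
    using m kap_outside[of c b] by auto
  show "der m (rw u \<psi>) (b # c # w) = rw (pull m u) (der m \<psi>) (b # c # w)
      + (\<Sum>p\<in>E-F-{m}. rw (moved u m p) (der p \<psi>) (b # c # w))"
    unfolding L P S X Y using psi_c
    by (cases "b \<in> E - F"; cases "c \<in> E - F") (simp_all only: if_True if_False, simp_all add: algebra_simps)
qed

text \<open>\<open>pull m\<close> reads u on letters of F only, except in terms with the zero factor
  \<open>kap m m\<close>. A relation of A can therefore be fed to \<open>KP_pull\<close> after
  restriction.\<close>

lemma pull_restr: "m \<in> E - F \<Longrightarrow> pull m (restr u) = pull m u"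
proof
  fix x assume m: "m \<in> E - F"
  show "pull m (restr u) x = pull m u x"
  proof (cases "x \<in> words E 2")
    case True
    then obtain a b where x: "x = [a, b]" "a \<in> E" "b \<in> E" by (rule words2E)
    show ?thesis
      using True m psi_F[OF m, of a] psi_F[OF m, of b] x
      by (cases "a = m \<or> b = m") (auto simp: pull_def restr_def)
  qed (simp add: pull_def)
qed

text \<open>Membership of v itself is part of the induction, because \<open>der m\<close> of y_m u
  is u. In degree 0 the truncated \<open>d - 1\<close> does no harm: the ideal is zero
  there.\<close>

lemma der_kidl: "kidl ext E RA d \<subseteq> {v. \<forall>m\<in>E-F. der m v \<in> kidl ext E RA (d - 1)}"
proof -
  let ?K = "\<lambda>d. kidl ext E RA d :: (nat list \<Rightarrow> 'k) set"
  have "didl E (KP E RA) d \<subseteq> {v. \<forall>m\<in>E-F. der m v \<in> ?K (d - 1)} \<inter> ?K d"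
  proof (rule didl_induct[of "\<lambda>d. {v. \<forall>m\<in>E-F. der m v \<in> ?K (d - 1)} \<inter> ?K d"])
    show "subsp ({v. \<forall>m\<in>E-F. der m v \<in> ?K (d - 1)} \<inter> ?K d)" for d
      by (rule subsp_Int[OF _ subsp_kidl], unfold subsp_def)
         (simp add: der_zero linopD[OF linop_der] subspD[OF subsp_kidl] subsp_zero[OF subsp_kidl])
    fix r :: "nat list \<Rightarrow> 'k" and b assume r: "r \<in> KP E RA" "set b \<subseteq> E"
    have b: "bv b \<in> frsp E (length b)" using r(2) by (intro bv_frsp) (auto simp: words_def)
    have "der m (rw r (bv b)) \<in> ?K (2 + length b - 1)" if m: "m \<in> E - F" for m
    proof (cases "length b")
      case 0
      \<comment> \<open>\<open>der\<close> has no letter to remove in degree 0, so it vanishes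
        there.\<close>
      have z: "der p (bv b) = (\<lambda>_. 0)" for p
        using der_support[OF b] 0 by (metis HOL.ext nat.distinct(1))
      show ?thesis unfolding der_rw[OF r(1) m] z
        by (simp add: linop_zero[OF linop_rw] subsp_zero[OF subsp_kidl])
    next
      case (Suc e)
      have "pull m r \<in> KP E RA"
        using KP_pull[OF KP_restr[OF r(1)] m] by (simp add: pull_restr[OF m])
      moreover have "der p (bv b) \<in> frsp E e" for p using b Suc by (intro der_frsp) simp
      ultimately have "(\<lambda>w. rw (pull m r) (der m (bv b)) w
        + (\<Sum>p\<in>E-F-{m}. rw (moved r m p) (der p (bv b)) w)) \<in> ?K (e + 2)"
        by (intro subsp_add[OF subsp_kidl] subsp_sum[OF subsp_kidl] rw_kidl KP_moved) auto
      then show ?thesis unfolding der_rw[OF r(1) m] using Suc by simp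
    qed
    moreover have "rw r (bv b) \<in> ?K (2 + length b)"
      using rw_kidl[OF r(1) b] by (simp add: add.commute)
    ultimately show "rw r (bv b) \<in> {v. \<forall>m\<in>E-F. der m v \<in> ?K (2 + length b - 1)} \<inter> ?K (2 + length b)"
      by blast
  next
    fix a d and u :: "nat list \<Rightarrow> 'k"
    assume a: "a \<in> E" and "u \<in> {v. \<forall>m\<in>E-F. der m v \<in> ?K (d - 1)} \<inter> ?K d"
    then have u: "\<And>m. m \<in> E - F \<Longrightarrow> der m u \<in> ?K (d - 1)" "u \<in> ?K d" by auto
    have "der m (lw a u) \<in> ?K d" if m: "m \<in> E - F" for m
    proof (cases "a \<in> F")
      case False
      then show ?thesis using a m u(2) by (simp add: der_lw_out subsp_zero[OF subsp_kidl])
    next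
      case True
      show ?thesis
      proof (cases d)
        case 0
        have "?K 0 \<subseteq> {\<lambda>_. 0}"
          unfolding kidl_didl didl_def by (rule lspan_minimal) (auto simp: subsp_def)
        then have "u = (\<lambda>_. 0)" using u(2) 0 by blast
        then show ?thesis by (simp add: linop_zero[OF linop_lw] der_zero subsp_zero[OF subsp_kidl])
      next
        case (Suc d')
        have t: "(\<lambda>w. s * kap m b * (if psi m b = a then 1 else 0) * der m u w
            - (if b \<in> E - F \<and> psi b m = a then kap b m else 0) * der b u w) \<in> ?K d'" for b
        proof (cases "b \<in> E - F")
          case True
          then show ?thesis using u(1) m Suc
            by (intro subsp_diff[OF subsp_kidl] subsp_scale[OF subsp_kidl]) auto
        next
          case False
          then have "(\<lambda>w. s * kap m b * (if psi m b = a then 1 else 0) * der m u w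
            - (if b \<in> E - F \<and> psi b m = a then kap b m else 0) * der b u w)
            = (\<lambda>w. s * kap m b * (if psi m b = a then 1 else 0) * der m u w)" by auto
          then show ?thesis using u(1)[OF m] Suc subsp_scale[OF subsp_kidl] by simp
        qed
        show ?thesis unfolding der_lw_in[OF m True] Suc
          by (intro subsp_sum[OF subsp_kidl] lw_kidl t)
      qed
    qed
    then show "lw a u \<in> {v. \<forall>m\<in>E-F. der m v \<in> ?K (Suc d - 1)} \<inter> ?K (Suc d)"
      using lw_kidl[OF a u(2)] by simp
  qed
  then show ?thesis unfolding kidl_didl by blast
qed

lemma der_tmap:
  assumes m: "m \<in> E - F" shows "der m (tmap \<phi>) = (\<lambda>w. \<phi> (m, w))"
proof
  fix w
  have "der m (\<lambda>w. \<Sum>j\<in>E-F. 1 * lw j (\<lambda>w. \<phi> (j, w)) w) w = (\<Sum>j\<in>E-F. 1 * der m (lw j (\<lambda>w. \<phi> (j, w))) w)"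
    unfolding linop_sum[OF linop_der] ..
  also have "\<dots> = (\<Sum>j\<in>E-F. if j = m then \<phi> (m, w) else 0)"
    by (rule sum.cong) (auto simp: der_lw_out[OF m])
  finally show "der m (tmap \<phi>) w = \<phi> (m, w)" using m finE by (simp add: tmap_sum)
qed

lemma ses_dual:
  "ses (tsp (E - F) (frsp E) d) (tsp (E - F) (kidl ext E RA) d) (frsp E d) (kidl ext E RA d)
     (frsp F d) (kidl ext F RB d) tmap restr"
  unfolding ses_def
proof (intro conjI ballI impI)
  show "lin_map (tsp (E - F) (frsp E) d) (frsp E d) tmap"
    unfolding lin_map_def using tmap_frsp linopD[OF linop_tmap] by blast
  show "lin_map (frsp E d) (frsp F d) restr"
    unfolding lin_map_def using restr_frsp linopD[OF linop_restr] by blast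
  show "tmap ` tsp (E - F) (kidl ext E RA) d \<subseteq> kidl ext E RA d"
    using tmap_kidl by blast
  show "restr ` kidl ext E RA d \<subseteq> kidl ext F RB d"
    using restr_kidl by blast
  show "\<phi> \<in> tsp (E - F) (kidl ext E RA) d"
    if "\<phi> \<in> tsp (E - F) (frsp E) d" "tmap \<phi> \<in> kidl ext E RA d" for \<phi> :: "nat \<times> nat list \<Rightarrow> 'k"
  proof (cases d)
    case 0
    then show ?thesis using that(1) by (simp add: tsp_0)
  next
    case (Suc d')
    have "(\<lambda>w. \<phi> (m, w)) \<in> kidl ext E RA d'" if "m \<in> E - F" for m
      using subsetD[OF der_kidl \<open>tmap \<phi> \<in> kidl ext E RA d\<close>] that Suc by (auto simp: der_tmap)
    then show ?thesis using that(1) Suc by (simp add: tsp_Suc)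
  qed
  show "restr v \<in> kidl ext F RB d \<longleftrightarrow> (\<exists>\<phi>\<in>tsp (E - F) (frsp E) d. (\<lambda>w. v w - tmap \<phi> w) \<in> kidl ext E RA d)"
    if "v \<in> frsp E d" for v :: "nat list \<Rightarrow> 'k"
    by (rule restr_kidl_iff[OF that])
  show "\<exists>v\<in>frsp E d. (\<lambda>x. restr v x - w x) \<in> kidl ext F RB d" if w: "w \<in> frsp F d" for w :: "nat list \<Rightarrow> 'k"
  proof
    show "w \<in> frsp E d" using w frsp_FE by blast
    show "(\<lambda>x. restr w x - w x) \<in> kidl ext F RB d"
      by (simp add: restr_F[OF w] subsp_zero[OF subsp_kidl])
  qed
qed

section \<open>Equivariance on words\<close>

lemma act_word_Cons:
  "act_word E' g (u :: nat list \<Rightarrow> 'k) (k # w)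
    = (\<Sum>j\<in>E'. if fst g j = k then sg (snd g j) * act_word E' g (\<lambda>x. u (j # x)) w else 0)"
proof -
  have "words E' (Suc (length w)) = (\<lambda>(j, x). j # x) ` (E' \<times> words E' (length w))"
    by (auto simp: words_def length_Suc_conv image_iff)
  moreover have "inj_on (\<lambda>(j, x). j # x) (E' \<times> words E' (length w))"
    by (auto simp: inj_on_def)
  ultimately have "act_word E' g u (k # w) = (\<Sum>(j, x)\<in>E' \<times> words E' (length w).
      if fst g j = k \<and> map (fst g) x = w then sg (snd g j) * prod_list (map (\<lambda>i. sg (snd g i)) x) * u (j # x) else 0)"
    unfolding act_word_def by (simp add: sum.reindex case_prod_unfold o_def cong: if_cong)
  also have "\<dots> = (\<Sum>j\<in>E'. \<Sum>x\<in>words E' (length w).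
      if fst g j = k \<and> map (fst g) x = w then sg (snd g j) * prod_list (map (\<lambda>i. sg (snd g i)) x) * u (j # x) else 0)"
    by (rule sum.cartesian_product[symmetric])
  also have "\<dots> = (\<Sum>j\<in>E'. if fst g j = k then sg (snd g j) * act_word E' g (\<lambda>x. u (j # x)) w else 0)"
    unfolding act_word_def by (intro sum.cong) (auto simp: sum_distrib_left mult.assoc intro!: sum.cong)
  finally show ?thesis .
qed

lemma equivar_tmap:
  assumes H: "\<And>h. h \<in> H \<Longrightarrow> aut h"
  shows "equivar (tsp (E - F) (frsp E) d) (kidl ext E RA d) tmap (act_tensor (E - F) (act_word E)) (act_word E) H"
  unfolding equivar_def
proof (intro ballI)
  fix h and \<phi> :: "nat \<times> nat list \<Rightarrow> 'k" assume h: "h \<in> H"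
  have zero: "act_word E h (\<lambda>_. 0) w = (0 :: 'k)" for w by (simp add: act_word_def cong: if_cong)
  have "tmap (act_tensor (E - F) (act_word E) h \<phi>) = act_word E h (tmap \<phi>)"
  proof (rule fun_list_eqI)
    show "tmap (act_tensor (E - F) (act_word E) h \<phi>) [] = act_word E h (tmap \<phi>) []"
      by (simp add: act_word_def words_def cong: if_cong)
    fix k w
    have "act_word E h (tmap \<phi>) (k # w) = (\<Sum>j\<in>E. if j \<in> E - F
        then if fst h j = k then sg (snd h j) * act_word E h (\<lambda>x. \<phi> (j, x)) w else 0 else 0)"
      unfolding act_word_Cons by (rule sum.cong) (auto simp: zero)
    also have "\<dots> = (\<Sum>j\<in>E-F. if fst h j = k then sg (snd h j) * act_word E h (\<lambda>x. \<phi> (j, x)) w else 0)"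
      by (rule sum.mono_neutral_cong_right[OF finE]) auto
    finally have *: "act_word E h (tmap \<phi>) (k # w)
      = (\<Sum>j\<in>E-F. if fst h j = k then sg (snd h j) * act_word E h (\<lambda>x. \<phi> (j, x)) w else 0)" .
    show "tmap (act_tensor (E - F) (act_word E) h \<phi>) (k # w) = act_word E h (tmap \<phi>) (k # w)"
    proof (cases "k \<in> E - F")
      case True
      then show ?thesis unfolding * by (simp add: act_tensor_def)
    next
      case False
      show ?thesis unfolding * sum_aut_delta[OF H[OF h]] tmap_simps if_not_P[OF False] by (rule refl)
    qed
  qed
  then show "(\<lambda>x. tmap (act_tensor (E - F) (act_word E) h \<phi>) x - act_word E h (tmap \<phi>) x) \<in> kidl ext E RA d"
    by (simp add: subsp_zero[OF subsp_kidl])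
qed

lemma equivar_restr:
  assumes H: "\<And>h. h \<in> H \<Longrightarrow> aut h"
  shows "equivar (frsp E d) (kidl ext F RB d) restr (act_word E) (act_word F) H"
  unfolding equivar_def
proof (intro ballI)
  fix h and v :: "nat list \<Rightarrow> 'k" assume h: "h \<in> H"
  have "restr (act_word E h v) w' = act_word F h (restr v) w'" for w'
  proof (cases "set w' \<subseteq> F")
    case True
    have "w \<in> words F (length w')" if "w \<in> words E (length w')" "map (fst h) w = w'" for w
    proof -
      have "x \<in> F" if x: "x \<in> set w" for x
      proof (rule ccontr)
        assume "x \<notin> F"
        moreover have "x \<in> E" using x \<open>w \<in> words E (length w')\<close> by (auto simp: words_def)
        ultimately have "fst h x \<in> E - F" using autD(5)[OF H[OF h]] by blast
        moreover have "fst h x \<in> set w'" using x \<open>map (fst h) w = w'\<close> by auto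
        ultimately show False using True by blast
      qed
      then show ?thesis using that by (auto simp: words_def)
    qed
    then have "(\<Sum>w\<in>words E (length w'). if map (fst h) w = w' then prod_list (map (\<lambda>i. sg (snd h i)) w) * v w else 0)
      = (\<Sum>w\<in>words F (length w'). if map (fst h) w = w' then prod_list (map (\<lambda>i. sg (snd h i)) w) * v w else 0)"
      by (intro sum.mono_neutral_right finite_words finE) (use FE in \<open>auto simp: words_def\<close>)
    also have "\<dots> = act_word F h (restr v) w'"
      unfolding act_word_def by (rule sum.cong) (auto simp: restr_def words_def)
    finally show ?thesis using True by (simp add: restr_def act_word_def)
  next
    case False
    have "map (fst h) w \<noteq> w'" if "w \<in> words F (length w')" for w
    proof
      assume "map (fst h) w = w'"
      then have "set w' = fst h ` set w" by auto
      also have "\<dots> \<subseteq> fst h ` F" using that by (auto simp: words_def)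
      finally show False using False autD(2)[OF H[OF h]] by simp
    qed
    then have "act_word F h (restr v) w' = 0" unfolding act_word_def by (intro sum.neutral) auto
    then show ?thesis using False by (simp add: restr_def)
  qed
  then show "(\<lambda>x. restr (act_word E h v) x - act_word F h (restr v) x) \<in> kidl ext F RB d"
    by (simp add: subsp_zero[OF subsp_kidl])
qed

lemma fibration_conc:
  assumes "\<And>h. h \<in> H \<Longrightarrow> aut h" shows "conc ext E F RA RB H"
proof -
  have incl: "equivar (extsp F d) (idl ext E RA d) (\<lambda>v. v) (act_ext ext F) (act_ext ext E) H" for d
    by (rule equivar_incl) (rule assms)
  have resm: "equivar (extsp E d) (tsp (E - F) (idl ext F RB) d) resmap (act_ext ext E)
    (act_tensor (E - F) (act_ext ext F)) H" for d
    by (rule equivar_resmap) (rule assms)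
  have tm: "equivar (tsp (E - F) (frsp E) d) (kidl ext E RA d) tmap
    (act_tensor (E - F) (act_word E)) (act_word E) H" for d
    by (rule equivar_tmap) (rule assms)
  have re: "equivar (frsp E d) (kidl ext F RB d) restr (act_word E) (act_word F) H" for d
    by (rule equivar_restr) (rule assms)
  show ?thesis
    unfolding conc_def
    by (intro allI conjI; rule exI, rule exI, intro conjI)
       (rule ses_algebra incl resm ses_dual tm re)+
qed

end

section \<open>Modular hyperplanes of matroids\<close>

lemma circuits_incomparable:
  assumes "matroid E \<C>" "C1 \<in> \<C>" "C2 \<in> \<C>" "C1 \<subseteq> C2" shows "C1 = C2"
proof -
  have "\<forall>C1\<in>\<C>. \<forall>C2\<in>\<C>. C1 \<subseteq> C2 \<longrightarrow> C1 = C2" using assms(1) by (simp add: matroid_def)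
  then show ?thesis using assms(2-4) by blast
qed

lemma circuit_elimination:
  assumes "matroid E \<C>" "C1 \<in> \<C>" "C2 \<in> \<C>" "C1 \<noteq> C2" "e \<in> C1" "e \<in> C2"
  obtains C3 where "C3 \<in> \<C>" "C3 \<subseteq> (C1 \<union> C2) - {e}"
proof -
  have "\<forall>C1\<in>\<C>. \<forall>C2\<in>\<C>. \<forall>e. C1 \<noteq> C2 \<and> e \<in> C1 \<inter> C2 \<longrightarrow> (\<exists>C3\<in>\<C>. C3 \<subseteq> (C1 \<union> C2) - {e})"
    using assms(1) by (simp add: matroid_def)
  then show thesis using assms(2-6) that by blast
qed

text \<open>Among the independent subsets K of the union of I and J with more elements than I, take
  one with I - K as small as possible. For e in I - K and any f in K - I, exchanging f for e would
  contradict minimality, so K + e contains a circuit through e that avoids f. Two such circuits, the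
  second avoiding an element of the first, give a circuit inside K by elimination of e.\<close>

lemma augment:
  assumes M: "matroid E \<C>" and I: "I \<subseteq> E" "indep \<C> I" and J: "J \<subseteq> E" "indep \<C> J"
    and "card I < card J"
  obtains e where "e \<in> J - I" "indep \<C> (insert e I)"
proof (rule ccontr)
  assume "\<not> thesis"
  with that have none: "\<And>e. e \<in> J - I \<Longrightarrow> \<not> indep \<C> (insert e I)" by blast
  have fE: "finite E" using M by (simp add: matroid_def)
  define P where "P = (\<lambda>K. K \<subseteq> I \<union> J \<and> indep \<C> K \<and> card I < card K)"
  have "P J" using J assms(6) by (simp add: P_def)
  then obtain K where K: "P K" "\<And>K'. P K' \<Longrightarrow> card (I - K) \<le> card (I - K')"
    using ex_has_least_nat[of P J "\<lambda>K. card (I - K)"] by blast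
  have fK: "finite K" and fI: "finite I"
    using K(1) I(1) J(1) fE unfolding P_def by (meson finite_subset Un_least)+
  have KI: "\<exists>x. x \<in> K - I"
  proof (rule ccontr)
    assume "\<nexists>x. x \<in> K - I"
    then have "K \<subseteq> I" by blast
    then have "card K \<le> card I" by (rule card_mono[OF fI])
    then show False using K(1) by (simp add: P_def)
  qed
  have "I - K \<noteq> {}"
  proof
    assume "I - K = {}"
    obtain x where x: "x \<in> K - I" using KI by blast
    then have "x \<in> J - I" using K(1) by (auto simp: P_def)
    moreover have "insert x I \<subseteq> K" using x \<open>I - K = {}\<close> by auto
    then have "indep \<C> (insert x I)" using K(1) unfolding P_def indep_def by (meson subset_trans)
    ultimately show False using none by blast
  qed
  then obtain e where e: "e \<in> I" "e \<notin> K" by blast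
  have dep: "\<exists>C\<in>\<C>. C \<subseteq> insert e K \<and> f \<notin> C \<and> e \<in> C" if f: "f \<in> K - I" for f
  proof -
    let ?T = "insert e (K - {f})"
    have "card ?T = Suc (card (K - {f}))" using e fK by (intro card_insert_disjoint) auto
    also have "\<dots> = card K" using f by (intro card_Suc_Diff1[OF fK]) simp
    finally have "card ?T = card K" .
    moreover have "I - ?T \<subset> I - K" using e f by auto
    then have "card (I - ?T) < card (I - K)" using fI by (intro psubset_card_mono) auto
    then have "\<not> P ?T" using K(2)[of ?T] by auto
    moreover have "?T \<subseteq> I \<union> J" using K(1) e by (auto simp: P_def)
    ultimately have "\<not> indep \<C> ?T" using K(1) e(1) by (simp add: P_def)
    then obtain C where C: "C \<in> \<C>" "C \<subseteq> ?T" by (auto simp: indep_def)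
    have "e \<in> C"
    proof (rule ccontr)
      assume "e \<notin> C"
      then have "C \<subseteq> K" using C by auto
      then show False using C(1) K(1) by (auto simp: P_def indep_def)
    qed
    then show ?thesis using C f e by blast
  qed
  obtain g where g: "g \<in> K - I" using KI by blast
  then obtain Cg where Cg: "Cg \<in> \<C>" "Cg \<subseteq> insert e K" "e \<in> Cg" using dep by blast
  have "\<not> Cg \<subseteq> I" using Cg(1) I(2) by (auto simp: indep_def)
  then obtain h where h: "h \<in> Cg" "h \<in> K - I" using Cg(2) e by blast
  then obtain Ch where Ch: "Ch \<in> \<C>" "Ch \<subseteq> insert e K" "e \<in> Ch" "h \<notin> Ch" using dep by blast
  then have "Cg \<noteq> Ch" using h by auto
  then obtain C where "C \<in> \<C>" "C \<subseteq> (Cg \<union> Ch) - {e}"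
    by (rule circuit_elimination[OF M Cg(1) Ch(1) _ Cg(3) Ch(3)])
  then have "C \<in> \<C>" "C \<subseteq> K" using Cg(2) Ch(2) by auto
  then show False using K(1) by (auto simp: P_def indep_def)
qed

context
  fixes E :: "nat set" and \<C> :: "nat set set"
  assumes M: "matroid E \<C>"
begin

lemma rank_set: "X \<subseteq> E \<Longrightarrow> finite {card Y |Y. Y \<subseteq> X \<and> indep \<C> Y}"
proof -
  assume X: "X \<subseteq> E"
  have "finite E" using M by (simp add: matroid_def)
  then have "finite (Pow X)" using X finite_subset by auto
  moreover have "{card Y |Y. Y \<subseteq> X \<and> indep \<C> Y} \<subseteq> card ` Pow X" by auto
  ultimately show ?thesis by (rule finite_surj)
qed

lemma indep_empty: "indep \<C> {}"
  using M by (auto simp: matroid_def indep_def)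

lemma card_le_mrank: "X \<subseteq> E \<Longrightarrow> Y \<subseteq> X \<Longrightarrow> indep \<C> Y \<Longrightarrow> card Y \<le> mrank \<C> X"
  unfolding mrank_def by (rule Max_ge[OF rank_set]) auto

lemma mrank_le_card:
  assumes "X \<subseteq> E" "\<And>Y. Y \<subseteq> X \<Longrightarrow> indep \<C> Y \<Longrightarrow> card Y \<le> k" shows "mrank \<C> X \<le> k"
proof -
  have "{card Y |Y. Y \<subseteq> X \<and> indep \<C> Y} \<noteq> {}" using indep_empty by blast
  then show ?thesis unfolding mrank_def using rank_set[OF assms(1)] assms(2)
    by (subst Max_le_iff) auto
qed

lemma mrank_mono: "X \<subseteq> X' \<Longrightarrow> X' \<subseteq> E \<Longrightarrow> mrank \<C> X \<le> mrank \<C> X'"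
  by (rule mrank_le_card) (auto intro: card_le_mrank)

lemma mrank_maximal:
  assumes "X \<subseteq> E" "B \<subseteq> X" "indep \<C> B" "\<And>x. x \<in> X - B \<Longrightarrow> \<not> indep \<C> (insert x B)"
  shows "mrank \<C> X = card B"
proof (rule antisym)
  show "mrank \<C> X \<le> card B"
  proof (rule mrank_le_card[OF assms(1)])
    fix Y assume Y: "Y \<subseteq> X" "indep \<C> Y"
    show "card Y \<le> card B"
    proof (rule ccontr)
      assume "\<not> card Y \<le> card B"
      then have "card B < card Y" by simp
      moreover have "B \<subseteq> E" "Y \<subseteq> E" using assms(1,2) Y(1) by auto
      ultimately obtain e where "e \<in> Y - B" "indep \<C> (insert e B)"
        using augment[OF M _ assms(3) _ Y(2)] by metis
      then show False using assms(4) Y(1) by blast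
    qed
  qed
  show "card B \<le> mrank \<C> X" by (rule card_le_mrank[OF assms(1-3)])
qed

lemma extend_to_maximal:
  assumes "X \<subseteq> E" "I \<subseteq> X" "indep \<C> I"
  obtains B where "I \<subseteq> B" "B \<subseteq> X" "indep \<C> B" "\<forall>x\<in>X - B. \<not> indep \<C> (insert x B)"
proof -
  let ?P = "\<lambda>B. I \<subseteq> B \<and> B \<subseteq> X \<and> indep \<C> B"
  have fX: "finite X" using M assms(1) finite_subset by (auto simp: matroid_def)
  have "\<exists>B. ?P B \<and> (\<forall>B'. ?P B' \<longrightarrow> card B' \<le> card B)"
    by (rule ex_has_greatest_nat[of ?P I card "Suc (card X)"])
       (use assms(2,3) card_mono[OF fX] in \<open>auto simp: less_Suc_eq_le\<close>)
  then obtain B where B: "?P B" "\<And>B'. ?P B' \<Longrightarrow> card B' \<le> card B" by blast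
  have "\<not> indep \<C> (insert x B)" if x: "x \<in> X - B" for x
  proof
    assume "indep \<C> (insert x B)"
    then have "card (insert x B) \<le> card B" using B x by (intro B(2)) auto
    moreover have "finite B" using B(1) fX finite_subset by blast
    ultimately show False using x by simp
  qed
  with B(1) that show thesis by blast
qed

text \<open>If e were the only element outside, the independent set C - e would extend to a basis of
  F that cannot be enlarged by e, and e would lie in the closure of F.\<close>

lemma flat_circuit:
  assumes "flat E \<C> F" "C \<in> \<C>" shows "C - F \<noteq> {e}"
proof
  assume e: "C - F = {e}"
  have FE: "F \<subseteq> E" and cl: "mclosure E \<C> F = F" using assms(1) by (auto simp: flat_def)
  have CE: "C \<subseteq> E" using M assms(2) by (auto simp: matroid_def)
  have i: "indep \<C> (C - {e})"
    unfolding indep_def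
  proof (intro ballI notI)
    fix C' assume "C' \<in> \<C>" "C' \<subseteq> C - {e}"
    moreover from this have "C' = C" using circuits_incomparable[OF M _ assms(2)] by blast
    ultimately show False using e by blast
  qed
  have "C - {e} \<subseteq> F" using e by blast
  then obtain B where B: "C - {e} \<subseteq> B" "B \<subseteq> F" "indep \<C> B" "\<forall>x\<in>F - B. \<not> indep \<C> (insert x B)"
    by (rule extend_to_maximal[OF FE _ i])
  have "\<not> indep \<C> (insert e B)" using B(1) assms(2) by (auto simp: indep_def)
  then have "mrank \<C> (insert e F) = card B"
    using B e CE FE by (intro mrank_maximal) auto
  moreover have "mrank \<C> F = card B" by (rule mrank_maximal[OF FE B(2,3) B(4)[rule_format]])
  ultimately have "e \<in> mclosure E \<C> F" using e CE by (auto simp: mclosure_def)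
  then show False using cl e by auto
qed

lemma mclosure_subset: "X \<subseteq> E \<Longrightarrow> X \<subseteq> mclosure E \<C> X" "mclosure E \<C> X \<subseteq> E"
  by (auto simp: mclosure_def insert_absorb)

lemma mrank_mclosure:
  assumes X: "X \<subseteq> E" shows "mrank \<C> (mclosure E \<C> X) = mrank \<C> X"
proof -
  obtain B where B: "B \<subseteq> X" "indep \<C> B" "\<forall>x\<in>X - B. \<not> indep \<C> (insert x B)"
    by (rule extend_to_maximal[OF X empty_subsetI indep_empty])
  have rX: "mrank \<C> X = card B" by (rule mrank_maximal[OF X B(1,2) B(3)[rule_format]])
  have "finite E" using M by (simp add: matroid_def)
  then have fB: "finite B" by (rule finite_subset[OF subset_trans[OF B(1) X]])
  have "\<not> indep \<C> (insert x B)" if x: "x \<in> mclosure E \<C> X - B" for x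
  proof
    assume "indep \<C> (insert x B)"
    then have "card (insert x B) \<le> mrank \<C> (insert x X)"
      using B(1) X x mclosure_subset(2) by (intro card_le_mrank) auto
    then show False using x fB rX by (auto simp: mclosure_def)
  qed
  then have "mrank \<C> (mclosure E \<C> X) = card B"
    using B mclosure_subset[of X] X by (intro mrank_maximal) auto
  then show ?thesis using rX by simp
qed

lemma flat_mclosure:
  assumes X: "X \<subseteq> E" shows "flat E \<C> (mclosure E \<C> X)"
proof -
  let ?Y = "mclosure E \<C> X"
  have "mclosure E \<C> ?Y \<subseteq> ?Y"
  proof
    fix e assume "e \<in> mclosure E \<C> ?Y"
    then have e: "e \<in> E" "mrank \<C> (insert e ?Y) = mrank \<C> ?Y" by (auto simp: mclosure_def)
    have "mrank \<C> (insert e X) \<le> mrank \<C> (insert e ?Y)"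
      using mclosure_subset[of X] X e(1) by (intro mrank_mono) auto
    moreover have "mrank \<C> X \<le> mrank \<C> (insert e X)" using X e(1) by (intro mrank_mono) auto
    ultimately show "e \<in> ?Y" using e mrank_mclosure[OF X] by (auto simp: mclosure_def)
  qed
  then show ?thesis using mclosure_subset(1)[OF mclosure_subset(2)] mclosure_subset(2) by (auto simp: flat_def)
qed

text \<open>The closure of {m, l} is a flat of rank 2 and F has corank at most 1, so modularity
  gives the meet positive rank. A point f of the meet makes {m, l, f} dependent, and simplicity
  makes it a circuit.\<close>

lemma modular_line_meets:
  assumes simple: "simple_m \<C>" and F: "modular_flat E \<C> F" and r: "mrank \<C> E \<le> Suc (mrank \<C> F)"
    and m: "m \<in> E - F" "l \<in> E - F" "m \<noteq> l"
  shows "\<exists>f\<in>F. {m, l, f} \<in> \<C>"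
proof -
  have small: "indep \<C> X" if "card X \<le> 2" "finite X" for X
    unfolding indep_def
  proof (intro ballI notI)
    fix C assume "C \<in> \<C>" "C \<subseteq> X"
    then have "3 \<le> card C" "card C \<le> card X" using simple card_mono[OF that(2)] by (auto simp: simple_m_def)
    then show False using that(1) by simp
  qed
  let ?Y = "mclosure E \<C> {m, l}"
  have ml: "{m, l} \<subseteq> E" using m by auto
  have "indep \<C> {m, l}" by (rule small) (auto simp: card_insert_if)
  then have "mrank \<C> {m, l} = card {m, l}" by (intro mrank_maximal[OF ml]) auto
  then have r2: "mrank \<C> {m, l} = 2" using m(3) by simp
  have FE: "F \<subseteq> E" using F by (simp add: modular_flat_def flat_def)
  have "mrank \<C> (mclosure E \<C> (F \<union> ?Y)) + mrank \<C> (F \<inter> ?Y) = mrank \<C> F + mrank \<C> ?Y"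
    using F flat_mclosure[OF ml] by (simp add: modular_flat_def)
  moreover have "mrank \<C> (mclosure E \<C> (F \<union> ?Y)) \<le> mrank \<C> E"
    by (rule mrank_mono[OF mclosure_subset(2) order_refl])
  moreover have "mrank \<C> {} = 0" using mrank_le_card[of "{}" 0] by simp
  ultimately have "F \<inter> ?Y \<noteq> {}" using r r2 mrank_mclosure[OF ml] by auto
  then obtain f where f: "f \<in> F" "f \<in> ?Y" by blast
  then have fE: "f \<in> E" "mrank \<C> (insert f {m, l}) = 2" using r2 by (auto simp: mclosure_def)
  have "f \<noteq> m" "f \<noteq> l" using m f(1) by auto
  then have c3: "card (insert f {m, l}) = 3" using m(3) by simp
  have "\<not> indep \<C> (insert f {m, l})"
    using card_le_mrank[of "insert f {m, l}" "insert f {m, l}"] fE m c3 by auto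
  then obtain C where C: "C \<in> \<C>" "C \<subseteq> insert f {m, l}" by (auto simp: indep_def)
  then have "3 \<le> card C" using simple by (auto simp: simple_m_def)
  then have "C = insert f {m, l}" using C(2) c3 by (intro card_seteq) auto
  then have "{m, l, f} \<in> \<C>" using C(1) by (simp add: insert_commute)
  then show ?thesis using f(1) by blast
qed

text \<open>Each proper inclusion of flats raises the rank. As E has rank r, this lower bound gives
  the last proper member of the flag corank at most 1.\<close>

lemma flag_rank:
  assumes "modular_flag E \<C> r Fl" "i \<le> r" shows "i \<le> mrank \<C> (Fl i)"
  using assms(2)
proof (induction i)
  case (Suc i)
  have flats: "flat E \<C> (Fl i)" "flat E \<C> (Fl (Suc i))" and sub: "Fl i \<subset> Fl (Suc i)"
    using assms(1) Suc.prems by (auto simp: modular_flag_def modular_flat_def)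
  then obtain e where e: "e \<in> Fl (Suc i)" "e \<notin> Fl i" by blast
  have FE: "Fl i \<subseteq> E" "Fl (Suc i) \<subseteq> E" "e \<notin> mclosure E \<C> (Fl i)" using flats e(2) by (auto simp: flat_def)
  then have "mrank \<C> (insert e (Fl i)) \<noteq> mrank \<C> (Fl i)" using e(1) by (auto simp: mclosure_def)
  moreover have "mrank \<C> (Fl i) \<le> mrank \<C> (insert e (Fl i))" using FE e by (intro mrank_mono) auto
  moreover have "mrank \<C> (insert e (Fl i)) \<le> mrank \<C> (Fl (Suc i))" using FE e sub by (intro mrank_mono) auto
  ultimately show ?case using Suc by simp
qed simp

lemma modular_flag_hyperplane:
  assumes simple: "simple_m \<C>" and fl: "modular_flag E \<C> r Fl" and r: "1 \<le> r"
  shows "Fl (r - 1) \<subseteq> E" "C \<in> \<C> \<Longrightarrow> C - Fl (r - 1) \<noteq> {m}"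
    "m \<in> E - Fl (r - 1) \<Longrightarrow> l \<in> E - Fl (r - 1) \<Longrightarrow> m \<noteq> l \<Longrightarrow> \<exists>f\<in>Fl (r - 1). {m, l, f} \<in> \<C>"
proof -
  have F: "modular_flat E \<C> (Fl (r - 1))" using fl by (auto simp: modular_flag_def)
  then have flat: "flat E \<C> (Fl (r - 1))" by (simp add: modular_flat_def)
  then show "Fl (r - 1) \<subseteq> E" by (simp add: flat_def)
  show "C - Fl (r - 1) \<noteq> {m}" if "C \<in> \<C>" by (rule flat_circuit[OF flat that])
  have "mrank \<C> E \<le> Suc (mrank \<C> (Fl (r - 1)))"
    using flag_rank[OF fl, of "r - 1"] fl r by (auto simp: modular_flag_def)
  then show "m \<in> E - Fl (r - 1) \<Longrightarrow> l \<in> E - Fl (r - 1) \<Longrightarrow> m \<noteq> l \<Longrightarrow> \<exists>f\<in>Fl (r - 1). {m, l, f} \<in> \<C>"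
    by (rule modular_line_meets[OF simple F])
qed

end

section \<open>Orlik--Solomon and Varchenko--Gelfand algebras\<close>

definition indw :: "nat set \<Rightarrow> nat \<Rightarrow> 'k::field" where
  "indw C = (\<lambda>e. if e \<in> C then 1 else 0)"

definition sgw :: "nat set \<times> nat set \<Rightarrow> nat \<Rightarrow> 'k::field" where
  "sgw X = (\<lambda>e. if e \<in> fst X then 1 else if e \<in> snd X then -1 else 0)"

lemma supp_indw [simp]: "supp (indw C :: nat \<Rightarrow> 'k::field) = C"
  by (auto simp: supp_def indw_def)

lemma supp_sgw [simp]: "supp (sgw X :: nat \<Rightarrow> 'k::field) = fst X \<union> snd X"
  by (auto simp: supp_def sgw_def)

lemma OS_conc:
  assumes M: "matroid E \<C>" and simple: "simple_m \<C>" and r: "1 \<le> r" and fl: "modular_flag E \<C> r Fl"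
    and G: "\<And>\<pi>. \<pi> \<in> G \<Longrightarrow> maut E \<C> \<pi>"
  shows "conc True E (Fl (r - 1)) (relsOS \<C> :: (nat \<times> (nat set \<Rightarrow> 'k::field)) set)
    (relsOS {C \<in> \<C>. C \<subseteq> Fl (r - 1)}) (unsigned {\<pi> \<in> G. \<pi> ` Fl (r - 1) = Fl (r - 1)})"
proof -
  let ?F = "Fl (r - 1)"
  note hyp = modular_flag_hyperplane[OF M simple fl r]
  interpret fibration True "1 :: 'k" E ?F "indw ` \<C>"
  proof (unfold_locales)
    show "(1 :: 'k) = (if True then 1 else - 1)" by simp
    show "finite E" using M by (simp add: matroid_def)
    show "?F \<subseteq> E" by (rule hyp(1))
    fix X :: "nat \<Rightarrow> 'k" assume "X \<in> indw ` \<C>"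
    then obtain C where C: "C \<in> \<C>" "X = indw C" by blast
    show "X e = 0 \<or> X e = 1 \<or> X e = - 1" for e by (simp add: C(2) indw_def)
    show "supp X \<subseteq> E" using C M by (auto simp: matroid_def)
    show "3 \<le> card (supp X)" using C simple by (simp add: simple_m_def)
    show "supp X - ?F \<noteq> {m}" for m using C hyp(2) by simp
    fix Y :: "nat \<Rightarrow> 'k" assume "Y \<in> indw ` \<C>"
    then obtain C' where C': "C' \<in> \<C>" "Y = indw C'" by blast
    show "X = Y \<or> X = (\<lambda>e. - Y e)" if "supp X = supp Y" using that C(2) C'(2) by simp
    fix e assume "supp X \<noteq> supp Y" "X e \<noteq> 0" "Y e \<noteq> 0"
    then have ne: "C \<noteq> C'" and e: "e \<in> C" "e \<in> C'" using C(2) C'(2) by (auto simp: indw_def split: if_splits)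
    obtain C3 where C3: "C3 \<in> \<C>" "C3 \<subseteq> (C \<union> C') - {e}"
      by (rule circuit_elimination[OF M C(1) C'(1) ne e])
    show "\<exists>Z\<in>indw ` \<C>. Z e = 0 \<and> (\<forall>c. Z c = 0 \<or> Z c = X c \<or> Z c = 1 * X e * Y e * Y c)"
    proof (intro bexI conjI allI)
      show "indw C3 \<in> indw ` \<C>" using C3(1) by blast
      show "indw C3 e = (0 :: 'k)" using C3(2) by (auto simp: indw_def)
      show "indw C3 c = 0 \<or> indw C3 c = X c \<or> indw C3 c = 1 * X e * Y e * Y c" for c
        using C3(2) e by (auto simp: C(2) C'(2) indw_def)
    qed
  next
    fix m l assume "m \<in> E - ?F" "l \<in> E - ?F" "m \<noteq> l"
    then obtain f where f: "f \<in> ?F" "{m, l, f} \<in> \<C>" using hyp(3) by blast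
    show "\<exists>f\<in>?F. \<exists>Y\<in>indw ` \<C>. supp (Y :: nat \<Rightarrow> 'k) = {m, l, f}"
      using f by (intro bexI[OF _ f(1)] bexI[OF _ imageI[OF f(2)]]) simp
  qed
  have relC: "rel (indw C) = (card C - 1, osrel C)" if "C \<in> \<C>" for C
  proof -
    have "finite C" using M that finite_subset by (auto simp: matroid_def)
    moreover have "relw (indw C) C = (osrel C :: nat set \<Rightarrow> 'k)"
      unfolding relw_def osrel_def by (intro HOL.ext sum.cong) (auto simp: indw_def sn_def)
    ultimately show ?thesis by (simp add: rel_def dm_eq_relw)
  qed
  have relsOS: "relsOS S = (\<lambda>C. (card C - 1, osrel C :: nat set \<Rightarrow> 'k)) ` S" for S
    by (auto simp: relsOS_def)
  have RA: "RA = relsOS \<C>"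
    unfolding RA_def relsOS image_image using relC by (intro image_cong) auto
  have "{X \<in> indw ` \<C>. supp (X :: nat \<Rightarrow> 'k) \<subseteq> ?F} = indw ` {C \<in> \<C>. C \<subseteq> ?F}" by auto
  then have RB: "RB = relsOS {C \<in> \<C>. C \<subseteq> ?F}"
    unfolding RB_def relsOS using relC by (simp only: image_image) (intro image_cong, auto)
  have aut: "aut h" if h: "h \<in> unsigned {\<pi> \<in> G. \<pi> ` ?F = ?F}" for h
  proof -
    obtain \<pi> where \<pi>: "h = (\<pi>, \<lambda>_. False)" "\<pi> \<in> G" "\<pi> ` ?F = ?F"
      using h by (auto simp: unsigned_def)
    have bij: "bij_betw \<pi> E E" and im: "\<And>C. C \<in> \<C> \<Longrightarrow> \<pi> ` C \<in> \<C>"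
      using G[OF \<pi>(2)] by (auto simp: maut_def)
    have "\<exists>X'\<in>indw ` \<C>. \<forall>e\<in>E. X' (\<pi> e) = (indw C e :: 'k)" if C: "C \<in> \<C>" for C
    proof (intro bexI ballI)
      show "indw (\<pi> ` C) \<in> indw ` \<C>" using im[OF C] by blast
      fix e assume "e \<in> E"
      moreover have "C \<subseteq> E" using M C by (auto simp: matroid_def)
      ultimately have "\<pi> e \<in> \<pi> ` C \<longleftrightarrow> e \<in> C"
        by (rule inj_on_image_mem_iff[OF bij_betw_imp_inj_on[OF bij]])
      then show "indw (\<pi> ` C) (\<pi> e) = (indw C e :: 'k)" by (simp add: indw_def)
    qed
    then show ?thesis unfolding aut_def \<pi>(1) using bij \<pi>(3) by (auto simp: sg_def)
  qed
  show ?thesis using fibration_conc[OF aut] unfolding RA RB .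
qed

text \<open>The axiom covers an element that is positive in the first circuit and negative in the
  second. The other positions reduce to it by reversing Y or exchanging the two circuits, and the
  factor - X_e Y_e records whether Y was reversed. Different supports rule out a pair of opposite
  circuits.\<close>

lemma signed_elimination:
  assumes OM: "oriented_matroid E SC" and X: "X \<in> SC" "Y \<in> SC"
    and ne: "fst X \<union> snd X \<noteq> fst Y \<union> snd Y" and e: "sgw X e \<noteq> (0 :: 'k::field)" "sgw Y e \<noteq> (0 :: 'k)"
  obtains Z where "Z \<in> SC" "sgw Z e = (0 :: 'k)"
    "\<forall>c. sgw Z c = (0 :: 'k) \<or> sgw Z c = (sgw X c :: 'k) \<or> sgw Z c = - 1 * sgw X e * sgw Y e * (sgw Y c :: 'k)"
    "fst Z \<union> snd Z \<subseteq> (fst X \<union> snd X \<union> (fst Y \<union> snd Y)) - {e}"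
proof -
  obtain P N where XX: "X = (P, N)" by (cases X)
  obtain P' N' where YY: "Y = (P', N')" by (cases Y)
  have D: "\<forall>(P,N)\<in>SC. P \<union> N \<subseteq> E \<and> P \<inter> N = {} \<and> P \<union> N \<noteq> {}"
    and flips: "\<forall>(P,N)\<in>SC. (N,P) \<in> SC"
    and el: "\<forall>(P,N)\<in>SC. \<forall>(P',N')\<in>SC. \<forall>e. (P',N') \<noteq> (N,P) \<and> e \<in> P \<inter> N' \<longrightarrow>
        (\<exists>(Q,R)\<in>SC. Q \<subseteq> (P \<union> P') - {e} \<and> R \<subseteq> (N \<union> N') - {e})"
    using OM unfolding oriented_matroid_def by argo+
  have disj: "P \<inter> N = {}" "P' \<inter> N' = {}" and flip: "(N', P') \<in> SC"
    using bspec[OF D X(1)] bspec[OF D X(2)] bspec[OF flips X(2)] by (simp_all add: XX YY)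
  have ax: "\<exists>(Q, R)\<in>SC. Q \<subseteq> (P1 \<union> P2) - {e} \<and> R \<subseteq> (N1 \<union> N2) - {e}"
    if "(P1, N1) \<in> SC" "(P2, N2) \<in> SC" "(P2, N2) \<noteq> (N1, P1)" "e \<in> P1 \<inter> N2" for P1 N1 P2 N2
    using bspec[OF bspec[OF el that(1), unfolded prod.case] that(2), unfolded prod.case] that(3,4) by blast
  obtain Q R where QR: "(Q, R) \<in> SC" "Q \<subseteq> (P \<union> (if e \<in> P \<longleftrightarrow> e \<in> N' then P' else N')) - {e}"
    "R \<subseteq> (N \<union> (if e \<in> P \<longleftrightarrow> e \<in> N' then N' else P')) - {e}"
  proof -
    have mem: "e \<in> P \<or> e \<in> N" "e \<in> P' \<or> e \<in> N'"
      using e by (auto simp: XX YY sgw_def split: if_splits)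
    have ne': "(P', N') \<noteq> (N, P)" "(N', P') \<noteq> (N, P)" "(P, N) \<noteq> (N', P')" "(P, N) \<noteq> (P', N')"
      using ne by (auto simp: XX YY)
    consider "e \<in> P" "e \<in> N'" | "e \<in> P" "e \<notin> N'" "e \<in> P'" | "e \<notin> P" "e \<in> N" "e \<notin> N'" "e \<in> P'"
      | "e \<notin> P" "e \<in> N" "e \<in> N'" using mem by blast
    then show thesis
    proof cases
      case 1
      then obtain Q R where "(Q, R) \<in> SC" "Q \<subseteq> (P \<union> P') - {e}" "R \<subseteq> (N \<union> N') - {e}"
        using ax[of P N P' N'] X ne' by (auto simp: XX YY)
      then show thesis using that 1 by simp
    next
      case 2
      then obtain Q R where "(Q, R) \<in> SC" "Q \<subseteq> (P \<union> N') - {e}" "R \<subseteq> (N \<union> P') - {e}"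
        using ax[of P N N' P'] X flip ne' by (auto simp: XX YY)
      then show thesis using that 2 by simp
    next
      case 3
      then obtain Q R where "(Q, R) \<in> SC" "Q \<subseteq> (P' \<union> P) - {e}" "R \<subseteq> (N' \<union> N) - {e}"
        using ax[of P' N' P N] X ne' by (auto simp: XX YY)
      then show thesis using that 3 by (simp add: Un_commute)
    next
      case 4
      then obtain Q R where "(Q, R) \<in> SC" "Q \<subseteq> (N' \<union> P) - {e}" "R \<subseteq> (P' \<union> N) - {e}"
        using ax[of N' P' P N] X flip ne' by (auto simp: XX YY)
      then show thesis using that 4 by (simp add: Un_commute)
    qed
  qed
  have dQ: "Q \<inter> R = {}" using bspec[OF D QR(1)] by simp
  have "sgw (Q, R) c = (0 :: 'k) \<or> sgw (Q, R) c = (sgw X c :: 'k) \<or>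
      sgw (Q, R) c = - 1 * sgw X e * sgw Y e * (sgw Y c :: 'k)" for c
    using QR(2,3) disj dQ e by (auto simp: XX YY sgw_def split: if_splits)
  moreover have "sgw (Q, R) e = (0 :: 'k)" using QR(2,3) by (auto simp: sgw_def)
  moreover have "fst (Q, R) \<union> snd (Q, R) \<subseteq> (fst X \<union> snd X \<union> (fst Y \<union> snd Y)) - {e}"
    using QR(2,3) by (auto simp: XX YY split: if_splits)
  ultimately show thesis using that QR(1) by blast
qed

lemma oriented_matroid_circuit:
  assumes "oriented_matroid E SC" "X \<in> SC"
  shows "fst X \<union> snd X \<subseteq> E" "fst X \<inter> snd X = {}" "fst X \<union> snd X \<noteq> {}"
proof -
  have "\<forall>(P,N)\<in>SC. P \<union> N \<subseteq> E \<and> P \<inter> N = {} \<and> P \<union> N \<noteq> {}"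
    using assms(1) unfolding oriented_matroid_def by argo
  from bspec[OF this assms(2)]
  show "fst X \<union> snd X \<subseteq> E" "fst X \<inter> snd X = {}" "fst X \<union> snd X \<noteq> {}"
    by (simp_all add: case_prod_unfold)
qed

lemma underlying_eq: "underlying SC = (\<lambda>X. fst X \<union> snd X) ` SC"
  by (auto simp: underlying_def image_def Bex_def split_paired_Ex)

lemma oriented_matroid_eq:
  assumes "oriented_matroid E SC" "X \<in> SC" "Y \<in> SC" "fst X \<union> snd X \<subseteq> fst Y \<union> snd Y"
  shows "Y = X \<or> Y = (snd X, fst X)"
proof -
  have "\<forall>(P,N)\<in>SC. \<forall>(P',N')\<in>SC. P \<union> N \<subseteq> P' \<union> N' \<longrightarrow> (P',N') = (P,N) \<or> (P',N') = (N,P)"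
    using assms(1) by (simp add: oriented_matroid_def)
  from bspec[OF this assms(2)] assms(3,4) show ?thesis by (auto simp: case_prod_unfold prod_eq_iff)
qed

lemma matroid_underlying:
  assumes OM: "oriented_matroid E SC" shows "matroid E (underlying SC)"
  unfolding matroid_def underlying_eq
proof (intro conjI ballI allI impI)
  note SC = oriented_matroid_circuit[OF OM]
  show "finite E" using OM by (simp add: oriented_matroid_def)
  show "(\<lambda>X. fst X \<union> snd X) ` SC \<subseteq> Pow E" using SC(1) by blast
  show "{} \<notin> (\<lambda>X. fst X \<union> snd X) ` SC" proof
    assume "{} \<in> (\<lambda>X. fst X \<union> snd X) ` SC"
    then obtain X where "{} = fst X \<union> snd X" "X \<in> SC" by (rule imageE)
    then show False using SC(3)[of X] by simp
  qed
  fix C1 C2 assume "C1 \<in> (\<lambda>X. fst X \<union> snd X) ` SC" "C2 \<in> (\<lambda>X. fst X \<union> snd X) ` SC"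
  then obtain X Y where X: "X \<in> SC" "C1 = fst X \<union> snd X" and Y: "Y \<in> SC" "C2 = fst Y \<union> snd Y" by blast
  show "C1 = C2" if "C1 \<subseteq> C2"
    using oriented_matroid_eq[OF OM X(1) Y(1)] that X(2) Y(2) by auto
  fix e assume e: "C1 \<noteq> C2 \<and> e \<in> C1 \<inter> C2"
  \<comment> \<open>Supports do not depend on the field; \<open>rat\<close> only serves as an
    instance for \<open>signed_elimination\<close>.\<close>
  then have nz: "sgw X e \<noteq> (0 :: rat)" "sgw Y e \<noteq> (0 :: rat)" by (auto simp: X Y sgw_def)
  have ne: "fst X \<union> snd X \<noteq> fst Y \<union> snd Y" using e X(2) Y(2) by simp
  obtain Z where "Z \<in> SC" "fst Z \<union> snd Z \<subseteq> (fst X \<union> snd X \<union> (fst Y \<union> snd Y)) - {e}"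
    by (rule signed_elimination[OF OM X(1) Y(1) ne nz]; rule that; assumption)
  then show "\<exists>C3\<in>(\<lambda>X. fst X \<union> snd X) ` SC. C3 \<subseteq> C1 \<union> C2 - {e}" using X(2) Y(2) by blast
qed

lemma VG_conc:
  assumes OM: "oriented_matroid E SC" and simple: "simple_m (underlying SC)" and r: "1 \<le> r"
    and fl: "modular_flag E (underlying SC) r Fl" and G: "\<And>g. g \<in> G \<Longrightarrow> oaut E SC g"
  shows "conc False E (Fl (r - 1)) (relsVG SC :: (nat \<times> (nat set \<Rightarrow> 'k::field)) set)
    (relsVG {X \<in> SC. fst X \<union> snd X \<subseteq> Fl (r - 1)}) {g \<in> G. fst g ` Fl (r - 1) = Fl (r - 1)}"
proof -
  let ?F = "Fl (r - 1)"
  note M = matroid_underlying[OF OM]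
  note hyp = modular_flag_hyperplane[OF M simple fl r]
  have und: "\<And>X. X \<in> SC \<Longrightarrow> fst X \<union> snd X \<in> underlying SC" by (auto simp: underlying_eq)
  have fE: "finite E" using OM by (simp add: oriented_matroid_def)
  note disj = oriented_matroid_circuit(2)[OF OM]
  have SCE: "fst X \<subseteq> E \<and> snd X \<subseteq> E" if "X \<in> SC" for X
    using oriented_matroid_circuit(1)[OF OM that] by simp
  have flip: "sgw (snd X, fst X) = (\<lambda>e. - sgw X e :: 'k)" if "X \<in> SC" for X
    using disj[OF that] by (auto simp: sgw_def fun_eq_iff)
  interpret fibration False "-1 :: 'k" E ?F "sgw ` SC"
  proof (unfold_locales)
    show "(-1 :: 'k) = (if False then 1 else - 1)" by simp
    show "finite E" by (rule fE)
    show "?F \<subseteq> E" by (rule hyp(1))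
    fix X :: "nat \<Rightarrow> 'k" assume "X \<in> sgw ` SC"
    then obtain C where C: "C \<in> SC" "X = sgw C" by blast
    show "X e = 0 \<or> X e = 1 \<or> X e = - 1" for e by (simp add: C(2) sgw_def)
    show "supp X \<subseteq> E" using SCE[OF C(1)] by (simp add: C(2))
    show "3 \<le> card (supp X)" using und[OF C(1)] simple by (simp add: C(2) simple_m_def)
    show "supp X - ?F \<noteq> {m}" for m using hyp(2)[OF und[OF C(1)]] by (simp add: C(2))
    fix Y :: "nat \<Rightarrow> 'k" assume "Y \<in> sgw ` SC"
    then obtain C' where C': "C' \<in> SC" "Y = sgw C'" by blast
    show "X = Y \<or> X = (\<lambda>e. - Y e)" if "supp X = supp Y"
      using oriented_matroid_eq[OF OM C'(1) C(1)] that flip[OF C'(1)] by (auto simp: C(2) C'(2))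
    fix e assume ne: "supp X \<noteq> supp Y" "X e \<noteq> 0" "Y e \<noteq> 0"
    show "\<exists>Z\<in>sgw ` SC. Z e = 0 \<and> (\<forall>c. Z c = 0 \<or> Z c = X c \<or> Z c = - 1 * X e * Y e * Y c)"
    proof -
      have ne': "fst C \<union> snd C \<noteq> fst C' \<union> snd C'" "sgw C e \<noteq> (0 :: 'k)" "sgw C' e \<noteq> (0 :: 'k)"
        using ne by (simp_all add: C(2) C'(2))
      obtain Z where "Z \<in> SC" "sgw Z e = (0 :: 'k)"
        "\<forall>c. sgw Z c = (0 :: 'k) \<or> sgw Z c = (sgw C c :: 'k) \<or> sgw Z c = - 1 * sgw C e * sgw C' e * (sgw C' c :: 'k)"
        by (rule signed_elimination[OF OM C(1) C'(1) ne']; rule that; assumption)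
      then show ?thesis unfolding C(2) C'(2) by blast
    qed
  next
    fix m l assume "m \<in> E - ?F" "l \<in> E - ?F" "m \<noteq> l"
    then obtain f where f: "f \<in> ?F" "{m, l, f} \<in> underlying SC" using hyp(3) by blast
    then obtain X where "X \<in> SC" "fst X \<union> snd X = {m, l, f}" by (auto simp: underlying_eq)
    then show "\<exists>f\<in>?F. \<exists>Y\<in>sgw ` SC. supp (Y :: nat \<Rightarrow> 'k) = {m, l, f}"
      using f(1) by (intro bexI[OF _ f(1)] bexI[OF _ imageI[of X]]) simp_all
  qed
  have relC: "rel (sgw X) = (card (fst X \<union> snd X) - 1, vgrel (fst X) (snd X))" if "X \<in> SC" for X
  proof -
    have "finite (fst X \<union> snd X)" using SCE[OF that] fE finite_subset by blast
    moreover have "relw (sgw X) (fst X \<union> snd X) = (vgrel (fst X) (snd X) :: nat set \<Rightarrow> 'k)"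
      unfolding relw_def vgrel_def by (intro HOL.ext sum.cong) (auto simp: sgw_def sn_def)
    ultimately show ?thesis by (simp add: rel_def dm_eq_relw)
  qed
  have relsVG: "relsVG S = (\<lambda>X. (card (fst X \<union> snd X) - 1, vgrel (fst X) (snd X) :: nat set \<Rightarrow> 'k)) ` S" for S
    by (auto simp: relsVG_def image_def Bex_def split_paired_Ex)
  have RA: "RA = relsVG SC"
    unfolding RA_def relsVG image_image using relC by (intro image_cong) auto
  have "{X \<in> sgw ` SC. supp (X :: nat \<Rightarrow> 'k) \<subseteq> ?F} = sgw ` {X \<in> SC. fst X \<union> snd X \<subseteq> ?F}" by auto
  then have RB: "RB = relsVG {X \<in> SC. fst X \<union> snd X \<subseteq> ?F}"
    unfolding RB_def relsVG using relC by (simp only: image_image) (intro image_cong, auto)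
  have aut: "aut g" if g: "g \<in> {g \<in> G. fst g ` ?F = ?F}" for g
  proof -
    have bij: "bij_betw (fst g) E E" using G g by (auto simp: oaut_def)
    have inj: "fst g a = fst g b \<longleftrightarrow> a = b" if "a \<in> E" "b \<in> E" for a b
      using inj_on_eq_iff[OF bij_betw_imp_inj_on[OF bij] that] .
    have "\<exists>X'\<in>sgw ` SC. \<forall>e\<in>E. X' (fst g e) = sg (snd g e) * (sgw X e :: 'k)" if X: "X \<in> SC" for X
    proof -
      define Q where "Q = {fst g e | e. e \<in> fst X \<and> \<not> snd g e} \<union> {fst g e | e. e \<in> snd X \<and> snd g e}"
      define R where "R = {fst g e | e. e \<in> snd X \<and> \<not> snd g e} \<union> {fst g e | e. e \<in> fst X \<and> snd g e}"
      have "(Q, R) \<in> SC"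
        using G g X unfolding oaut_def Q_def R_def by (cases X) fastforce
      moreover have "sgw (Q, R) (fst g e) = sg (snd g e) * (sgw X e :: 'k)" if e: "e \<in> E" for e
      proof -
        have "fst g e \<in> Q \<longleftrightarrow> (if snd g e then e \<in> snd X else e \<in> fst X)"
          "fst g e \<in> R \<longleftrightarrow> (if snd g e then e \<in> fst X else e \<in> snd X)"
          unfolding Q_def R_def using inj[OF e] SCE[OF X] by auto
        then show ?thesis using disj[OF X] by (auto simp: sgw_def sg_def)
      qed
      ultimately show ?thesis by blast
    qed
    then show ?thesis unfolding aut_def using bij g by auto
  qed
  show ?thesis using fibration_conc[OF aut] unfolding RA RB .
qed

theorem theorem7p1:
  fixes n r :: nat and Fl :: "nat \<Rightarrow> nat set"
  shows "(\<forall>(\<C>::nat set set) (G::(nat \<Rightarrow> nat) set).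
            matroid {1..n} \<C> \<and> simple_m \<C> \<and> 1 \<le> r \<and> modular_flag {1..n} \<C> r Fl \<and>
            sgroup {1..n} (unsigned G) \<and> (\<forall>\<pi>\<in>G. maut {1..n} \<C> \<pi>) \<longrightarrow>
            conc True {1..n} (Fl (r - 1))
              (relsOS \<C> :: (nat \<times> (nat set \<Rightarrow> 'k::field)) set)
              (relsOS {C \<in> \<C>. C \<subseteq> Fl (r - 1)})
              (unsigned {\<pi> \<in> G. \<pi> ` Fl (r - 1) = Fl (r - 1)})) \<and>
         (\<forall>(SC::(nat set \<times> nat set) set) (G::sperm set).
            oriented_matroid {1..n} SC \<and> simple_m (underlying SC) \<and> 1 \<le> r \<and>
            modular_flag {1..n} (underlying SC) r Fl \<and>
            sgroup {1..n} G \<and> (\<forall>g\<in>G. oaut {1..n} SC g) \<longrightarrow>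
            conc False {1..n} (Fl (r - 1))
              (relsVG SC :: (nat \<times> (nat set \<Rightarrow> 'k::field)) set)
              (relsVG {X \<in> SC. fst X \<union> snd X \<subseteq> Fl (r - 1)})
              {g \<in> G. fst g ` Fl (r - 1) = Fl (r - 1)})"
  by (intro conjI allI impI; elim conjE) (rule OS_conc VG_conc; blast)+

end
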